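(* Every 3-connected non-complete planar graph is degree-truncated DP-$16$-colourable.
   Context: Graphs are finite and simple. A cover of a graph $G$ is a pair $(L,M)$, where $L=\{L(v): v\in V(G)\}$ is a family of pairwise disjoint sets, and $M=\{M_e: e\in E(G)\}$, where for each edge $e=uv$, $M_e$ is a matching (not necessarily perfect) between $L(u)$ and $L(v)$. For $f:V(G)\to\mathbb{N}$, $(L,M)$ is an $f$-cover if $|L(v)|\ge f(v)$ for every vertex $v$. An $(L,M)$-colouring of $G$ is a mapping $\phi:V(G)\to\bigcup_{v}L(v)$ such that $\phi(v)\in L(v)$ for every vertex $v$ and $\phi(u)\phi(v)\notin M_e$ for every edge $e=uv$. $G$ is DP-$f$-colourable if $G$ has an $(L,M)$-colouring for every $f$-cover $(L,M)$. For a positive integer $k$, $G$ is degree-truncated DP-$k$-colourable if $G$ is DP-$f$-colourable for $f(v)=\min\{k,d_G(v)\}$, where $d_G(v)$ is the degree of $v$ in $G$. *)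

theory Defs
  imports "HOL-Analysis.Analysis" "HOL-Library.Disjoint_Sets" "Graph_Theory.Graph_Theory"
begin

text \<open>
  Finite simple graphs are the loop-free symmetric finite digraphs of \<^locale>\<open>pair_graph\<close>, in
  which an undirected edge $uv$ is the pair of arcs $(u,v)$, $(v,u)$. Data attached to an edge
  is indexed by the two-element set $\{u,v\}$, so that it does not depend on the orientation.
\<close>

definition edges :: "'a pair_pre_digraph \<Rightarrow> 'a set set" where
  "edges G = {{u, v} | u v. (u, v) \<in> parcs G}"

text \<open>In a symmetric digraph the out-neighbours of a vertex are exactly its neighbours.\<close>

definition vertex_degree :: "'a pair_pre_digraph \<Rightarrow> 'a \<Rightarrow> nat" where
  "vertex_degree G v = out_degree (with_proj G) v"

definition complete_graph :: "'a pair_pre_digraph \<Rightarrow> bool" where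
  "complete_graph G \<longleftrightarrow> complete_digraph (card (pverts G)) (with_proj G)"

definition k_connected :: "nat \<Rightarrow> 'a pair_pre_digraph \<Rightarrow> bool" where
  "k_connected k G \<longleftrightarrow>
     k < card (pverts G) \<and>
     (\<forall>S \<subseteq> pverts G. card S < k \<longrightarrow>
        Digraph_Component.connected (with_proj G \<restriction> (pverts G - S)))"


text \<open>
  A drawing in the plane: \<open>p\<close> places the vertices and \<open>c e\<close> is a simple (non-closed) curve
  joining the two ends of the edge \<open>e\<close>. Curves meet vertices and each other only at common ends.
\<close>

definition plane_drawing ::
    "'a pair_pre_digraph \<Rightarrow> ('a \<Rightarrow> complex) \<Rightarrow> ('a set \<Rightarrow> real \<Rightarrow> complex) \<Rightarrow> bool" where
  "plane_drawing G p c \<longleftrightarrow>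
     inj_on p (pverts G) \<and>
     (\<forall>e \<in> edges G.
        arc (c e) \<and> {pathstart (c e), pathfinish (c e)} = p ` e \<and>
        path_image (c e) \<inter> p ` pverts G = p ` e) \<and>
     (\<forall>e \<in> edges G. \<forall>e' \<in> edges G. e \<noteq> e' \<longrightarrow>
        path_image (c e) \<inter> path_image (c e') = p ` (e \<inter> e'))"

definition planar :: "'a pair_pre_digraph \<Rightarrow> bool" where
  "planar G \<longleftrightarrow> (\<exists>p c. plane_drawing G p c)"


definition matching_between :: "'b set \<Rightarrow> 'b set \<Rightarrow> 'b set set \<Rightarrow> bool" where
  "matching_between A B N \<longleftrightarrow>
     (\<forall>m \<in> N. \<exists>x \<in> A. \<exists>y \<in> B. m = {x, y}) \<and> pairwise disjnt N"

definition cover :: "'a pair_pre_digraph \<Rightarrow> ('a \<Rightarrow> 'b set) \<Rightarrow> ('a set \<Rightarrow> 'b set set) \<Rightarrow> bool" where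
  "cover G L M \<longleftrightarrow>
     disjoint_family_on L (pverts G) \<and>
     (\<forall>(u, v) \<in> parcs G. matching_between (L u) (L v) (M {u, v}))"

text \<open>The sets \<open>L v\<close> may be infinite; the guard is needed because \<^const>\<open>card\<close> is 0 on them.\<close>

definition f_cover ::
    "('a \<Rightarrow> nat) \<Rightarrow> 'a pair_pre_digraph \<Rightarrow> ('a \<Rightarrow> 'b set) \<Rightarrow> ('a set \<Rightarrow> 'b set set) \<Rightarrow> bool" where
  "f_cover f G L M \<longleftrightarrow>
     cover G L M \<and> (\<forall>v \<in> pverts G. finite (L v) \<longrightarrow> f v \<le> card (L v))"

definition cover_colouring ::
    "'a pair_pre_digraph \<Rightarrow> ('a \<Rightarrow> 'b set) \<Rightarrow> ('a set \<Rightarrow> 'b set set) \<Rightarrow> ('a \<Rightarrow> 'b) \<Rightarrow> bool" where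
  "cover_colouring G L M \<phi> \<longleftrightarrow>
     (\<forall>v \<in> pverts G. \<phi> v \<in> L v) \<and> (\<forall>(u, v) \<in> parcs G. {\<phi> u, \<phi> v} \<notin> M {u, v})"

text \<open>
  The type argument \<open>'b\<close> is the type the colours are drawn from. It is a parameter because a
  definition cannot quantify over types; a theorem stated for a type variable \<open>'b\<close> covers all of
  them.
\<close>

definition DP_colourable ::
    "'b itself \<Rightarrow> ('a \<Rightarrow> nat) \<Rightarrow> 'a pair_pre_digraph \<Rightarrow> bool" where
  "DP_colourable (_ :: 'b itself) f G \<longleftrightarrow>
     (\<forall>(L :: 'a \<Rightarrow> 'b set) M. f_cover f G L M \<longrightarrow> (\<exists>\<phi>. cover_colouring G L M \<phi>))"

definition degree_truncated_DP_colourable ::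
    "'b itself \<Rightarrow> nat \<Rightarrow> 'a pair_pre_digraph \<Rightarrow> bool" where
  "degree_truncated_DP_colourable (T :: 'b itself) k G \<longleftrightarrow>
     DP_colourable T (\<lambda>v. min k (vertex_degree G v)) G"

end

theory Submission
  imports Defs
begin

text \<open>
  Planarity is used only through the absence of K33 models: a K33 model in a plane drawing would give a
  Jordan curve through two of its sides, contradicting Janiszewski's theorem. Hence a subgraph on n
  vertices has at most 3n - 5 edges, and bipartite minors satisfy e \<le> 2n - 4.

  Let B be the set of vertices of degree at least 16. The other vertices form islands Q, the components of
  G - B, whose vertices keep at least as many colours as they have neighbours in Q after B is coloured.
  Such lists are bad only in rigid circumstances: in an end (leaf block) of Q all degrees agree, and if they
  are at least 3 then the end is a clique. So a vertex v of B that is coloured last among suitable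
  neighbours X of Q saves Q by avoiding few colours (its cost): one if v has neighbours and non-neighbours
  in the end, one more than the degree if v is adjacent to all of it, and never more than five for X = N(Q).

  Islands own units, placed on B so that each vertex carries at most two of them (Hall's theorem and the
  bipartite edge bound), and for each island the total cost over a suitable X is at most five times the
  number of its units on X; this is a case analysis over the ends. Hence in each nonempty subset D of B the
  degrees within D together with the costs of the islands sum to less than 16 |D|. Some vertex of D thus has
  a free colour if it is coloured last, and B is coloured by induction so that all islands can be completed.
\<close>

section \<open>Connected sets and K33 models\<close>

text \<open>The number 16 is 6 + 2 * 5: inside a set of big vertices the degrees average less than
  6, and each big vertex carries at most two units, each of which pays for five colours. The
  obstacle is that the order in which B is coloured comes from averaging over subsets, so it is
  unknown which neighbour of an island is coloured last. Hence every member of X must be able to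
  save the island, and all their costs have to be paid. Moreover Hall's theorem places the units
  before X is chosen, so a suitable X must exist for every placement. The bound e \<le> 2n - 4
  grants a connected piece with neighbours N only card N - 2 units. Where this is too little, an
  island is cut into two disjoint connected pieces that see the same neighbours; or, if only two
  neighbours matter, the island is shown to separate them, which makes one extra unit affordable. In
  the remaining cases 3-connectivity provides a connected set outside the island that completes a
  K33 model.\<close>

definition touch :: "('a \<times> 'a) set \<Rightarrow> 'a set \<Rightarrow> 'a set \<Rightarrow> bool" where
  "touch A S T \<longleftrightarrow> (\<exists>x\<in>S. \<exists>y\<in>T. (x, y) \<in> A)"

text \<open>Connectedness is expressed by cuts; the empty set is not connected.\<close>
definition conn :: "('a \<times> 'a) set \<Rightarrow> 'a set \<Rightarrow> bool" where
  "conn A S \<longleftrightarrow> S \<noteq> {} \<and> (\<forall>T. T \<subseteq> S \<and> T \<noteq> {} \<and> T \<noteq> S \<longrightarrow> touch A T (S - T))"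

definition component :: "('a \<times> 'a) set \<Rightarrow> 'a set \<Rightarrow> 'a \<Rightarrow> 'a set" where
  "component A S x = \<Union>{T. conn A T \<and> T \<subseteq> S \<and> x \<in> T}"

text \<open>A minor given by its six branch sets; stated in this way it involves no
  contraction.\<close>

definition k33 where
  "k33 A X1 X2 X3 Y1 Y2 Y3 \<longleftrightarrow>
     (\<forall>Z\<in>{X1,X2,X3,Y1,Y2,Y3}. conn A Z) \<and>
     X1 \<inter> X2 = {} \<and> X1 \<inter> X3 = {} \<and> X2 \<inter> X3 = {} \<and> Y1 \<inter> Y2 = {} \<and> Y1 \<inter> Y3 = {} \<and> Y2 \<inter> Y3 = {} \<and>
     (\<forall>X\<in>{X1,X2,X3}. \<forall>Y\<in>{Y1,Y2,Y3}. X \<inter> Y = {} \<and> touch A X Y)"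

definition k33_free :: "('a \<times> 'a) set \<Rightarrow> bool" where
  "k33_free A \<longleftrightarrow> (\<nexists>X1 X2 X3 Y1 Y2 Y3. k33 A X1 X2 X3 Y1 Y2 Y3)"

lemma k33_freeD:
  assumes "k33_free A"
    "conn A X1" "conn A X2" "conn A X3" "conn A Y1" "conn A Y2" "conn A Y3"
    "touch A X1 Y1" "touch A X1 Y2" "touch A X1 Y3" "touch A X2 Y1" "touch A X2 Y2" "touch A X2 Y3"
    "touch A X3 Y1" "touch A X3 Y2" "touch A X3 Y3"
    "X1 \<inter> X2 = {}" "X1 \<inter> X3 = {}" "X2 \<inter> X3 = {}" "Y1 \<inter> Y2 = {}" "Y1 \<inter> Y3 = {}" "Y2 \<inter> Y3 = {}"
    "X1 \<inter> Y1 = {}" "X1 \<inter> Y2 = {}" "X1 \<inter> Y3 = {}" "X2 \<inter> Y1 = {}" "X2 \<inter> Y2 = {}" "X2 \<inter> Y3 = {}"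
    "X3 \<inter> Y1 = {}" "X3 \<inter> Y2 = {}" "X3 \<inter> Y3 = {}"
  shows False
proof -
  have "k33 A X1 X2 X3 Y1 Y2 Y3" using assms(2-) unfolding k33_def by simp
  with assms(1) show False unfolding k33_free_def by blast
qed

lemma touch_commute: "sym A \<Longrightarrow> touch A S T \<longleftrightarrow> touch A T S"
  unfolding touch_def by (meson symE)

lemma touch_mono: "touch A S T \<Longrightarrow> S \<subseteq> S' \<Longrightarrow> T \<subseteq> T' \<Longrightarrow> touch A S' T'"
  unfolding touch_def by blast

lemma touchI: "(x, y) \<in> A \<Longrightarrow> x \<in> S \<Longrightarrow> y \<in> T \<Longrightarrow> touch A S T"
  unfolding touch_def by blast

lemma touch_singleton [simp]: "touch A {x} {y} \<longleftrightarrow> (x, y) \<in> A"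
  unfolding touch_def by blast

lemma conn_nonempty: "conn A S \<Longrightarrow> S \<noteq> {}"
  unfolding conn_def by blast

lemma connD: "conn A S \<Longrightarrow> T \<subseteq> S \<Longrightarrow> T \<noteq> {} \<Longrightarrow> T \<noteq> S \<Longrightarrow> touch A T (S - T)"
  unfolding conn_def by blast

lemma conn_singleton [simp]: "conn A {x}"
  unfolding conn_def by blast

lemma conn_Un:
  assumes A: "sym A" and S: "conn A S" and T: "conn A T" and ST: "S \<inter> T \<noteq> {} \<or> touch A S T"
  shows "conn A (S \<union> T)"
  unfolding conn_def
proof (intro conjI allI impI)
  show "S \<union> T \<noteq> {}" using conn_nonempty[OF S] by blast
  fix U assume U: "U \<subseteq> S \<union> T \<and> U \<noteq> {} \<and> U \<noteq> S \<union> T"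
  show "touch A U (S \<union> T - U)"
  proof (rule ccontr)
    assume n: "\<not> touch A U (S \<union> T - U)"
    have a: "U \<inter> S = {} \<or> U \<inter> S = S"
      using n connD[OF S, of "U \<inter> S"] unfolding touch_def by blast
    have b: "U \<inter> T = {} \<or> U \<inter> T = T"
      using n connD[OF T, of "U \<inter> T"] unfolding touch_def by blast
    from a b U consider "S \<subseteq> U" "U \<inter> T = {}" | "T \<subseteq> U" "U \<inter> S = {}" by blast
    then show False
    proof cases
      case 1
      with ST have "touch A S T" by blast
      with 1 n show False unfolding touch_def by blast
    next
      case 2
      with ST have "touch A T S" using touch_commute[OF A] by blast
      with 2 n show False unfolding touch_def by blast
    qed
  qed
qed

lemma conn_insert: "sym A \<Longrightarrow> conn A S \<Longrightarrow> touch A {x} S \<Longrightarrow> conn A (insert x S)"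
  using conn_Un[of A "{x}" S] by simp

lemma conn_pair: "sym A \<Longrightarrow> (x, y) \<in> A \<Longrightarrow> conn A {x, y}"
  using conn_insert[of A "{y}" x] by simp

lemma conn_Union:
  assumes F: "\<And>S. S \<in> F \<Longrightarrow> conn A S \<and> x \<in> S" and ne: "F \<noteq> {}"
  shows "conn A (\<Union>F)"
  unfolding conn_def
proof (intro conjI allI impI)
  show "\<Union>F \<noteq> {}" using F ne by blast
  fix U assume U: "U \<subseteq> \<Union>F \<and> U \<noteq> {} \<and> U \<noteq> \<Union>F"
  show "touch A U (\<Union>F - U)"
  proof (rule ccontr)
    assume n: "\<not> touch A U (\<Union>F - U)"
    have a: "U \<inter> S = {} \<or> S \<subseteq> U" if "S \<in> F" for S
    proof (rule ccontr)
      assume "\<not> (U \<inter> S = {} \<or> S \<subseteq> U)"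
      then have "touch A (U \<inter> S) (S - U \<inter> S)"
        using connD[of A S "U \<inter> S"] F[OF that] by blast
      with n that show False unfolding touch_def by blast
    qed
    show False
    proof (cases "x \<in> U")
      case True with a F have "\<Union>F \<subseteq> U" by blast with U show False by blast
    next
      case False with a F have "U \<inter> S = {}" if "S \<in> F" for S using that by blast
      with U show False by blast
    qed
  qed
qed

text \<open>A cut of the union that splits no \<open>g z\<close> comes from a subset of X, and
  connectedness of X in \<open>A'\<close> supplies an arc leaving that subset.\<close>

lemma conn_image_Union:
  assumes X: "conn A' X" and g: "\<And>z. z \<in> X \<Longrightarrow> conn A (g z)"
    and t: "\<And>z z'. (z, z') \<in> A' \<Longrightarrow> z \<in> X \<Longrightarrow> z' \<in> X \<Longrightarrow> touch A (g z) (g z')"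
  shows "conn A (\<Union>z\<in>X. g z)" (is "conn A ?U")
  unfolding conn_def
proof (intro conjI allI impI)
  show "?U \<noteq> {}" using conn_nonempty[OF X] conn_nonempty[OF g] by blast
  fix T assume T: "T \<subseteq> ?U \<and> T \<noteq> {} \<and> T \<noteq> ?U"
  show "touch A T (?U - T)"
  proof (rule ccontr)
    assume n: "\<not> touch A T (?U - T)"
    have a: "T \<inter> g z = {} \<or> g z \<subseteq> T" if "z \<in> X" for z
    proof (rule ccontr)
      assume "\<not> (T \<inter> g z = {} \<or> g z \<subseteq> T)"
      then have "touch A (T \<inter> g z) (g z - T \<inter> g z)"
        using connD[OF g[OF that], of "T \<inter> g z"] by blast
      with n that show False unfolding touch_def by blast
    qed
    define Z where "Z = {z\<in>X. g z \<subseteq> T}"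
    have "Z \<noteq> {}" using T a unfolding Z_def by blast
    moreover have "Z \<noteq> X" using T unfolding Z_def by blast
    ultimately have "touch A' Z (X - Z)" using connD[OF X, of Z] unfolding Z_def by blast
    then obtain z z' where z: "z \<in> Z" "z' \<in> X - Z" "(z, z') \<in> A'" unfolding touch_def by blast
    then have "touch A (g z) (g z')" using t unfolding Z_def by blast
    moreover have "g z \<subseteq> T" "g z' \<inter> T = {}" using z a unfolding Z_def by blast+
    ultimately show False using n z unfolding touch_def by blast
  qed
qed

text \<open>Models compose: replacing each vertex z of a model in \<open>A'\<close> by its branch
  set \<open>g z\<close> gives a model in A. Every vertex of a branch set has an arc, so
  \<open>g\<close> is only asked to behave well on \<open>Field A'\<close>.\<close>

lemma k33_free_minor:
  assumes free: "k33_free A"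
    and g: "\<And>z. z \<in> Field A' \<Longrightarrow> conn A (g z)"
    and dj: "\<And>z z'. z \<in> Field A' \<Longrightarrow> z' \<in> Field A' \<Longrightarrow> z \<noteq> z' \<Longrightarrow> g z \<inter> g z' = {}"
    and t: "\<And>z z'. (z, z') \<in> A' \<Longrightarrow> touch A (g z) (g z')"
  shows "k33_free A'"
  unfolding k33_free_def
proof
  assume "\<exists>X1 X2 X3 Y1 Y2 Y3. k33 A' X1 X2 X3 Y1 Y2 Y3"
  then obtain X1 X2 X3 Y1 Y2 Y3 where k: "k33 A' X1 X2 X3 Y1 Y2 Y3" by blast
  have all: "\<forall>Z\<in>{X1,X2,X3,Y1,Y2,Y3}. conn A' Z" using k unfolding k33_def by (rule conjunct1)
  have fld: "Z \<subseteq> Field A'" if Z: "Z \<in> {X1,X2,X3,Y1,Y2,Y3}" for Z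
  proof
    fix z assume z: "z \<in> Z"
    show "z \<in> Field A'"
    proof (cases "Z = {z}")
      case True
      \<comment> \<open>If a branch set has a single element, its arc leads to another branch set;
        these five pairs cover all six sets.\<close>
      from k have "touch A' X1 Y1" "touch A' X2 Y1" "touch A' X3 Y1" "touch A' X1 Y2" "touch A' X1 Y3"
        unfolding k33_def by simp_all
      with Z have "\<exists>W. touch A' Z W \<or> touch A' W Z" by (elim insertE) auto
      with True show ?thesis unfolding touch_def Field_def by auto
    next
      case False
      have "conn A' Z" using Z all by (rule bspec[rotated])
      from connD[OF this, of "{z}"] z False show ?thesis unfolding touch_def Field_def by blast
    qed
  qed
  define G where "G Z = (\<Union>z\<in>Z. g z)" for Z
  have c: "conn A (G Z)" if Z: "Z \<in> {X1,X2,X3,Y1,Y2,Y3}" for Z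
    unfolding G_def
  proof (rule conn_image_Union[of A' Z])
    show "conn A' Z" using Z all by (rule bspec[rotated])
  qed (use fld[OF Z] g t in auto)
  have d: "G Z \<inter> G Z' = {}" if "Z \<in> {X1,X2,X3,Y1,Y2,Y3}" "Z' \<in> {X1,X2,X3,Y1,Y2,Y3}" "Z \<inter> Z' = {}" for Z Z'
  proof -
    have "g z \<inter> g z' = {}" if "z \<in> Z" "z' \<in> Z'" for z z'
      using dj[of z z'] fld[OF \<open>Z \<in> _\<close>] fld[OF \<open>Z' \<in> _\<close>] that \<open>Z \<inter> Z' = {}\<close> by blast
    then show ?thesis unfolding G_def by blast
  qed
  have tt: "touch A (G Z) (G Z')" if "touch A' Z Z'" for Z Z'
  proof -
    from that obtain z z' where "z \<in> Z" "z' \<in> Z'" "(z, z') \<in> A'" unfolding touch_def by blast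
    with t[of z z'] show ?thesis unfolding G_def by (auto intro: touch_mono)
  qed
  from k have m: "X1 \<inter> X2 = {}" "X1 \<inter> X3 = {}" "X2 \<inter> X3 = {}" "Y1 \<inter> Y2 = {}" "Y1 \<inter> Y3 = {}" "Y2 \<inter> Y3 = {}"
    "\<And>X Y. X \<in> {X1,X2,X3} \<Longrightarrow> Y \<in> {Y1,Y2,Y3} \<Longrightarrow> X \<inter> Y = {} \<and> touch A' X Y"
    unfolding k33_def by auto
  show False
    by (rule k33_freeD[OF free, of "G X1" "G X2" "G X3" "G Y1" "G Y2" "G Y3"]; (rule c | rule d | rule tt); simp add: m)
qed

lemma k33_free_subset: "k33_free A \<Longrightarrow> A' \<subseteq> A \<Longrightarrow> k33_free A'"
  by (rule k33_free_minor[of A A' "\<lambda>z. {z}"]) auto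

section \<open>Components of a vertex set\<close>

lemma component_conn: "x \<in> S \<Longrightarrow> conn A (component A S x)"
  unfolding component_def by (rule conn_Union[of _ _ x]) (auto intro!: exI[of _ "{x}"])

lemma component_subset: "component A S x \<subseteq> S"
  unfolding component_def by blast

lemma component_self: "x \<in> S \<Longrightarrow> x \<in> component A S x"
  unfolding component_def by (auto intro!: exI[of _ "{x}"])

lemma component_max: "conn A T \<Longrightarrow> T \<subseteq> S \<Longrightarrow> x \<in> T \<Longrightarrow> T \<subseteq> component A S x"
  unfolding component_def by blast

lemma component_absorb:
  assumes A: "sym A" and T: "conn A T" "T \<subseteq> S" and t: "T \<inter> component A S x \<noteq> {} \<or> touch A (component A S x) T"
    and x: "x \<in> S"
  shows "T \<subseteq> component A S x"
proof -
  have "conn A (component A S x \<union> T)"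
    by (rule conn_Un[OF A component_conn[OF x] T(1)]) (use t in blast)
  from component_max[OF this] T(2) component_subset[of A S x] component_self[OF x, of A] show ?thesis by blast
qed

lemma component_closed:
  assumes "sym A" "x \<in> S" shows "\<not> touch A (component A S x) (S - component A S x)"
proof
  assume "touch A (component A S x) (S - component A S x)"
  then obtain y where y: "y \<in> S" "y \<notin> component A S x" "touch A (component A S x) {y}" unfolding touch_def by blast
  then have "{y} \<subseteq> component A S x" by (intro component_absorb) (use assms in auto)
  with y show False by blast
qed

lemma component_eq:
  assumes A: "sym A" and x: "x \<in> S" and y: "y \<in> component A S x"
  shows "component A S y = component A S x"
proof
  have ys: "y \<in> S" using y component_subset[of A S x] by auto
  have "component A S y \<inter> component A S x \<noteq> {}" using y component_self[OF ys, of A] by auto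
  then show "component A S y \<subseteq> component A S x"
    using component_absorb[OF A component_conn[OF ys] component_subset _ x] by simp
  show "component A S x \<subseteq> component A S y"
    by (rule component_max[OF component_conn[OF x] component_subset y])
qed

text \<open>T is attached to the rest at w alone. The side of a cut of S - T that misses w has no
  arc to T, so the arc leaving it in S already stays in S - T.\<close>

lemma conn_Diff_pendant:
  assumes A: "sym A" and S: "conn A S" and w: "w \<in> S - T" and only: "\<And>x. x \<in> S - T \<Longrightarrow> touch A {x} T \<Longrightarrow> x = w"
  shows "conn A (S - T)"
  unfolding conn_def
proof (intro conjI allI impI)
  show "S - T \<noteq> {}" using w by blast
  fix U assume U: "U \<subseteq> S - T \<and> U \<noteq> {} \<and> U \<noteq> S - T"
  show "touch A U (S - T - U)"
  proof (cases "w \<in> U")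
    case True
    have "S - T - U \<noteq> {}" "S - T - U \<noteq> S" using U by blast+
    then have "touch A (S - T - U) (S - (S - T - U))" using connD[OF S, of "S - T - U"] by blast
    then obtain x y where xy: "x \<in> S - T - U" "y \<in> S" "y \<notin> S - T - U" "(x, y) \<in> A" unfolding touch_def by blast
    have "y \<notin> T" using only[of x] xy True unfolding touch_def by blast
    with xy have "(y, x) \<in> A" "y \<in> U" using symD[OF A] by blast+
    with xy show ?thesis unfolding touch_def by blast
  next
    case False
    have "touch A U (S - U)" using connD[OF S, of U] U w False by blast
    then obtain x y where xy: "x \<in> U" "y \<in> S" "y \<notin> U" "(x, y) \<in> A" unfolding touch_def by blast
    have "y \<notin> T" using only[of x] xy U False unfolding touch_def by blast
    with xy show ?thesis unfolding touch_def by blast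
  qed
qed

lemma conn_subset_field:
  assumes "conn A Y" "touch A Y Z" "A \<subseteq> V \<times> V"
  shows "Y \<subseteq> V"
proof
  fix x assume x: "x \<in> Y"
  show "x \<in> V"
  proof (cases "Y = {x}")
    case True then show ?thesis using assms(2,3) unfolding touch_def by blast
  next
    case False
    then have "touch A {x} (Y - {x})" using connD[OF assms(1), of "{x}"] x by blast
    then show ?thesis using assms(3) unfolding touch_def by blast
  qed
qed

section \<open>Edge bounds without K33 models\<close>

text \<open>A counterexample to an edge bound can be thinned edge by edge until it exceeds the bound
  by at most two arcs. Only then is the number of arcs bounded above, which yields a vertex of small
  degree.\<close>

lemma sym_subset_between:
  assumes "finite A" "sym A" "m < card A"
  shows "\<exists>B\<subseteq>A. sym B \<and> m < card B \<and> card B \<le> m + 2"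
  using assms
proof (induction "card A" arbitrary: A rule: less_induct)
  case less
  show ?case
  proof (cases "card A \<le> m + 2")
    case True then show ?thesis using less.prems by blast
  next
    case False
    then have "A \<noteq> {}" by auto
    then obtain x y where xy: "(x, y) \<in> A" by fastforce
    define B where "B = A - {(x, y), (y, x)}"
    have yx: "(y, x) \<in> A" using xy less.prems(2) by (simp add: symD)
    have "card {(x, y), (y, x)} \<le> 2" using card_length[of "[(x, y), (y, x)]"] by simp
    then have c: "card A \<le> card B + 2"
      using diff_card_le_card_Diff[of "{(x, y), (y, x)}" A] unfolding B_def by simp
    have s: "sym B" using less.prems(2) unfolding B_def sym_def by blast
    have "B \<subset> A" using xy unfolding B_def by blast
    then have "card B < card A" using less.prems(1) by (simp add: psubset_card_mono)
    moreover have "finite B" "m < card B" using less.prems(1) c False unfolding B_def by auto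
    ultimately obtain B' where "B' \<subseteq> B" "sym B' \<and> m < card B' \<and> card B' \<le> m + 2"
      using less.hyps[of B] s by blast
    then show ?thesis unfolding B_def by blast
  qed
qed

lemma card_eq_sum_degree:
  assumes "finite V" "A \<subseteq> V \<times> V"
  shows "card A = (\<Sum>v\<in>V. card (A `` {v}))"
proof -
  have "A = Sigma V (\<lambda>v. A `` {v})" using assms(2) by auto
  moreover have "finite (A `` {v})" if "v \<in> V" for v
    by (rule finite_subset[OF _ assms(1)]) (use assms(2) in auto)
  ultimately show ?thesis using card_SigmaI[OF assms(1), of "\<lambda>v. A `` {v}"] by simp
qed

lemma ex_small_degree:
  assumes "finite V" "A \<subseteq> V \<times> V" "card A < k * card V"
  shows "\<exists>v\<in>V. card (A `` {v}) < k"
proof (rule ccontr)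
  assume "\<not> ?thesis"
  then have "k * card V \<le> (\<Sum>v\<in>V. card (A `` {v}))"
    using sum_bounded_below[of V k "\<lambda>v. card (A `` {v})"] by (simp add: not_less mult.commute)
  with card_eq_sum_degree[OF assms(1,2)] assms(3) show False by simp
qed

lemma card_arcs_remove:
  assumes "finite V" "A \<subseteq> V \<times> V" "sym A"
  shows "card A \<le> card (A \<inter> (V - {v}) \<times> (V - {v})) + 2 * card (A `` {v})"
proof -
  let ?U = "A `` {v}"
  have "finite ?U" by (rule finite_subset[OF _ assms(1)]) (use assms(2) in auto)
  have "A \<subseteq> A \<inter> (V - {v}) \<times> (V - {v}) \<union> ({v} \<times> ?U \<union> ?U \<times> {v})"
    using assms(2) symD[OF assms(3)] by auto
  then have "card A \<le> card (A \<inter> (V - {v}) \<times> (V - {v}) \<union> ({v} \<times> ?U \<union> ?U \<times> {v}))"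
    by (rule card_mono[rotated]) (use \<open>finite ?U\<close> assms(1) in auto)
  also have "\<dots> \<le> card (A \<inter> (V - {v}) \<times> (V - {v})) + (card ({v} \<times> ?U) + card (?U \<times> {v}))"
    by (meson add_left_mono card_Un_le le_trans)
  finally show ?thesis by (simp add: card_cartesian_product)
qed

text \<open>Counting for two graphs glued along common vertices: the arcs in S occur in both
  parts.\<close>

lemma card_arcs_split:
  assumes fin: "finite V" and A: "A \<subseteq> V \<times> V" and sub: "A \<subseteq> V1 \<times> V1 \<union> V2 \<times> V2" and S: "S \<subseteq> A \<inter> V1 \<times> V1 \<inter> V2 \<times> V2"
  shows "card A + card S \<le> card (A \<inter> V1 \<times> V1) + card (A \<inter> V2 \<times> V2)"
proof -
  have f: "finite A" using fin A finite_subset by blast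
  have "card (A \<inter> V1 \<times> V1) + card (A \<inter> V2 \<times> V2) =
      card (A \<inter> V1 \<times> V1 \<union> A \<inter> V2 \<times> V2) + card (A \<inter> V1 \<times> V1 \<inter> (A \<inter> V2 \<times> V2))"
    by (rule card_Un_Int) (use f in auto)
  moreover have "A \<inter> V1 \<times> V1 \<union> A \<inter> V2 \<times> V2 = A" using sub by blast
  moreover have "card S \<le> card (A \<inter> V1 \<times> V1 \<inter> (A \<inter> V2 \<times> V2))"
    by (rule card_mono) (use f S in auto)
  ultimately show ?thesis by simp
qed

text \<open>Contracting a connected set to its element x has this form, D being the other elements.\<close>
definition merge :: "('a \<times> 'a) set \<Rightarrow> 'a set \<Rightarrow> 'a \<Rightarrow> 'a set \<Rightarrow> ('a \<times> 'a) set" where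
  "merge A D x U = (A - (D \<times> UNIV \<union> UNIV \<times> D)) \<union> ({x} \<times> U \<union> U \<times> {x})"

lemma k33_free_merge:
  assumes "k33_free A" "sym A" "conn A (insert x D)" "x \<notin> D" "x \<notin> U" "U \<inter> D = {}"
    and U: "\<And>u. u \<in> U \<Longrightarrow> touch A {u} (insert x D)"
  shows "k33_free (merge A D x U)"
proof (rule k33_free_minor[OF assms(1)])
  let ?g = "\<lambda>z. if z = x then insert x D else {z}"
  fix z z'
  { assume "z \<in> Field (merge A D x U)" show "conn A (?g z)" using assms(3) by simp }
  { assume "z \<in> Field (merge A D x U)" "z' \<in> Field (merge A D x U)" "z \<noteq> z'"
    moreover have "Field (merge A D x U) \<inter> D = {}" using assms(4,6) unfolding merge_def Field_def by auto
    ultimately show "?g z \<inter> ?g z' = {}" by auto }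
  { assume "(z, z') \<in> merge A D x U"
    then consider "(z, z') \<in> A" | "z = x" "z' \<in> U" | "z' = x" "z \<in> U" unfolding merge_def by blast
    then show "touch A (?g z) (?g z')"
    proof cases
      case 1 then show ?thesis unfolding touch_def by auto
    next
      case 2 then show ?thesis using U[of z'] assms(5) touch_commute[OF assms(2)] by auto
    next
      case 3 then show ?thesis using U[of z] assms(5) by auto
    qed }
qed

text \<open>Each element of U outside C gives a new edge at x, that is two arcs; only the common
  neighbours, collected in C, coincide with neighbours that x had before.\<close>

lemma card_merge:
  assumes fin: "finite A" and "finite U" and U: "x \<notin> U" "x \<notin> D" "U \<inter> D = {}" and C: "C \<subseteq> U" "A `` {x} \<inter> U \<subseteq> C" and "sym A"
  shows "card (A - (D \<times> UNIV \<union> UNIV \<times> D)) + 2 * card U \<le> card (merge A D x U) + 2 * card C"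
proof -
  let ?A1 = "A - (D \<times> UNIV \<union> UNIV \<times> D)" and ?W = "U - C"
  have fW: "finite ?W" using \<open>finite U\<close> by blast
  have "card (?A1 \<union> ({x} \<times> ?W \<union> ?W \<times> {x})) \<le> card (merge A D x U)"
    by (rule card_mono) (use fin \<open>finite U\<close> in \<open>auto simp: merge_def\<close>)
  moreover have "card (?A1 \<union> ({x} \<times> ?W \<union> ?W \<times> {x})) = card ?A1 + (card ({x} \<times> ?W) + card (?W \<times> {x}))"
  proof -
    have "card ({x} \<times> ?W \<union> ?W \<times> {x}) = card ({x} \<times> ?W) + card (?W \<times> {x})"
      by (rule card_Un_disjoint) (use fW U in auto)
    moreover have "?A1 \<inter> ({x} \<times> ?W \<union> ?W \<times> {x}) = {}" using C(2) symD[OF \<open>sym A\<close>] by blast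
    ultimately show ?thesis using card_Un_disjoint[of ?A1 "{x} \<times> ?W \<union> ?W \<times> {x}"] fin fW by simp
  qed
  moreover have "card ?W + card C = card U"
    using C(1) \<open>finite U\<close> by (metis card_Diff_subset card_mono finite_subset le_add_diff_inverse2)
  ultimately show ?thesis by (simp add: card_cartesian_product)
qed

lemma three_elements:
  assumes "3 \<le> card X" obtains x y z where "x \<in> X" "y \<in> X" "z \<in> X" "x \<noteq> y" "x \<noteq> z" "y \<noteq> z"
proof -
  obtain Y where "Y \<subseteq> X" "card Y = 3" using obtain_subset_with_card_n[OF assms] by blast
  then obtain x y z where "Y = {x, y, z}" "x \<noteq> y" "x \<noteq> z" "y \<noteq> z" by (metis card_3_iff)
  with \<open>Y \<subseteq> X\<close> that show ?thesis by blast
qed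

text \<open>The complete graph on five vertices, which has no K33 model, attains the bound.\<close>
theorem k33_free_card_arcs:
  fixes V :: "'a set"
  assumes "finite V" "A \<subseteq> V \<times> V" "sym A" "irrefl A" "k33_free A" "2 \<le> card V"
  shows "card A + 10 \<le> 6 * card V"
  using assms
proof (induction "card V" arbitrary: V A rule: less_induct)
  case less
  note fin = less.prems(1)
  show ?case
  proof (rule ccontr)
    assume "\<not> ?thesis"
    then have "6 * card V - 10 < card A" using less.prems(6) by simp
    then obtain E where E: "E \<subseteq> A" "sym E" "6 * card V - 10 < card E" "card E \<le> 6 * card V - 10 + 2"
      using sym_subset_between[of A "6 * card V - 10"] less.prems(1-3) finite_subset[of A "V \<times> V"] by blast
    have EV: "E \<subseteq> V \<times> V" and ir: "irrefl E" and free: "k33_free E"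
      using E(1) less.prems(2,4,5) k33_free_subset by (auto simp: irrefl_def)
    have fE: "finite E" using EV fin finite_subset by blast
    have noloop: "(x, x) \<notin> E" for x using ir by (simp add: irrefl_def)
    have es: "(y, x) \<in> E" if "(x, y) \<in> E" for x y using E(2) that by (rule symD)
    have fn: "finite (E `` {v})" for v by (rule finite_subset[OF _ fin]) (use EV in auto)
    have IH: "card E' + 10 \<le> 6 * card V'"
      if "card V' < card V" "finite V'" "E' \<subseteq> V' \<times> V'" "sym E'" "irrefl E'" "k33_free E'" "2 \<le> card V'" for V' :: "'a set" and E'
      by (rule less.hyps) (use that in auto)
    have IHi: "card (E \<inter> V' \<times> V') + 10 \<le> 6 * card V'" if "V' \<subset> V" "2 \<le> card V'" for V'
    proof (rule IH)
      show "card V' < card V" using that fin by (simp add: psubset_card_mono)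
      show "finite V'" using that fin finite_subset by blast
      show "sym (E \<inter> V' \<times> V')" using E(2) unfolding sym_def by blast
      show "irrefl (E \<inter> V' \<times> V')" using ir unfolding irrefl_def by blast
      show "k33_free (E \<inter> V' \<times> V')" by (rule k33_free_subset[OF free]) blast
    qed (use that in auto)
    have V3: "3 \<le> card V"
    proof (rule ccontr)
      assume "\<not> 3 \<le> card V"
      with less.prems(6) have c2: "card V = 2" by simp
      then obtain x y where V: "V = {x, y}" by (meson card_2_iff)
      have "E \<subseteq> {(x, y), (y, x)}" using EV noloop V by auto
      then have "card E \<le> card {(x, y), (y, x)}" by (rule card_mono[rotated]) simp
      also have "\<dots> \<le> 2" using card_length[of "[(x, y), (y, x)]"] by simp
      finally show False using E(3) c2 by simp
    qed
    \<comment> \<open>Contracting xy loses the two arcs of xy and two arcs for each common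
      neighbour. With at most two common neighbours these are at most 6 arcs, the allowance for one
      vertex.\<close>
    have com: "3 \<le> card (E `` {x} \<inter> E `` {y})" if xy: "(x, y) \<in> E" for x y
    proof (rule ccontr)
      assume "\<not> ?thesis"
      then have C2: "card (E `` {x} \<inter> E `` {y}) \<le> 2" by simp
      define U where "U = E `` {y} - {x}"
      have xny: "x \<noteq> y" using xy noloop by blast
      have yx: "(y, x) \<in> E" using xy es by blast
      have "card (merge E {y} x U) + 10 \<le> 6 * card (V - {y})"
      proof (rule IH)
        have yV: "y \<in> V" using xy EV by auto
        then show "card (V - {y}) < card V" by (rule card_Diff1_less[OF fin])
        show "2 \<le> card (V - {y})" using V3 yV fin by simp
        show "merge E {y} x U \<subseteq> (V - {y}) \<times> (V - {y})"
          using EV xny xy noloop unfolding merge_def U_def by auto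
        show "sym (merge E {y} x U)" using es unfolding merge_def sym_def by blast
        show "irrefl (merge E {y} x U)" using noloop unfolding merge_def irrefl_def U_def by auto
        show "k33_free (merge E {y} x U)"
        proof (rule k33_free_merge[OF free E(2)])
          show "conn E (insert x {y})" using conn_pair[OF E(2) xy] by simp
          show "touch E {u} (insert x {y})" if "u \<in> U" for u
            using that es unfolding U_def touch_def by blast
        qed (use xny noloop in \<open>auto simp: U_def\<close>)
      qed (use fin in auto)
      moreover have "card (E - ({y} \<times> UNIV \<union> UNIV \<times> {y})) + 2 * card U
          \<le> card (merge E {y} x U) + 2 * card (E `` {x} \<inter> E `` {y})"
        by (rule card_merge) (use fE fn xny noloop es E(2) in \<open>auto simp: U_def\<close>)
      moreover have "card E \<le> card (E \<inter> (V - {y}) \<times> (V - {y})) + 2 * card (E `` {y})"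
        by (rule card_arcs_remove[OF fin EV E(2)])
      moreover have "E \<inter> (V - {y}) \<times> (V - {y}) = E - ({y} \<times> UNIV \<union> UNIV \<times> {y})" using EV by auto
      moreover have "card (E `` {y}) = Suc (card U)"
        unfolding U_def using yx fn[of y] by (metis Image_singleton_iff card.remove)
      moreover have "card (V - {y}) = card V - 1" using xy EV fin by auto
      ultimately show False using C2 E(3) V3 by simp
    qed
    \<comment> \<open>Thinning has left at most 6n - 8 arcs, so the average degree is below
      6.\<close>
    have "card E < 6 * card V" using E(4) V3 by simp
    then obtain v where v: "v \<in> V" "card (E `` {v}) < 6" using ex_small_degree[OF fin EV] by blast
    let ?W = "E `` {v}"
    have Wne: "?W \<noteq> {}"
    proof
      assume e: "?W = {}"
      have "card (E \<inter> (V - {v}) \<times> (V - {v})) + 10 \<le> 6 * card (V - {v})"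
        by (rule IHi) (use v fin V3 in auto)
      moreover have "card E \<le> card (E \<inter> (V - {v}) \<times> (V - {v})) + 2 * card ?W"
        by (rule card_arcs_remove[OF fin EV E(2)])
      ultimately show False using e E(3) v fin V3 by simp
    qed
    have inW: "3 \<le> card (E `` {x} \<inter> ?W)" if "x \<in> ?W" for x
      using com[of v x] that by (simp add: Int_commute)
    have W4: "4 \<le> card ?W"
    proof -
      obtain x where x: "x \<in> ?W" using Wne by blast
      have "E `` {x} \<inter> ?W \<subseteq> ?W - {x}" using noloop by auto
      then have "card (E `` {x} \<inter> ?W) \<le> card (?W - {x})" by (rule card_mono[rotated]) (use fn in auto)
      with inW[OF x] x fn[of v] show ?thesis by (simp add: card_Diff_singleton)
    qed
    show False
    proof (cases "card ?W = 4")
      case False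
      then have W5: "card ?W = 5" using W4 v by simp
      \<comment> \<open>The neighbourhood has five vertices and minimum degree at least 3: a
        nonadjacent pair is joined to all of the other three, and without such a pair it is
        complete. Then v, p, q face the other three vertices in a K33 model.\<close>
      have "\<exists>p q. p \<in> ?W \<and> q \<in> ?W \<and> p \<noteq> q \<and> ?W - {p, q} \<subseteq> E `` {p} \<inter> E `` {q}"
      proof (cases "\<exists>p q. p \<in> ?W \<and> q \<in> ?W \<and> p \<noteq> q \<and> (p, q) \<notin> E")
        case True
        then obtain p q where pq: "p \<in> ?W" "q \<in> ?W" "p \<noteq> q" "(p, q) \<notin> E" by blast
        have c3: "card (?W - {p, q}) = 3" using pq W5 fn[of v] by (simp add: card_Diff_subset)
        have full: "E `` {r} \<inter> ?W = ?W - {p, q}" if "r = p \<or> r = q" for r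
        proof (rule card_seteq)
          show "finite (?W - {p, q})" using fn by blast
          show "E `` {r} \<inter> ?W \<subseteq> ?W - {p, q}" using that noloop pq es by auto
          have "r \<in> ?W" using that pq by blast
          then show "card (?W - {p, q}) \<le> card (E `` {r} \<inter> ?W)" using inW[of r] c3 by simp
        qed
        then show ?thesis using pq by blast
      next
        case False
        obtain p where p: "p \<in> ?W" using Wne by blast
        have "?W - {p} \<noteq> {}"
        proof
          assume "?W - {p} = {}"
          then have "?W \<subseteq> {p}" by blast
          then have "card ?W \<le> card {p}" by (rule card_mono[rotated]) simp
          with W5 show False by simp
        qed
        then obtain q where "q \<in> ?W" "p \<noteq> q" by blast
        with p False show ?thesis by blast
      qed
      then obtain p q where pq: "p \<in> ?W" "q \<in> ?W" "p \<noteq> q" "?W - {p, q} \<subseteq> E `` {p} \<inter> E `` {q}" by blast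
      have "card (?W - {p, q}) = 3" using pq W5 fn[of v] by (simp add: card_Diff_subset)
      then obtain r s t where rst: "?W - {p, q} = {r, s, t}" "r \<noteq> s" "r \<noteq> t" "s \<noteq> t" by (metis card_3_iff)
      have a: "(v, u) \<in> E" "(p, u) \<in> E" "(q, u) \<in> E" "p \<noteq> u" "q \<noteq> u" "v \<noteq> u" if "u \<in> {r, s, t}" for u
        using that pq rst(1) noloop by auto
      have b: "v \<noteq> p" "v \<noteq> q" using pq noloop by auto
      show False
        by (rule k33_freeD[OF free, of "{v}" "{p}" "{q}" "{r}" "{s}" "{t}"]) (use a b pq(3) rst(2-) in auto)
    next
      case True
      have adj: "(x, y) \<in> E" if "x \<in> ?W" "y \<in> ?W" "x \<noteq> y" for x y
      proof -
        have "E `` {x} \<inter> ?W = ?W - {x}"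
        proof (rule card_seteq)
          show "finite (?W - {x})" using fn by blast
          show "E `` {x} \<inter> ?W \<subseteq> ?W - {x}" using noloop by auto
          show "card (?W - {x}) \<le> card (E `` {x} \<inter> ?W)" using inW[OF that(1)] True that fn[of v] by simp
        qed
        with that show ?thesis by blast
      qed
      \<comment> \<open>Now v and its four neighbours form a complete graph on five
        vertices.\<close>
      define K where "K = insert v ?W"
      have KV: "K \<subseteq> V" using v EV unfolding K_def by auto
      have vW: "v \<notin> ?W" using noloop by auto
      have cK: "card K = 5" using True vW fn[of v] unfolding K_def by simp
      show False
      proof (cases "V = K")
        case VK: True
        have fK: "finite K" using KV fin finite_subset by blast
        have "E \<subseteq> Sigma K (\<lambda>x. K - {x})" using EV VK noloop by auto
        then have "card E \<le> card (Sigma K (\<lambda>x. K - {x}))" by (rule card_mono[rotated]) (rule finite_SigmaI, use fK in auto)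
        also have "\<dots> = (\<Sum>x\<in>K. card (K - {x}))" by (rule card_SigmaI) (use fK in auto)
        also have "\<dots> = (\<Sum>x\<in>K. 4)" using cK by (intro sum.cong) (auto simp: card_Diff_singleton)
        also have "\<dots> = 20" using cK by simp
        finally show False using E(3) VK cK by simp
      next
        case False
        then obtain z where z: "z \<in> V - K" using KV by blast
        define C where "C = component E (V - K) z"
        have C: "conn E C" "C \<subseteq> V - K" "C \<noteq> {}"
          using component_conn[OF z, of E] component_subset[of E "V - K" z] conn_nonempty unfolding C_def by auto
        \<comment> \<open>Three vertices of \<open>?W\<close> attached to C would face v, the fourth
          neighbour and C in a K33 model. So the graph splits at a pair S of adjacent vertices. The
          two bounds sum to 6n - 8, and the two arcs inside S are counted twice.\<close>
        define T where "T = {x \<in> ?W. touch E {x} C}"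
        have "card T \<le> 2"
        proof (rule ccontr)
          assume "\<not> card T \<le> 2"
          then have "3 \<le> card T" by simp
          then obtain t1 t2 t3 where t: "t1 \<in> T" "t2 \<in> T" "t3 \<in> T" "t1 \<noteq> t2" "t1 \<noteq> t3" "t2 \<noteq> t3"
            by (rule three_elements)
          have "\<not> ?W \<subseteq> {t1, t2, t3}"
          proof
            assume "?W \<subseteq> {t1, t2, t3}"
            then have "card ?W \<le> card {t1, t2, t3}" by (rule card_mono[rotated]) simp
            with True t show False by simp
          qed
          then obtain s where s: "s \<in> ?W" "s \<noteq> t1" "s \<noteq> t2" "s \<noteq> t3" by blast
          have a: "t1 \<in> ?W" "t2 \<in> ?W" "t3 \<in> ?W" "touch E {t1} C" "touch E {t2} C" "touch E {t3} C"
            using t unfolding T_def by auto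
          have "C \<inter> ?W = {}" "v \<notin> C" using C(2) unfolding K_def by auto
          then have b: "t1 \<notin> C" "t2 \<notin> C" "t3 \<notin> C" "s \<notin> C" "v \<notin> C" using a s by blast+
          have e: "(t1, v) \<in> E" "(t2, v) \<in> E" "(t3, v) \<in> E" using a es by auto
          have vt: "t1 \<noteq> v" "t2 \<noteq> v" "t3 \<noteq> v" "v \<noteq> s" using a s noloop by auto
          show False
            by (rule k33_freeD[OF free, of "{t1}" "{t2}" "{t3}" "{v}" "{s}" C])
              (use a b e vt s t C(1) adj in \<open>auto simp: Int_commute\<close>)
        qed
        moreover have fT: "T \<subseteq> ?W" unfolding T_def by auto
        ultimately obtain S where S: "T \<subseteq> S" "S \<subseteq> ?W" "card S = 2"
          using exists_subset_between[of T 2 ?W] True fn[of v] by auto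
        then obtain s s' where ss: "S = {s, s'}" "s \<noteq> s'" by (meson card_2_iff)
        have clos: "y \<in> C" if "x \<in> C" "y \<in> V - K" "(x, y) \<in> E" for x y
          using component_closed[OF E(2) z] that unfolding C_def touch_def by blast
        have CW: "C \<inter> ?W = {}" "v \<notin> C" using C(2) unfolding K_def by auto
        have fC: "finite C" using C(2) fin finite_subset by blast
        have one: "y \<in> C \<union> S" if x: "x \<in> C" and xy: "(x, y) \<in> E" for x y
        proof (cases "y \<in> K")
          case True
          have "y \<noteq> v" using xy es[OF xy] CW x by blast
          then have "y \<in> ?W" using True unfolding K_def by blast
          moreover have "touch E {y} C" using es[OF xy] x unfolding touch_def by blast
          ultimately show ?thesis using S unfolding T_def by blast
        next
          case False
          then show ?thesis using clos[OF x _ xy] xy EV by blast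
        qed
        have sub: "E \<subseteq> (C \<union> S) \<times> (C \<union> S) \<union> (V - C) \<times> (V - C)"
        proof
          fix e assume e: "e \<in> E"
          obtain x y where xy: "e = (x, y)" by force
          show "e \<in> (C \<union> S) \<times> (C \<union> S) \<union> (V - C) \<times> (V - C)"
            using one[of x y] one[of y x] es[of x y] e xy EV by (cases "x \<in> C"; cases "y \<in> C") auto
        qed
        have "card E + card {(s, s'), (s', s)} \<le>
            card (E \<inter> (C \<union> S) \<times> (C \<union> S)) + card (E \<inter> (V - C) \<times> (V - C))"
          by (rule card_arcs_split[OF fin EV sub]) (use ss S adj CW EV v in auto)
        moreover have "card {(s, s'), (s', s)} = 2" using ss by auto
        moreover have cCS: "card (C \<union> S) = card C + 2"
          using card_Un_disjoint[of C S] fC S CW fn[of v] finite_subset[of S ?W] by auto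
        moreover have "card (E \<inter> (C \<union> S) \<times> (C \<union> S)) + 10 \<le> 6 * card (C \<union> S)"
        proof (rule IHi)
          show "C \<union> S \<subset> V" using C(2) S EV v vW CW by blast
          show "2 \<le> card (C \<union> S)" using cCS by simp
        qed
        moreover have cVC: "card (V - C) + card C = card V"
          using C(2) fin fC by (metis Diff_subset card_Diff_subset card_mono le_add_diff_inverse2 subset_trans)
        moreover have "card (E \<inter> (V - C) \<times> (V - C)) + 10 \<le> 6 * card (V - C)"
        proof (rule IHi)
          show "V - C \<subset> V" using C by blast
          have "card K \<le> card (V - C)" by (rule card_mono) (use fin KV C(2) in auto)
          then show "2 \<le> card (V - C)" using cK by simp
        qed
        ultimately show False using E(3) by simp
      qed
    qed
  qed
qed

text \<open>A thinned counterexample has a vertex q of degree 3. If two of its neighbours b1, b2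
  have few common neighbours, the path b1, q, b2 is contracted; dropping the third edge at q keeps
  the graph bipartite. If they have three common neighbours, the graph splits along the K23 formed
  with these.\<close>

theorem k33_free_bipartite_card_arcs:
  fixes V :: "'a set"
  assumes "finite V" "A \<subseteq> V \<times> V" "sym A" "k33_free A" "3 \<le> card V"
    and "\<And>x y. (x, y) \<in> A \<Longrightarrow> x \<in> P \<longleftrightarrow> y \<notin> P"
  shows "card A + 8 \<le> 4 * card V"
  using assms
proof (induction "card V" arbitrary: V A rule: less_induct)
  case less
  note fin = less.prems(1)
  show ?case
  proof (rule ccontr)
    assume "\<not> ?thesis"
    then have "4 * card V - 8 < card A" using less.prems(5) by simp
    then obtain E where E: "E \<subseteq> A" "sym E" "4 * card V - 8 < card E" "card E \<le> 4 * card V - 8 + 2"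
      using sym_subset_between[of A "4 * card V - 8"] less.prems(1-3) finite_subset[of A "V \<times> V"] by blast
    have EV: "E \<subseteq> V \<times> V" and free: "k33_free E"
      using E(1) less.prems(2,4) k33_free_subset by auto
    have bip: "x \<in> P \<longleftrightarrow> y \<notin> P" if "(x, y) \<in> E" for x y using E(1) less.prems(6) that by blast
    have fE: "finite E" using EV fin finite_subset by blast
    have noloop: "(x, x) \<notin> E" for x using bip[of x x] by blast
    have es: "(y, x) \<in> E" if "(x, y) \<in> E" for x y using E(2) that by (rule symD)
    have fn: "finite (E `` {v})" for v by (rule finite_subset[OF _ fin]) (use EV in auto)
    have IH: "card E' + 8 \<le> 4 * card V'"
      if "card V' < card V" "finite V'" "E' \<subseteq> V' \<times> V'" "sym E'" "k33_free E'" "3 \<le> card V'"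
        "\<And>x y. (x, y) \<in> E' \<Longrightarrow> x \<in> P \<longleftrightarrow> y \<notin> P" for V' :: "'a set" and E'
      by (rule less.hyps) (use that in auto)
    have IHi: "card (E \<inter> V' \<times> V') + 8 \<le> 4 * card V'" if "V' \<subset> V" "3 \<le> card V'" for V'
    proof (rule IH)
      show "card V' < card V" using that fin by (simp add: psubset_card_mono)
      show "finite V'" using that fin finite_subset by blast
      show "sym (E \<inter> V' \<times> V')" using E(2) unfolding sym_def by blast
      show "k33_free (E \<inter> V' \<times> V')" by (rule k33_free_subset[OF free]) blast
      show "x \<in> P \<longleftrightarrow> y \<notin> P" if "(x, y) \<in> E \<inter> V' \<times> V'" for x y using that bip by blast
    qed (use that in auto)
    have V4: "4 \<le> card V"
    proof (rule ccontr)
      assume "\<not> 4 \<le> card V"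
      with less.prems(5) have c3: "card V = 3" by simp
      define p r where "p = card (V \<inter> P)" and "r = card (V - P)"
      have pr: "p + r = 3" unfolding p_def r_def using c3 fin by (metis card_Int_Diff)
      have "E \<subseteq> (V \<inter> P) \<times> (V - P) \<union> (V - P) \<times> (V \<inter> P)" using EV bip by auto
      then have "card E \<le> card ((V \<inter> P) \<times> (V - P) \<union> (V - P) \<times> (V \<inter> P))"
        by (rule card_mono[rotated]) (use fin in auto)
      also have "\<dots> \<le> card ((V \<inter> P) \<times> (V - P)) + card ((V - P) \<times> (V \<inter> P))" by (rule card_Un_le)
      also have "\<dots> = 2 * (p * r)" by (simp add: card_cartesian_product p_def r_def)
      finally have "card E \<le> 2 * (p * r)" .
      moreover have "p = 0 \<or> p = 1 \<or> p = 2 \<or> p = 3" using pr by linarith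
      then have "p * r \<le> 2" using pr by (elim disjE) auto
      ultimately show False using E(3) c3 by simp
    qed
    have deg3: "3 \<le> card (E `` {v})" if "v \<in> V" for v
    proof (rule ccontr)
      assume "\<not> ?thesis"
      moreover have "card (E \<inter> (V - {v}) \<times> (V - {v})) + 8 \<le> 4 * card (V - {v})"
        by (rule IHi) (use that fin V4 in auto)
      moreover have "card E \<le> card (E \<inter> (V - {v}) \<times> (V - {v})) + 2 * card (E `` {v})"
        by (rule card_arcs_remove[OF fin EV E(2)])
      moreover have "card (V - {v}) = card V - 1" using that fin by simp
      ultimately show False using E(3) V4 by simp
    qed
    have "card E < 4 * card V" using E(4) V4 by simp
    then obtain q where q: "q \<in> V" "card (E `` {q}) < 4" using ex_small_degree[OF fin EV] by blast
    then have q3: "card (E `` {q}) = 3" using deg3[of q] by simp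
    then obtain b1 b2 b3 where b: "E `` {q} = {b1, b2, b3}" "b1 \<noteq> b2" "b1 \<noteq> b3" "b2 \<noteq> b3" by (metis card_3_iff)
    have qb: "(q, b1) \<in> E" "(q, b2) \<in> E" "(b1, q) \<in> E" "(b2, q) \<in> E" using b es by auto
    have bV: "b1 \<in> V" "b2 \<in> V" using qb EV by auto
    have side: "b1 \<in> P \<longleftrightarrow> q \<notin> P" "b2 \<in> P \<longleftrightarrow> q \<notin> P" using qb bip by blast+
    have bq: "b1 \<noteq> q" "b2 \<noteq> q" using side by blast+
    have b12: "(b1, b2) \<notin> E" "(b2, b1) \<notin> E" using side bip by blast+
    let ?D = "E `` {b1} \<inter> E `` {b2}"
    have Dside: "x \<in> P \<longleftrightarrow> q \<in> P" if "x \<in> ?D" for x using that bip side by blast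
    show False
    proof (cases "3 \<le> card ?D")
      case True
      then obtain q1 q2 q3 where qs: "q1 \<in> ?D" "q2 \<in> ?D" "q3 \<in> ?D" "q1 \<noteq> q2" "q1 \<noteq> q3" "q2 \<noteq> q3"
        by (rule three_elements)
      define Q where "Q = {q1, q2, q3}"
      define K where "K = {b1, b2} \<union> Q"
      have QD: "Q \<subseteq> ?D" using qs unfolding Q_def by blast
      have cQ: "card Q = 3" using qs unfolding Q_def by simp
      have fQ: "finite Q" unfolding Q_def by simp
      have bnQ: "b1 \<notin> Q" "b2 \<notin> Q" using QD Dside side by blast+
      have KV: "K \<subseteq> V" using bV QD EV unfolding K_def by auto
      \<comment> \<open>By bipartiteness the neighbours of x in K are b1 and b2 only, while its
        degree is at least 3.\<close>
      have nbr: "\<exists>c \<in> V - K. (x, c) \<in> E" if x: "x \<in> Q" for x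
      proof -
        have "\<not> E `` {x} \<subseteq> {b1, b2}"
        proof
          assume "E `` {x} \<subseteq> {b1, b2}"
          then have "card (E `` {x}) \<le> 2" using card_mono[of "{b1, b2}" "E `` {x}"] b(2) by simp
          with deg3[of x] x QD KV show False unfolding K_def by auto
        qed
        then obtain c where c: "(x, c) \<in> E" "c \<noteq> b1" "c \<noteq> b2" by blast
        have "c \<notin> Q" using c(1) bip[of x c] Dside[of x] Dside[of c] x QD by blast
        with c EV show ?thesis unfolding K_def by blast
      qed
      obtain c1 where c1: "c1 \<in> V - K" "(q1, c1) \<in> E" using nbr[of q1] unfolding Q_def by blast
      define Y where "Y = component E (V - K) c1"
      have Y: "conn E Y" "Y \<subseteq> V - K" "c1 \<in> Y"
        using component_conn[OF c1(1), of E] component_subset[of E "V - K" c1] component_self[OF c1(1), of E] unfolding Y_def by auto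
      have clos: "y \<in> Y" if "x \<in> Y" "y \<in> V - K" "(x, y) \<in> E" for x y
        using component_closed[OF E(2) c1(1)] that unfolding Y_def touch_def by blast
      have YK: "Y \<inter> K = {}" using Y by blast
      have fY: "finite Y" using Y(2) fin finite_subset by blast
      have cK: "card K = 5"
        unfolding K_def using bnQ b(2) cQ fQ by (subst card_Un_disjoint) auto
      show False
      proof (cases "\<forall>x\<in>Q. touch E {x} Y")
        case True
        then have t: "touch E Y {q1}" "touch E Y {q2}" "touch E Y {q3}"
          using touch_commute[OF E(2)] unfolding Q_def by blast+
        show False
          by (rule k33_freeD[OF free, of "{b1}" "{b2}" Y "{q1}" "{q2}" "{q3}"])
            (use t qs b(2) Y(1) YK bnQ in \<open>auto simp: K_def Q_def\<close>)
      next
        case False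
        then obtain x where x: "x \<in> Q" "\<not> touch E {x} Y" by blast
        \<comment> \<open>The vertex c shows that Y with K is a proper part of V. The two bounds sum
          to 4n + 4, and the 12 arcs of K23 are counted twice.\<close>
        obtain c where c: "c \<in> V - K" "(x, c) \<in> E" using nbr[OF x(1)] by blast
        have cY: "c \<notin> Y" using x(2) c(2) unfolding touch_def by blast
        have sub: "E \<subseteq> (Y \<union> K) \<times> (Y \<union> K) \<union> (V - Y) \<times> (V - Y)"
        proof
          fix e assume e: "e \<in> E"
          obtain y z where yz: "e = (y, z)" by force
          show "e \<in> (Y \<union> K) \<times> (Y \<union> K) \<union> (V - Y) \<times> (V - Y)"
            using clos[of y z] clos[of z y] es[of y z] e yz EV by (cases "y \<in> Y"; cases "z \<in> Y") auto
        qed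
        have "card E + card ({b1, b2} \<times> Q \<union> Q \<times> {b1, b2}) \<le>
            card (E \<inter> (Y \<union> K) \<times> (Y \<union> K)) + card (E \<inter> (V - Y) \<times> (V - Y))"
          by (rule card_arcs_split[OF fin EV sub]) (use QD es YK KV in \<open>auto simp: K_def\<close>)
        moreover have "card ({b1, b2} \<times> Q \<union> Q \<times> {b1, b2}) = 12"
        proof -
          have "card ({b1, b2} \<times> Q \<union> Q \<times> {b1, b2}) = card ({b1, b2} \<times> Q) + card (Q \<times> {b1, b2})"
            by (rule card_Un_disjoint) (use fQ bnQ in auto)
          then show ?thesis using cQ b(2) by (simp add: card_cartesian_product)
        qed
        moreover have cYK: "card (Y \<union> K) = card Y + 5"
          using card_Un_disjoint[of Y K] fY YK cK KV fin finite_subset by auto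
        moreover have "card (E \<inter> (Y \<union> K) \<times> (Y \<union> K)) + 8 \<le> 4 * card (Y \<union> K)"
          by (rule IHi) (use Y(2) KV c(1) cY cYK in auto)
        moreover have "card (V - Y) + card Y = card V"
          using Y(2) fin fY by (metis Diff_subset card_Diff_subset card_mono le_add_diff_inverse2 subset_trans)
        moreover have "card (E \<inter> (V - Y) \<times> (V - Y)) + 8 \<le> 4 * card (V - Y)"
        proof (rule IHi)
          show "V - Y \<subset> V" using Y by blast
          have "card K \<le> card (V - Y)" by (rule card_mono) (use fin KV YK in auto)
          then show "3 \<le> card (V - Y)" using cK by simp
        qed
        ultimately show False using E(3) by simp
      qed
    next
      case False
      then have D2: "card ?D \<le> 2" by simp
      \<comment> \<open>Deleting q loses 6 arcs, and merging b2 into b1 loses two more for at most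
        one further common neighbour. Eight arcs are the allowance for two vertices.\<close>
      define U where "U = E `` {b2} - {q}"
      \<comment> \<open>The bound is false for fewer than three vertices, so five are needed before
        two are removed.\<close>
      have V5: "5 \<le> card V"
      proof -
        have "card (E `` {q} \<union> E `` {b1}) = card (E `` {q}) + card (E `` {b1})"
          by (rule card_Un_disjoint) (use fn bip side in auto)
        moreover have "card (E `` {q} \<union> E `` {b1}) \<le> card V" by (rule card_mono) (use fin EV in auto)
        ultimately show ?thesis using q3 deg3[OF bV(1)] by simp
      qed
      have Uside: "u \<in> P \<longleftrightarrow> q \<in> P" if "u \<in> U" for u using that bip side unfolding U_def by blast
      have cV2: "card (V - {q, b2}) = card V - 2" using q(1) bV bq fin by (simp add: card_Diff_subset)
      have "card (merge E {q, b2} b1 U) + 8 \<le> 4 * card (V - {q, b2})"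
      proof (rule IH)
        show "card (V - {q, b2}) < card V" using cV2 V5 by simp
        show "3 \<le> card (V - {q, b2})" using cV2 V5 by simp
        show "merge E {q, b2} b1 U \<subseteq> (V - {q, b2}) \<times> (V - {q, b2})"
          using EV bV b(2) bq b12 noloop unfolding merge_def U_def by auto
        show "sym (merge E {q, b2} b1 U)" using es unfolding merge_def sym_def by blast
        show "x \<in> P \<longleftrightarrow> y \<notin> P" if "(x, y) \<in> merge E {q, b2} b1 U" for x y
          using that bip side Uside unfolding merge_def by blast
        show "k33_free (merge E {q, b2} b1 U)"
        proof (rule k33_free_merge[OF free E(2)])
          have "conn E (insert b1 {q, b2})"
            by (rule conn_insert[OF E(2) conn_pair[OF E(2) qb(2)]]) (use qb in \<open>auto simp: touch_def\<close>)
          then show "conn E (insert b1 {q, b2})" .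
          show "touch E {u} (insert b1 {q, b2})" if "u \<in> U" for u
            using that es unfolding U_def touch_def by blast
        qed (use b(2) bq b12 noloop in \<open>auto simp: U_def\<close>)
      qed (use fin in auto)
      moreover have "card (E - ({q, b2} \<times> UNIV \<union> UNIV \<times> {q, b2})) + 2 * card U
          \<le> card (merge E {q, b2} b1 U) + 2 * card (?D - {q})"
        by (rule card_merge) (use fE fn b(2) bq b12 noloop es E(2) in \<open>auto simp: U_def\<close>)
      moreover have "card E \<le> card (E - ({q, b2} \<times> UNIV \<union> UNIV \<times> {q, b2})) + 6 + 2 * card U"
      proof -
        let ?E1 = "E \<inter> (V - {q}) \<times> (V - {q})"
        have "card E \<le> card ?E1 + 2 * card (E `` {q})" by (rule card_arcs_remove[OF fin EV E(2)])
        moreover have "card ?E1 \<le> card (?E1 \<inter> (V - {b2}) \<times> (V - {b2})) + 2 * card (?E1 `` {b2})"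
          by (rule card_arcs_remove[OF fin]) (use EV E(2) in \<open>auto simp: sym_def\<close>)
        moreover have "?E1 \<inter> (V - {b2}) \<times> (V - {b2}) = E - ({q, b2} \<times> UNIV \<union> UNIV \<times> {q, b2})" using EV by auto
        moreover have "?E1 `` {b2} = U" using EV bV bq unfolding U_def by auto
        ultimately show ?thesis using q3 by simp
      qed
      moreover have "card (?D - {q}) \<le> 1"
      proof -
        have "q \<in> ?D" using qb by blast
        then show ?thesis using D2 fn by simp
      qed
      ultimately show False using E(3) V5 cV2 by simp
    qed
  qed
qed

section \<open>Distributing units\<close>

text \<open>Contracting every piece to a point and keeping its edges to N gives a bipartite minor on
  \<open>card \<P> + card X\<close> vertices, to which e \<le> 2n - 4 applies. Its vertices are
  taken to be the pieces themselves and the singletons of X, so that the branch sets are given by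
  the identity.\<close>

lemma pieces_bound:
  assumes A: "sym A" "k33_free A" and X: "finite X" and fin: "finite \<P>"
    and pc: "\<And>P N. (P, N) \<in> \<P> \<Longrightarrow> conn A P \<and> P \<inter> X = {} \<and> N \<subseteq> X \<and> 3 \<le> card N \<and> (\<forall>n\<in>N. touch A P {n})"
    and dj: "\<And>p q. p \<in> \<P> \<Longrightarrow> q \<in> \<P> \<Longrightarrow> p \<noteq> q \<Longrightarrow> fst p \<inter> fst q = {}" and ne: "\<P> \<noteq> {}"
  shows "(\<Sum>p\<in>\<P>. card (snd p) - 2) + 4 \<le> 2 * card X"
proof -
  define f :: "('a set \<times> 'a set) \<times> 'a \<Rightarrow> 'a set \<times> 'a set" where "f = (\<lambda>(p, n). (fst p, {n}))"
  define A1 where "A1 = f ` Sigma \<P> snd"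
  have finN: "finite (snd p)" if "p \<in> \<P>" for p
    using pc[of "fst p" "snd p"] that X finite_subset by auto
  have inj_fst: "inj_on fst \<P>"
  proof (rule inj_onI)
    fix p q assume pq: "p \<in> \<P>" "q \<in> \<P>" "fst p = fst q"
    show "p = q"
    proof (rule ccontr)
      assume "p \<noteq> q"
      with dj[OF pq(1,2)] pq(3) have "fst p = {}" by simp
      moreover have "conn A (fst p)" using pc[of "fst p" "snd p"] pq(1) by simp
      ultimately show False by (simp add: conn_def)
    qed
  qed
  have inj: "inj_on f (Sigma \<P> snd)"
    using inj_fst by (auto simp: inj_on_def f_def)
  have cA1: "card A1 = (\<Sum>p\<in>\<P>. card (snd p))"
  proof -
    have "card A1 = card (Sigma \<P> snd)" unfolding A1_def by (rule card_image[OF inj])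
    also have "\<dots> = (\<Sum>p\<in>\<P>. card (snd p))" by (rule card_SigmaI[OF fin]) (use finN in blast)
    finally show ?thesis .
  qed
  have fA1: "finite A1" unfolding A1_def using fin finN by blast
  define V where "V = fst ` \<P> \<union> (\<lambda>x. {x}) ` X"
  have djX: "fst p \<noteq> {x}" if "p \<in> \<P>" "x \<in> X" for p x
    using pc[of "fst p" "snd p"] that by auto
  have A1V: "A1 \<subseteq> fst ` \<P> \<times> (\<lambda>x. {x}) ` X"
  proof
    fix e assume "e \<in> A1"
    then obtain p n where pn: "p \<in> \<P>" "n \<in> snd p" "e = (fst p, {n})" unfolding A1_def f_def by auto
    then have "n \<in> X" using pc[of "fst p" "snd p"] by auto
    with pn show "e \<in> fst ` \<P> \<times> (\<lambda>x. {x}) ` X" by auto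
  qed
  have disj: "fst ` \<P> \<inter> (\<lambda>x. {x}) ` X = {}" using djX by blast
  have cV: "card V = card \<P> + card X"
  proof -
    have "card V = card (fst ` \<P>) + card ((\<lambda>x. {x}) ` X)"
      unfolding V_def by (rule card_Un_disjoint) (use fin X disj in auto)
    then show ?thesis using card_image[OF inj_fst] card_image[of "\<lambda>x. {x}" X] by (simp add: inj_on_def)
  qed
  have c2: "card (A1 \<union> A1\<inverse>) = 2 * card A1"
  proof -
    have "x \<in> fst ` \<P> \<and> y \<in> (\<lambda>x. {x}) ` X" if "(x, y) \<in> A1" for x y
      using subsetD[OF A1V that] by simp
    note * = this
    have "(y, x) \<notin> A1" if xy: "(x, y) \<in> A1" for x y
    proof
      assume "(y, x) \<in> A1"
      from conjunct1[OF *[OF this]] conjunct2[OF *[OF xy]] disj show False by (meson disjoint_iff)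
    qed
    note ** = this
    have "A1 \<inter> A1\<inverse> = {}"
    proof (rule equals0I)
      fix p assume p: "p \<in> A1 \<inter> A1\<inverse>"
      obtain x y where xy: "p = (x, y)" by (cases p)
      with p have "(x, y) \<in> A1" "(y, x) \<in> A1" by simp_all
      with ** show False by simp
    qed
    then have "card (A1 \<union> A1\<inverse>) = card A1 + card (A1\<inverse>)" by (intro card_Un_disjoint) (use fA1 in auto)
    then show ?thesis by simp
  qed
  obtain p0 where p0: "p0 \<in> \<P>" using ne by blast
  have "card (snd p0) \<le> card X" by (rule card_mono[OF X]) (use pc[of "fst p0" "snd p0"] p0 in auto)
  then have X3: "3 \<le> card X" using pc[of "fst p0" "snd p0"] p0 by auto
  have t: "touch A P {n}" if "(P, {n}) \<in> A1" for P n
  proof -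
    from that obtain p where "p \<in> \<P>" "n \<in> snd p" "P = fst p" unfolding A1_def f_def by auto
    then show ?thesis using pc[of "fst p" "snd p"] by auto
  qed
  have "card (A1 \<union> A1\<inverse>) + 8 \<le> 4 * card V"
  proof (rule k33_free_bipartite_card_arcs[where P = "fst ` \<P>"])
    show "finite V" unfolding V_def using fin X by blast
    show "A1 \<union> A1\<inverse> \<subseteq> V \<times> V" using A1V unfolding V_def by blast
    show "sym (A1 \<union> A1\<inverse>)" by (auto simp: sym_def)
    show "3 \<le> card V" using cV X3 by simp
    show "x \<in> fst ` \<P> \<longleftrightarrow> y \<notin> fst ` \<P>" if "(x, y) \<in> A1 \<union> A1\<inverse>" for x y
      using that A1V disj by blast
    show "k33_free (A1 \<union> A1\<inverse>)"
    proof (rule k33_free_minor[OF A(2), of _ "\<lambda>z. z"])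
      have F: "Field (A1 \<union> A1\<inverse>) \<subseteq> V" using A1V unfolding V_def Field_def by blast
      show "conn A z" if "z \<in> Field (A1 \<union> A1\<inverse>)" for z
        using that F pc unfolding V_def by fastforce
      show "z \<inter> z' = {}" if "z \<in> Field (A1 \<union> A1\<inverse>)" "z' \<in> Field (A1 \<union> A1\<inverse>)" "z \<noteq> z'" for z z'
      proof -
        have "z \<in> V" "z' \<in> V" using that F by blast+
        then consider p q where "z = fst p" "z' = fst q" "p \<in> \<P>" "q \<in> \<P>" | p x where "z = fst p" "z' = {x}" "p \<in> \<P>" "x \<in> X"
          | p x where "z' = fst p" "z = {x}" "p \<in> \<P>" "x \<in> X" | x y where "z = {x}" "z' = {y}"
          unfolding V_def by blast
        then show ?thesis
        proof cases
          case 1 then show ?thesis using dj[of p q] \<open>z \<noteq> z'\<close> by blast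
        next
          case 2 then show ?thesis using pc[of "fst p" "snd p"] by auto
        next
          case 3 then show ?thesis using pc[of "fst p" "snd p"] by auto
        next
          case 4 then show ?thesis using \<open>z \<noteq> z'\<close> by blast
        qed
      qed
      show "touch A z z'" if zz: "(z, z') \<in> A1 \<union> A1\<inverse>" for z z'
      proof -
        from zz have "(z, z') \<in> A1 \<or> (z', z) \<in> A1" by blast
        moreover have "touch A P Z" if PZ: "(P, Z) \<in> A1" for P Z
        proof -
          obtain x where "Z = {x}" using PZ A1V by blast
          then show ?thesis using PZ t by blast
        qed
        ultimately show ?thesis using touch_commute[OF A(1)] by blast
      qed
    qed
  qed
  then have "2 * (\<Sum>p\<in>\<P>. card (snd p)) + 8 \<le> 4 * (card \<P> + card X)" using c2 cA1 cV by simp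
  moreover have "(\<Sum>p\<in>\<P>. card (snd p)) = (\<Sum>p\<in>\<P>. card (snd p) - 2) + 2 * card \<P>"
  proof -
    have "(\<Sum>p\<in>\<P>. card (snd p)) = (\<Sum>p\<in>\<P>. (card (snd p) - 2) + 2)"
      by (rule sum.cong) (use pc in fastforce)+
    then show ?thesis by (simp only: sum.distrib sum_constant) simp
  qed
  ultimately show ?thesis by simp
qed

text \<open>The connected set stands for the interior of a path from a to b; an edge between a and b
  does not violate separation.\<close>

definition separates :: "('a \<times> 'a) set \<Rightarrow> 'a set \<Rightarrow> 'a \<Rightarrow> 'a \<Rightarrow> bool" where
  "separates A Q a b \<longleftrightarrow> (\<nexists>Y. conn A Y \<and> Y \<inter> (Q \<union> {a, b}) = {} \<and> touch A Y {a} \<and> touch A Y {b})"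

text \<open>The bipartite edge bound pays for card N - 2 units. A pair would get none and is granted
  one nevertheless.\<close>

definition unit_weight :: "'b set \<Rightarrow> nat" where
  "unit_weight N = max 1 (card N - 2)"

text \<open>Pairs N of weight 1 can be afforded when the piece separates the pair: the count then splits along that separation.\<close>
theorem unit_count:
  assumes A: "sym A" "k33_free A" and B: "finite B" and fin: "finite \<P>"
    and pc: "\<And>P N. (P, N) \<in> \<P> \<Longrightarrow> conn A P \<and> P \<inter> B = {} \<and> N \<subseteq> B \<and> 2 \<le> card N \<and> (\<forall>n\<in>N. touch A P {n})"
    and two: "\<And>P N. (P, N) \<in> \<P> \<Longrightarrow> card N = 2 \<Longrightarrow> \<exists>a b. N = {a, b} \<and> a \<noteq> b \<and> separates A P a b"
    and dj: "\<And>p q. p \<in> \<P> \<Longrightarrow> q \<in> \<P> \<Longrightarrow> p \<noteq> q \<Longrightarrow> fst p \<inter> fst q = {}"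
    and X: "X \<subseteq> B" "X \<noteq> {}"
  shows "(\<Sum>p\<in>{p\<in>\<P>. snd p \<subseteq> X}. unit_weight (snd p)) + 2 \<le> 2 * card X"
  using X
proof (induction "card X" arbitrary: X rule: less_induct)
  case less
  have fX: "finite X" using less.prems B finite_subset by blast
  let ?f = "\<lambda>X. \<Sum>p\<in>{p\<in>\<P>. snd p \<subseteq> X}. unit_weight (snd p)"
  show ?case
  proof (cases "\<exists>p\<in>\<P>. snd p \<subseteq> X \<and> card (snd p) = 2")
    case False
    let ?R = "{p\<in>\<P>. snd p \<subseteq> X}"
    have c3: "3 \<le> card (snd p)" if "p \<in> ?R" for p
      using that False pc[of "fst p" "snd p"] by (cases p) force
    show ?thesis
    proof (cases "?R = {}")
      case True
      have "card X \<ge> 1" using less.prems(2) fX by (simp add: Suc_leI card_gt_0_iff)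
      then show ?thesis unfolding True by simp
    next
      case False
      have "(\<Sum>p\<in>?R. card (snd p) - 2) + 4 \<le> 2 * card X"
      proof (rule pieces_bound[OF A fX _ _ _ False])
        show "finite ?R" using fin by simp
        show "fst p \<inter> fst q = {}" if "p \<in> ?R" "q \<in> ?R" "p \<noteq> q" for p q using that dj by blast
        show "conn A P \<and> P \<inter> X = {} \<and> N \<subseteq> X \<and> 3 \<le> card N \<and> (\<forall>n\<in>N. touch A P {n})" if "(P, N) \<in> ?R" for P N
          using that pc[of P N] c3[OF that] less.prems(1) by auto
      qed
      moreover have "?f X = (\<Sum>p\<in>?R. card (snd p) - 2)"
        by (rule sum.cong) (use c3 in \<open>fastforce simp: unit_weight_def\<close>)+
      ultimately show ?thesis by simp
    qed
  next
    case True
    then obtain Q N0 where QN: "(Q, N0) \<in> \<P>" "N0 \<subseteq> X" "card N0 = 2" by auto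
    then obtain a b where ab: "N0 = {a, b}" "a \<noteq> b" "separates A Q a b" using two by blast
    have QB: "Q \<inter> B = {}" using pc[OF QN(1)] by blast
    \<comment> \<open>\<open>X1\<close> consists of a and of what can be reached from a while
      avoiding Q and b. Every other piece is connected and disjoint from Q, so its neighbours lie on
      one side; otherwise a and b would be linked outside Q.\<close>
    define S where "S Y x \<longleftrightarrow> conn A Y \<and> Y \<inter> (Q \<union> {a, b}) = {} \<and> x \<in> Y \<and> touch A Y {a}" for Y x
    define X1 where "X1 = insert a {x\<in>X. \<exists>Y. S Y x}"
    have aX: "a \<in> X" "b \<in> X" using ab QN by auto
    have X1: "X1 \<subseteq> X" "a \<in> X1" "b \<notin> X1" using aX ab(2) unfolding X1_def S_def by auto
    have one: "N \<subseteq> X1 \<or> N \<subseteq> X - X1" if PN: "(P, N) \<in> \<P>" "P \<noteq> Q" "N \<subseteq> X" for P N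
    proof -
      have P: "conn A P" "P \<inter> B = {}" "\<And>n. n \<in> N \<Longrightarrow> touch A P {n}" using pc[OF PN(1)] by auto
      have PQ: "P \<inter> Q = {}" using dj[OF PN(1) QN(1)] PN(2) by auto
      have Pd: "P \<inter> (Q \<union> {a, b}) = {}" using PQ P(2) aX less.prems(1) by blast
      have nQ: "n \<notin> Q" if "n \<in> N" for n using that PN(3) less.prems(1) QB by blast
      have ext: "n \<in> X1" if n: "n \<in> N" "n \<noteq> b" and Z: "conn A Z" "P \<subseteq> Z" "Z \<inter> (Q \<union> {a, b}) = {}" "touch A Z {a}" for n Z
      proof (cases "n = a")
        case False
        have "touch A {n} Z" using P(3)[OF n(1)] Z(2) touch_commute[OF A(1)] touch_mono by blast
        then have "conn A (insert n Z)" by (rule conn_insert[OF A(1) Z(1)])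
        moreover have "touch A (insert n Z) {a}" by (rule touch_mono[OF Z(4)]) auto
        ultimately have "S (insert n Z) n" unfolding S_def using Z(3) n(2) False nQ[OF n(1)] by simp
        then show ?thesis unfolding X1_def using n(1) PN(3) by blast
      qed (use X1 in simp)
      show ?thesis
      proof (rule ccontr)
        assume "\<not> ?thesis"
        then obtain n m where nm: "n \<in> N" "n \<in> X1" "m \<in> N" "m \<notin> X1" using PN(3) by blast
        obtain Z where Z: "conn A Z" "P \<subseteq> Z" "Z \<inter> (Q \<union> {a, b}) = {}" "touch A Z {a}"
        proof (cases "n = a")
          case True then show ?thesis using that[of P] P(1) P(3)[OF nm(1)] Pd by simp
        next
          case False
          then obtain Y where Y: "S Y n" using nm(2) unfolding X1_def by blast
          have "touch A P Y" by (rule touch_mono[OF P(3)[OF nm(1)]]) (use Y in \<open>auto simp: S_def\<close>)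
          then have "conn A (P \<union> Y)" using Y P(1) by (intro conn_Un[OF A(1)]) (auto simp: S_def)
          moreover have "touch A (P \<union> Y) {a}" by (rule touch_mono[of A Y "{a}"]) (use Y in \<open>auto simp: S_def\<close>)
          ultimately show ?thesis using that[of "P \<union> Y"] Y Pd unfolding S_def by blast
        qed
        show False
        proof (cases "m = b")
          case True
          have "touch A Z {b}" by (rule touch_mono[OF P(3)[OF nm(3)]]) (use Z True in auto)
          then show False using Z ab(3) unfolding separates_def by blast
        next
          case False
          then show False using ext[OF nm(3) False Z] nm(4) by blast
        qed
      qed
    qed
    let ?X2 = "X - X1"
    let ?R = "\<lambda>X. {p\<in>\<P>. snd p \<subseteq> X}"
    have sub: "?R X \<subseteq> insert (Q, N0) (?R X1 \<union> ?R ?X2)"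
    proof
      fix p assume p: "p \<in> ?R X"
      obtain P N where PN: "p = (P, N)" by force
      show "p \<in> insert (Q, N0) (?R X1 \<union> ?R ?X2)"
      proof (cases "P = Q")
        case True
        have "Q \<noteq> {}" using pc[OF QN(1)] conn_nonempty by blast
        then have "p = (Q, N0)" using dj[of p "(Q, N0)"] p PN QN True by auto
        then show ?thesis by simp
      next
        case False then show ?thesis using one[of P N] p PN by auto
      qed
    qed
    have fR: "finite (?R Z)" for Z using fin by simp
    have "?f X \<le> (\<Sum>p\<in>insert (Q, N0) (?R X1 \<union> ?R ?X2). unit_weight (snd p))"
      by (rule sum_mono2[OF _ sub]) (use fR in auto)
    also have "\<dots> \<le> unit_weight N0 + (\<Sum>p\<in>?R X1 \<union> ?R ?X2. unit_weight (snd p))"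
      using fR by (cases "(Q, N0) \<in> ?R X1 \<union> ?R ?X2") (simp_all only: insert_absorb sum.insert finite_UnI not_False_eq_True snd_conv order_refl le_add2)
    also have "(\<Sum>p\<in>?R X1 \<union> ?R ?X2. unit_weight (snd p)) \<le> ?f X1 + ?f ?X2"
      using sum.union_inter[OF fR fR, of "\<lambda>p. unit_weight (snd p)" X1 ?X2] by linarith
    \<comment> \<open>One unit for the pair and the two induction hypotheses give at most 1 + 2 card
      X - 4, one less than allowed.\<close>
    finally have le: "?f X \<le> unit_weight N0 + (?f X1 + ?f ?X2)" by simp
    have "card X1 < card X" by (rule psubset_card_mono[OF fX]) (use X1 aX in blast)
    moreover have "card ?X2 < card X" by (rule psubset_card_mono[OF fX]) (use X1 aX in blast)
    ultimately have "?f X1 + 2 \<le> 2 * card X1" "?f ?X2 + 2 \<le> 2 * card ?X2"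
      using less.hyps[of X1] less.hyps[of ?X2] X1 aX less.prems(1) by blast+
    moreover have "card X1 + card ?X2 = card X"
      using X1(1) fX by (metis card_Diff_subset card_mono finite_subset le_add_diff_inverse)
    moreover have "unit_weight N0 = 1" using QN(3) unfolding unit_weight_def by simp
    ultimately show ?thesis using le by linarith
  qed
qed

text \<open>Hall's theorem where b may be used \<open>c b\<close> times, by the induction of Halmos
  and Vaughan: a proper tight subfamily is served first and its neighbourhood withdrawn from the
  others. If there is none, one choice may be fixed and its capacity lowered by one without
  violating the condition.\<close>

theorem hall_capacity:
  fixes N :: "'i \<Rightarrow> 'b set" and c :: "'b \<Rightarrow> nat"
  assumes "finite I" "\<And>i. i \<in> I \<Longrightarrow> finite (N i)" "\<And>J. J \<subseteq> I \<Longrightarrow> card J \<le> sum c (\<Union>(N ` J))"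
  shows "\<exists>u. (\<forall>i\<in>I. u i \<in> N i) \<and> (\<forall>b. card {i\<in>I. u i = b} \<le> c b)"
  using assms
proof (induction "card I" arbitrary: I N c rule: less_induct)
  case less
  show ?case
  proof (cases "I = {}")
    case True then show ?thesis by auto
  next
    case ne: False
    have finU: "finite (\<Union>(N ` J))" if "J \<subseteq> I" for J
    proof -
      have "finite J" by (rule finite_subset[OF that less.prems(1)])
      then show ?thesis using that less.prems(2) by blast
    qed
    show ?thesis
    proof (cases "\<exists>J. J \<subset> I \<and> J \<noteq> {} \<and> card J = sum c (\<Union>(N ` J))")
      case True
      then obtain J where J: "J \<subset> I" "J \<noteq> {}" "card J = sum c (\<Union>(N ` J))" by blast
      have fJ: "finite J" using J less.prems(1) finite_subset by blast
      have "\<exists>u. (\<forall>i\<in>J. u i \<in> N i) \<and> (\<forall>b. card {i\<in>J. u i = b} \<le> c b)"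
      proof (rule less.hyps)
        show "card J < card I" by (rule psubset_card_mono[OF less.prems(1) J(1)])
      qed (use J less.prems fJ in auto)
      then obtain u where u: "\<forall>i\<in>J. u i \<in> N i" "\<forall>b. card {i\<in>J. u i = b} \<le> c b" by blast
      let ?W = "\<Union>(N ` J)" and ?N = "\<lambda>i. N i - \<Union>(N ` J)"
      have "\<exists>u. (\<forall>i\<in>I - J. u i \<in> ?N i) \<and> (\<forall>b. card {i\<in>I - J. u i = b} \<le> c b)"
      proof (rule less.hyps)
        show "card (I - J) < card I" using J less.prems(1) by (metis Diff_subset card_Diff_subset card_gt_0_iff card_mono diff_less fJ ne psubsetE)
        show "finite (I - J)" using less.prems(1) by simp
        show "finite (?N i)" if "i \<in> I - J" for i using less.prems(2) that by simp
        show "card K \<le> sum c (\<Union>(?N ` K))" if K: "K \<subseteq> I - J" for K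
        proof -
          have fK: "finite K" using K less.prems(1) finite_subset by blast
          have "card K + card J = card (K \<union> J)" using K fK fJ by (subst card_Un_disjoint) auto
          also have "\<dots> \<le> sum c (\<Union>(N ` (K \<union> J)))" by (rule less.prems(3)) (use K J in auto)
          also have "\<Union>(N ` (K \<union> J)) = \<Union>(?N ` K) \<union> ?W" by blast
          also have "sum c (\<Union>(?N ` K) \<union> ?W) = sum c (\<Union>(?N ` K)) + sum c ?W"
          proof (rule sum.union_disjoint)
            have "\<Union>(?N ` K) \<subseteq> \<Union>(N ` K)" by blast
            then show "finite (\<Union>(?N ` K))" using finU[of K] K finite_subset by blast
            show "finite ?W" using finU[of J] J by blast
          qed blast
          finally show ?thesis using J(3) by simp
        qed
      qed
      then obtain u' where u': "\<forall>i\<in>I - J. u' i \<in> ?N i" "\<forall>b. card {i\<in>I - J. u' i = b} \<le> c b" by blast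
      let ?u = "\<lambda>i. if i \<in> J then u i else u' i"
      have "card {i\<in>I. ?u i = b} \<le> c b" for b
      proof (cases "b \<in> ?W")
        case True
        then have "u' i \<noteq> b" if "i \<in> I - J" for i using u' that by blast
        then have "{i\<in>I. ?u i = b} = {i\<in>J. u i = b}" using J by auto
        then show ?thesis using u by simp
      next
        case False
        then have "u i \<noteq> b" if "i \<in> J" for i using u that by blast
        then have "{i\<in>I. ?u i = b} = {i\<in>I - J. u' i = b}" by auto
        then show ?thesis using u' by simp
      qed
      moreover have "\<forall>i\<in>I. ?u i \<in> N i" using u u' by auto
      ultimately show ?thesis by (intro exI[of _ ?u]) blast
    next
      case False
      then have strict: "card J < sum c (\<Union>(N ` J))" if "J \<subset> I" "J \<noteq> {}" for J
        using less.prems(3)[of J] that by (metis le_neq_implies_less psubset_imp_subset)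
      obtain i where i: "i \<in> I" using ne by blast
      have "card {i} \<le> sum c (\<Union>(N ` {i}))" by (rule less.prems(3)) (use i in simp)
      then have "sum c (N i) \<noteq> 0" by simp
      then obtain b where b: "b \<in> N i" "c b > 0" by (meson gr0I sum.neutral)
      let ?c = "c(b := c b - 1)"
      have "\<exists>u. (\<forall>i\<in>I - {i}. u i \<in> N i) \<and> (\<forall>b. card {j\<in>I - {i}. u j = b} \<le> ?c b)"
      proof (rule less.hyps)
        show "card (I - {i}) < card I" by (rule card_Diff1_less[OF less.prems(1) i])
        show "card K \<le> sum ?c (\<Union>(N ` K))" if K: "K \<subseteq> I - {i}" for K
        proof (cases "K = {}")
          case False
          let ?U = "\<Union>(N ` K)"
          have "card K < sum c ?U" by (rule strict) (use K i False in auto)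
          moreover have "sum c ?U \<le> sum ?c ?U + 1"
          proof (cases "b \<in> ?U")
            case True
            have fU: "finite ?U" using finU[of K] K by blast
            have "sum c ?U = c b + sum c (?U - {b})" by (rule sum.remove[OF fU True])
            moreover have "sum ?c ?U = ?c b + sum ?c (?U - {b})" by (rule sum.remove[OF fU True])
            moreover have "sum ?c (?U - {b}) = sum c (?U - {b})" by (rule sum.cong) auto
            ultimately show ?thesis using b by simp
          next
            case False
            then have "sum ?c ?U = sum c ?U" by (intro sum.cong) auto
            then show ?thesis by simp
          qed
          ultimately show ?thesis by simp
        qed simp
      qed (use less.prems in auto)
      then obtain u where u: "\<forall>j\<in>I - {i}. u j \<in> N j" "\<forall>x. card {j\<in>I - {i}. u j = x} \<le> ?c x" by blast
      let ?u = "u(i := b)"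
      have "card {j\<in>I. ?u j = x} \<le> c x" for x
      proof (cases "x = b")
        case True
        have "{j\<in>I. ?u j = x} = insert i {j\<in>I - {i}. u j = x}" using i True by auto
        then have "card {j\<in>I. ?u j = x} \<le> Suc (card {j\<in>I - {i}. u j = x})" by (simp add: card_insert_le_m1 card_insert_if less.prems(1))
        also have "\<dots> \<le> c x" using u(2)[rule_format, of x] True b by simp
        finally show ?thesis .
      next
        case False
        then have "{j\<in>I. ?u j = x} = {j\<in>I - {i}. u j = x}" by auto
        then show ?thesis using u(2)[rule_format, of x] False by simp
      qed
      moreover have "\<forall>j\<in>I. ?u j \<in> N j" using u b by auto
      ultimately show ?thesis by (intro exI[of _ ?u]) blast
    qed
  qed
qed

section \<open>Greedy colouring and bad lists\<close>

definition nbrs :: "('a \<times> 'a) set \<Rightarrow> 'a set \<Rightarrow> 'a \<Rightarrow> 'a set" where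
  "nbrs A S u = {x \<in> S. (u, x) \<in> A}"

lemma nbrs_subset: "nbrs A S u \<subseteq> S"
  unfolding nbrs_def by blast

lemma finite_nbrs: "finite S \<Longrightarrow> finite (nbrs A S u)"
  unfolding nbrs_def by simp

lemma nbrs_mono: "S \<subseteq> T \<Longrightarrow> nbrs A S u \<subseteq> nbrs A T u"
  unfolding nbrs_def by blast

lemma card_nbrs_mono: "finite T \<Longrightarrow> S \<subseteq> T \<Longrightarrow> card (nbrs A S u) \<le> card (nbrs A T u)"
  by (intro card_mono finite_nbrs nbrs_mono)

lemma card_nbrs_less:
  assumes "finite T" "S \<subseteq> T" "x \<in> T - S" "(u, x) \<in> A"
  shows "card (nbrs A S u) < card (nbrs A T u)"
proof (rule psubset_card_mono)
  show "finite (nbrs A T u)" by (rule finite_nbrs[OF assms(1)])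
  show "nbrs A S u \<subset> nbrs A T u" using assms(2-4) unfolding nbrs_def by blast
qed

lemma card_nbrs_Un:
  assumes "finite S" "finite T" "S \<inter> T = {}"
  shows "card (nbrs A (S \<union> T) u) = card (nbrs A S u) + card (nbrs A T u)"
proof -
  have "nbrs A (S \<union> T) u = nbrs A S u \<union> nbrs A T u" unfolding nbrs_def by blast
  moreover have "card (nbrs A S u \<union> nbrs A T u) = card (nbrs A S u) + card (nbrs A T u)"
    by (rule card_Un_disjoint) (use assms in \<open>auto simp: nbrs_def\<close>)
  ultimately show ?thesis by simp
qed

lemma card_nbrs_Diff:
  assumes "finite S" "T \<subseteq> S"
  shows "card (nbrs A S u) = card (nbrs A (S - T) u) + card (nbrs A T u)"
proof -
  have "finite T" using assms finite_subset by blast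
  then have "card (nbrs A ((S - T) \<union> T) u) = card (nbrs A (S - T) u) + card (nbrs A T u)"
    by (intro card_nbrs_Un) (use assms(1) in auto)
  moreover have "(S - T) \<union> T = S" using assms(2) by blast
  ultimately show ?thesis by simp
qed

text \<open>The matchings of a cover are united into one symmetric relation C on colours, so that
  conflicts carry no edge label. Uniqueness of partners is stated from one end of an edge and
  follows for the other by symmetry.\<close>

locale cover_graph =
  fixes A :: "('a \<times> 'a) set" and L :: "'a \<Rightarrow> 'b set" and C :: "('b \<times> 'b) set"
  assumes symA: "sym A" and irreflA: "(x, x) \<notin> A" and symC: "sym C" and finL: "finite (L v)"
    and matching: "(u, v) \<in> A \<Longrightarrow> \<alpha> \<in> L u \<Longrightarrow> \<beta> \<in> L v \<Longrightarrow> \<beta>' \<in> L v \<Longrightarrow> (\<alpha>, \<beta>) \<in> C \<Longrightarrow> (\<alpha>, \<beta>') \<in> C \<Longrightarrow> \<beta> = \<beta>'"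
begin

lemma arcD: "(x, y) \<in> A \<Longrightarrow> (y, x) \<in> A" using symA by (rule symD)

lemma conflictD: "(\<alpha>, \<beta>) \<in> C \<Longrightarrow> (\<beta>, \<alpha>) \<in> C" using symC by (rule symD)

abbreviation deg :: "'a set \<Rightarrow> 'a \<Rightarrow> nat" where "deg S u \<equiv> card (nbrs A S u)"

definition proper :: "'a set \<Rightarrow> ('a \<Rightarrow> 'b set) \<Rightarrow> ('a \<Rightarrow> 'b) \<Rightarrow> bool" where
  "proper S R \<phi> \<longleftrightarrow> (\<forall>u\<in>S. \<phi> u \<in> R u) \<and> (\<forall>u\<in>S. \<forall>v\<in>S. (u, v) \<in> A \<longrightarrow> (\<phi> u, \<phi> v) \<notin> C)"

definition colourable :: "'a set \<Rightarrow> ('a \<Rightarrow> 'b set) \<Rightarrow> bool" where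
  "colourable S R \<longleftrightarrow> (\<exists>\<phi>. proper S R \<phi>)"

definition resid :: "('a \<Rightarrow> 'b set) \<Rightarrow> ('a \<Rightarrow> 'b) \<Rightarrow> 'a set \<Rightarrow> 'a \<Rightarrow> 'b set" where
  "resid R \<phi> P y = {\<alpha> \<in> R y. \<forall>x\<in>P. (y, x) \<in> A \<longrightarrow> (\<alpha>, \<phi> x) \<notin> C}"

definition sublists :: "'a set \<Rightarrow> ('a \<Rightarrow> 'b set) \<Rightarrow> bool" where
  "sublists S R \<longleftrightarrow> (\<forall>u\<in>S. R u \<subseteq> L u)"

lemma resid_subset: "resid R \<phi> P y \<subseteq> R y"
  unfolding resid_def by blast

lemma sublists_resid: "sublists S R \<Longrightarrow> T \<subseteq> S \<Longrightarrow> sublists T (resid R \<phi> P)"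
  unfolding sublists_def resid_def by blast

lemma sublists_subset: "sublists S R \<Longrightarrow> T \<subseteq> S \<Longrightarrow> sublists T R"
  unfolding sublists_def by blast

lemma card_partners:
  assumes "(u, v) \<in> A" "\<alpha> \<in> L u"
  shows "finite {\<beta> \<in> L v. (\<beta>, \<alpha>) \<in> C}" "card {\<beta> \<in> L v. (\<beta>, \<alpha>) \<in> C} \<le> 1"
proof -
  show fin: "finite {\<beta> \<in> L v. (\<beta>, \<alpha>) \<in> C}" using finL by simp
  show "card {\<beta> \<in> L v. (\<beta>, \<alpha>) \<in> C} \<le> 1"
    using fin matching[OF assms] conflictD by (intro card_le_Suc0_iff_eq[THEN iffD2, simplified One_nat_def[symmetric]]) blast+
qed

lemma card_resid:
  assumes P: "finite P" "\<And>x. x \<in> P \<Longrightarrow> \<phi> x \<in> L x" and R: "R y \<subseteq> L y"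
  shows "card (R y) \<le> card (resid R \<phi> P y) + deg P y"
proof -
  let ?K = "\<Union>x\<in>nbrs A P y. {\<alpha> \<in> L y. (\<alpha>, \<phi> x) \<in> C}"
  have fN: "finite (nbrs A P y)" using P(1) by (rule finite_nbrs)
  have "card ?K \<le> (\<Sum>x\<in>nbrs A P y. card {\<alpha> \<in> L y. (\<alpha>, \<phi> x) \<in> C})" by (rule card_UN_le[OF fN])
  also have "\<dots> \<le> (\<Sum>x\<in>nbrs A P y. 1)"
  proof (rule sum_mono)
    fix x assume "x \<in> nbrs A P y"
    then have "(x, y) \<in> A" "\<phi> x \<in> L x" using arcD P(2) unfolding nbrs_def by blast+
    then show "card {\<alpha> \<in> L y. (\<alpha>, \<phi> x) \<in> C} \<le> 1" by (rule card_partners)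
  qed
  finally have K: "card ?K \<le> deg P y" by simp
  have fK: "finite ?K" using fN finL by simp
  have "R y \<subseteq> resid R \<phi> P y \<union> ?K" unfolding resid_def nbrs_def using R by blast
  moreover have "finite (resid R \<phi> P y)" using resid_subset R finL finite_subset by metis
  ultimately have "card (R y) \<le> card (resid R \<phi> P y \<union> ?K)" using fK by (intro card_mono) auto
  also have "\<dots> \<le> card (resid R \<phi> P y) + card ?K" by (rule card_Un_le)
  finally show ?thesis using K by linarith
qed

lemma card_resid_less:
  assumes P: "finite P" "\<And>x. x \<in> P \<Longrightarrow> \<phi> x \<in> L x" and R: "R y \<subseteq> L y"
    and z: "z \<in> P" "(y, z) \<in> A"
    and dom: "\<And>\<alpha>. \<alpha> \<in> R y \<Longrightarrow> (\<alpha>, \<phi> z) \<in> C \<Longrightarrow> \<exists>x\<in>P - {z}. (y, x) \<in> A \<and> (\<alpha>, \<phi> x) \<in> C"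
  shows "card (R y) < card (resid R \<phi> P y) + deg P y"
proof -
  have "resid R \<phi> P y = resid R \<phi> (P - {z}) y" unfolding resid_def using dom by blast
  moreover have "card (R y) \<le> card (resid R \<phi> (P - {z}) y) + deg (P - {z}) y"
    by (rule card_resid) (use P R in auto)
  moreover have "deg (P - {z}) y < deg P y" by (rule card_nbrs_less[OF P(1), of _ z]) (use z in auto)
  ultimately show ?thesis by simp
qed

lemma proper_extend:
  assumes \<phi>: "proper P R \<phi>" and \<theta>: "proper T (resid R \<phi> P) \<theta>" and PT: "P \<inter> T = {}"
  shows "proper (P \<union> T) R (\<lambda>x. if x \<in> P then \<phi> x else \<theta> x)"
proof -
  have a: "\<theta> u \<in> R u" "\<And>x. x \<in> P \<Longrightarrow> (u, x) \<in> A \<Longrightarrow> (\<theta> u, \<phi> x) \<notin> C" if "u \<in> T" for u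
    using \<theta> that unfolding proper_def resid_def by auto
  have b: "(\<phi> x, \<theta> u) \<notin> C" if "u \<in> T" "x \<in> P" "(x, u) \<in> A" for x u
    using a(2)[OF that(1,2) arcD[OF that(3)]] conflictD by blast
  show ?thesis using \<phi> \<theta> a b PT unfolding proper_def by auto
qed

lemma colourable_extend:
  assumes "proper P R \<phi>" "colourable T (resid R \<phi> P)" "P \<inter> T = {}" "S = P \<union> T"
  shows "colourable S R"
  using assms proper_extend unfolding colourable_def by blast

text \<open>A vertex with a spare colour is coloured last. Its removal may disconnect S, hence the
  hypothesis speaks of all sets T that no arc leaves: such a set in the rest either touched z, and a
  vertex of it gains a spare colour, or was already closed in S.\<close>

theorem greedy:
  assumes "finite S" "sublists S R" "\<And>y. y \<in> S \<Longrightarrow> deg S y \<le> card (R y)"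
    and "\<And>T. T \<subseteq> S \<Longrightarrow> T \<noteq> {} \<Longrightarrow> \<not> touch A T (S - T) \<Longrightarrow> \<exists>z\<in>T. deg S z < card (R z)"
  shows "colourable S R"
  using assms
proof (induction "card S" arbitrary: S rule: less_induct)
  case less
  show ?case
  proof (cases "S = {}")
    case True then show ?thesis by (simp add: colourable_def proper_def)
  next
    case False
    have "\<not> touch A S (S - S)" unfolding touch_def by simp
    then obtain z where z: "z \<in> S" "deg S z < card (R z)" using less.prems(4)[of S] False by blast
    let ?S = "S - {z}"
    have "colourable ?S R"
    proof (rule less.hyps)
      show "card ?S < card S" by (rule card_Diff1_less[OF less.prems(1) z(1)])
      show "finite ?S" using less.prems(1) by simp
      show "sublists ?S R" using less.prems(2) by (rule sublists_subset) blast
      show "deg ?S y \<le> card (R y)" if "y \<in> ?S" for y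
        using less.prems(3)[of y] card_nbrs_mono[OF less.prems(1), of ?S A y] that by auto
      show "\<exists>x\<in>T. deg ?S x < card (R x)" if T: "T \<subseteq> ?S" "T \<noteq> {}" "\<not> touch A T (?S - T)" for T
      proof (cases "touch A T {z}")
        case True
        then obtain x where x: "x \<in> T" "(x, z) \<in> A" unfolding touch_def by blast
        have "deg ?S x < deg S x" by (rule card_nbrs_less[OF less.prems(1), of _ z]) (use z x in auto)
        then show ?thesis using less.prems(3)[of x] x T(1) by (intro bexI[of _ x]) auto
      next
        case False
        then have "\<not> touch A T (S - T)" using T(3) unfolding touch_def by blast
        then obtain x where x: "x \<in> T" "deg S x < card (R x)" using less.prems(4)[of T] T by blast
        then show ?thesis using card_nbrs_mono[OF less.prems(1), of ?S A x] by (intro bexI[of _ x]) auto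
      qed
    qed
    then obtain \<phi> where \<phi>: "proper ?S R \<phi>" unfolding colourable_def by blast
    have R: "R u \<subseteq> L u" if "u \<in> S" for u using less.prems(2) that unfolding sublists_def by blast
    have "card (R z) \<le> card (resid R \<phi> ?S z) + deg ?S z"
      by (rule card_resid) (use less.prems(1) \<phi> R z in \<open>auto simp: proper_def\<close>)
    moreover have "deg ?S z \<le> deg S z" using card_nbrs_mono[OF less.prems(1), of ?S A z] by auto
    ultimately have "card (resid R \<phi> ?S z) > 0" using z(2) by linarith
    then obtain \<alpha> where \<alpha>: "\<alpha> \<in> resid R \<phi> ?S z" by (metis card_gt_0_iff ex_in_conv)
    have "proper {z} (resid R \<phi> ?S) (\<lambda>_. \<alpha>)" using \<alpha> irreflA by (simp add: proper_def)
    then have "colourable {z} (resid R \<phi> ?S)" unfolding colourable_def by blast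
    then show ?thesis by (rule colourable_extend[OF \<phi>]) (use z in auto)
  qed
qed

corollary greedy_conn:
  assumes "finite S" "sublists S R" "\<And>y. y \<in> S \<Longrightarrow> deg S y \<le> card (R y)"
    and "conn A S" "z \<in> S" "deg S z < card (R z)"
  shows "colourable S R"
proof (rule greedy[OF assms(1-3)])
  show "\<exists>z\<in>T. deg S z < card (R z)" if T: "T \<subseteq> S" "T \<noteq> {}" "\<not> touch A T (S - T)" for T
  proof -
    have "T = S" using connD[OF assms(4), of T] T by blast
    then show ?thesis using assms(5,6) by blast
  qed
qed

section \<open>Lists of degree size without a colouring\<close>

definition badlist :: "'a set \<Rightarrow> ('a \<Rightarrow> 'b set) \<Rightarrow> bool" where
  "badlist Q R \<longleftrightarrow> sublists Q R \<and> (\<forall>u\<in>Q. deg Q u \<le> card (R u)) \<and> \<not> colourable Q R"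

lemma badlist_card:
  assumes "badlist Q R" "finite Q" "conn A Q" "u \<in> Q"
  shows "card (R u) = deg Q u"
  using greedy_conn[OF assms(2), of R u] assms unfolding badlist_def by fastforce

text \<open>The singleton is a separate case because \<open>conn\<close> excludes the empty
  set.\<close>

definition noncut :: "'a set \<Rightarrow> 'a \<Rightarrow> bool" where
  "noncut Q u \<longleftrightarrow> Q = {u} \<or> conn A (Q - {u})"

lemma noncut_conn: "noncut Q u \<Longrightarrow> v \<in> Q \<Longrightarrow> v \<noteq> u \<Longrightarrow> conn A (Q - {u})"
  unfolding noncut_def by blast

text \<open>If \<alpha> conflicted with nothing in the list of \<open>u'\<close>, colouring u first
  with \<alpha> would leave \<open>u'\<close> a spare colour in the connected rest, and greedy
  colouring would succeed.\<close>

lemma badlist_partner: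
  assumes bad: "badlist Q R" and Q: "finite Q" "conn A Q" and u: "u \<in> Q" "u' \<in> Q" "(u, u') \<in> A"
    and nc: "noncut Q u" and \<alpha>: "\<alpha> \<in> R u"
  shows "\<exists>\<beta>\<in>R u'. (\<alpha>, \<beta>) \<in> C"
proof (rule ccontr)
  assume n: "\<not> ?thesis"
  have R: "\<And>u. u \<in> Q \<Longrightarrow> R u \<subseteq> L u" "\<And>u. u \<in> Q \<Longrightarrow> deg Q u \<le> card (R u)"
    using bad unfolding badlist_def sublists_def by auto
  have ne: "u' \<noteq> u" using u irreflA by blast
  let ?S = "Q - {u}" and ?\<phi> = "\<lambda>_. \<alpha>"
  have p: "proper {u} R ?\<phi>" using \<alpha> irreflA by (simp add: proper_def)
  have D: "deg Q y = deg ?S y + deg {u} y" for y by (rule card_nbrs_Diff) (use Q u in auto)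
  have "colourable ?S (resid R ?\<phi> {u})"
  proof (rule greedy_conn)
    show "finite ?S" using Q by simp
    show "sublists ?S (resid R ?\<phi> {u})" using bad sublists_resid unfolding badlist_def by blast
    show "conn A ?S" by (rule noncut_conn[OF nc u(2) ne])
    show "deg ?S y \<le> card (resid R ?\<phi> {u} y)" if "y \<in> ?S" for y
    proof -
      have "card (R y) \<le> card (resid R ?\<phi> {u} y) + deg {u} y" by (rule card_resid) (use R u \<alpha> that in auto)
      then show ?thesis using D[of y] R(2)[of y] that by simp
    qed
    show "u' \<in> ?S" using u ne by blast
    have "card (R u') < card (resid R ?\<phi> {u} u') + deg {u} u'"
      by (rule card_resid_less[where z = u]) (use R u \<alpha> arcD n conflictD in auto)
    then show "deg ?S u' < card (resid R ?\<phi> {u} u')" using D[of u'] R(2)[OF u(2)] by simp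
  qed
  then have "colourable Q R" by (rule colourable_extend[OF p]) (use u in auto)
  then show False using bad unfolding badlist_def by blast
qed

lemma card_partner_le:
  assumes u: "(u, u') \<in> A" and X: "X \<subseteq> L u" and Y: "Y \<subseteq> L u'" and p: "\<And>\<alpha>. \<alpha> \<in> X \<Longrightarrow> \<exists>\<beta>\<in>Y. (\<alpha>, \<beta>) \<in> C"
  shows "card X \<le> card Y"
proof -
  from p obtain g where g: "\<And>\<alpha>. \<alpha> \<in> X \<Longrightarrow> g \<alpha> \<in> Y \<and> (\<alpha>, g \<alpha>) \<in> C" by metis
  have "inj_on g X"
  proof (rule inj_onI)
    fix x y assume xy: "x \<in> X" "y \<in> X" "g x = g y"
    show "x = y" by (rule matching[OF arcD[OF u], of "g x"]) (use xy g[of x] g[of y] X Y conflictD in auto)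
  qed
  moreover have "finite Y" using Y finL finite_subset by blast
  ultimately show ?thesis using g by (intro card_inj_on_le[of g]) auto
qed

text \<open>Partners inject each of the two lists into the other, and in a bad list the sizes are
  the degrees.\<close>

lemma badlist_deg_eq:
  assumes bad: "badlist Q R" and Q: "finite Q" "conn A Q" and u: "u \<in> Q" "u' \<in> Q" "(u, u') \<in> A"
    and nc: "noncut Q u" "noncut Q u'"
  shows "deg Q u = deg Q u'"
proof -
  have R: "\<And>u. u \<in> Q \<Longrightarrow> R u \<subseteq> L u" using bad unfolding badlist_def sublists_def by auto
  have "card (R u) \<le> card (R u')"
    by (rule card_partner_le[OF u(3) R[OF u(1)] R[OF u(2)] badlist_partner[OF bad Q u nc(1)]])
  moreover have "card (R u') \<le> card (R u)"
    by (rule card_partner_le[OF arcD[OF u(3)] R[OF u(2)] R[OF u(1)] badlist_partner[OF bad Q u(2,1) arcD[OF u(3)] nc(2)]])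
  ultimately show ?thesis using badlist_card[OF bad Q] u by simp
qed

text \<open>The device behind Brooks' theorem: the colours of y and z forbid the same colour \<beta>
  at x, so x loses one colour to two neighbours and has a spare one in the connected rest.\<close>

lemma colourable_two_first:
  assumes Q: "finite Q" "sublists Q R" "\<And>u. u \<in> Q \<Longrightarrow> deg Q u \<le> card (R u)"
    and yz: "y \<in> Q" "z \<in> Q" "y \<noteq> z" "(y, z) \<notin> A" and S: "conn A (Q - {y, z})"
    and x: "x \<in> Q" "(x, y) \<in> A" "(x, z) \<in> A"
    and col: "\<alpha> \<in> R y" "\<gamma> \<in> R z" "\<beta> \<in> R x" "(\<alpha>, \<beta>) \<in> C" "(\<beta>, \<gamma>) \<in> C"
  shows "colourable Q R"
proof -
  let ?S = "Q - {y, z}" and ?\<phi> = "\<lambda>v. if v = y then \<alpha> else \<gamma>"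
  have R: "\<And>u. u \<in> Q \<Longrightarrow> R u \<subseteq> L u" using Q unfolding sublists_def by auto
  have zy: "(z, y) \<notin> A" using yz(4) arcD by blast
  have p: "proper {y, z} R ?\<phi>" using col yz irreflA zy by (auto simp: proper_def)
  have \<phi>L: "\<And>v. v \<in> {y, z} \<Longrightarrow> ?\<phi> v \<in> L v" using col R yz by auto
  have D: "deg Q v = deg ?S v + deg {y, z} v" for v by (rule card_nbrs_Diff) (use Q yz in auto)
  have "colourable ?S (resid R ?\<phi> {y, z})"
  proof (rule greedy_conn[OF _ _ _ S])
    show "finite ?S" using Q by simp
    show "sublists ?S (resid R ?\<phi> {y, z})" using Q(2) sublists_resid by blast
    show "deg ?S v \<le> card (resid R ?\<phi> {y, z} v)" if v: "v \<in> ?S" for v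
    proof -
      have "card (R v) \<le> card (resid R ?\<phi> {y, z} v) + deg {y, z} v"
        by (rule card_resid[OF _ \<phi>L]) (use R v in auto)
      then show ?thesis using D[of v] Q(3)[of v] v by simp
    qed
    show "x \<in> ?S" using x irreflA by blast
    have "card (R x) < card (resid R ?\<phi> {y, z} x) + deg {y, z} x"
    proof (rule card_resid_less[where z = z, OF _ \<phi>L])
      fix \<delta> assume \<delta>: "\<delta> \<in> R x" "(\<delta>, ?\<phi> z) \<in> C"
      have "\<delta> = \<beta>" by (rule matching[OF arcD[OF x(3)], of \<gamma>]) (use \<delta> yz col R x conflictD in auto)
      then show "\<exists>v\<in>{y, z} - {z}. (x, v) \<in> A \<and> (\<delta>, ?\<phi> v) \<in> C" using x yz col conflictD by auto
    qed (use R x in auto)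
    then show "deg ?S x < card (resid R ?\<phi> {y, z} x)" using D[of x] Q(3)[OF x(1)] by simp
  qed
  then show ?thesis by (rule colourable_extend[OF p]) (use yz in auto)
qed

text \<open>A colour at y has a partner at x, and this has a partner at z; these are the three
  colours that \<open>colourable_two_first\<close> asks for.\<close>

lemma badlist_no_triple:
  assumes bad: "badlist Q R" and Q: "finite Q" "conn A Q" and yz: "y \<in> Q" "z \<in> Q" "y \<noteq> z" "(y, z) \<notin> A"
    and x: "x \<in> Q" "(x, y) \<in> A" "(x, z) \<in> A" and nc: "noncut Q x" "noncut Q y"
  shows "\<not> conn A (Q - {y, z})"
proof
  assume S: "conn A (Q - {y, z})"
  have b: "sublists Q R" "\<And>u. u \<in> Q \<Longrightarrow> deg Q u \<le> card (R u)" "\<not> colourable Q R"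
    using bad unfolding badlist_def by auto
  have "nbrs A Q y \<noteq> {}" using x arcD unfolding nbrs_def by blast
  then have "deg Q y > 0" using finite_nbrs[OF Q(1)] by (simp add: card_gt_0_iff)
  then have "card (R y) > 0" using b(2)[OF yz(1)] by linarith
  then obtain \<alpha> where \<alpha>: "\<alpha> \<in> R y" by (metis card_gt_0_iff ex_in_conv)
  obtain \<beta> where \<beta>: "\<beta> \<in> R x" "(\<alpha>, \<beta>) \<in> C"
    using badlist_partner[OF bad Q yz(1) x(1) arcD[OF x(2)] nc(2) \<alpha>] by blast
  obtain \<gamma> where \<gamma>: "\<gamma> \<in> R z" "(\<beta>, \<gamma>) \<in> C"
    using badlist_partner[OF bad Q x(1) yz(2) x(3) nc(1) \<beta>(1)] by blast
  show False using colourable_two_first[OF Q(1) b(1,2) yz S x \<alpha> \<gamma>(1) \<beta> \<gamma>(2)] b(3) by blast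
qed

end

section \<open>Ends of connected sets\<close>

lemma conn_star:
  assumes A: "sym A" and K: "conn A K" "K \<subseteq> T"
    and all: "\<And>x. x \<in> T \<Longrightarrow> \<exists>D. conn A D \<and> D \<subseteq> T \<and> x \<in> D \<and> (D \<inter> K \<noteq> {} \<or> touch A D K)"
  shows "conn A T"
proof -
  obtain c where c: "c \<in> K" using conn_nonempty[OF K(1)] by blast
  define F where "F = {D. conn A D \<and> D \<subseteq> T \<and> c \<in> D}"
  have "\<exists>D\<in>F. x \<in> D" if x: "x \<in> T" for x
  proof -
    from all[OF x] obtain D where D: "conn A D" "D \<subseteq> T" "x \<in> D" "D \<inter> K \<noteq> {} \<or> touch A D K" by blast
    have "conn A (D \<union> K)" by (rule conn_Un[OF A D(1) K(1) D(4)])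
    then have "D \<union> K \<in> F" using D(2) K(2) c by (simp add: F_def)
    then show ?thesis using D(3) by blast
  qed
  then have "\<Union>F = T" by (auto simp: F_def)
  moreover have "conn A (\<Union>F)" by (rule conn_Union[of _ _ c]) (use K c in \<open>auto simp: F_def\<close>)
  ultimately show ?thesis by simp
qed

lemma closed_absorb:
  assumes T: "conn A T" "T \<subseteq> S" and D: "\<not> touch A D (S - D)" and meet: "T \<inter> D \<noteq> {}"
  shows "T \<subseteq> D"
proof (rule ccontr)
  assume "\<not> T \<subseteq> D"
  then have "touch A (T \<inter> D) (T - T \<inter> D)" using connD[OF T(1), of "T \<inter> D"] meet by blast
  then have "touch A D (S - D)" by (rule touch_mono) (use T(2) in auto)
  then show False using D by blast
qed

lemma conn_distance_two:
  assumes S: "conn A S" and pq: "p \<in> S" "q \<in> S" "p \<noteq> q" "(p, q) \<notin> A"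
  obtains x q' where "x \<in> S" "q' \<in> S" "(p, x) \<in> A" "(x, q') \<in> A" "q' \<noteq> p" "(p, q') \<notin> A"
proof -
  let ?T = "insert p (nbrs A S p)"
  have "touch A ?T (S - ?T)" by (rule connD[OF S]) (use pq in \<open>auto simp: nbrs_def\<close>)
  then obtain x q' where x: "x \<in> ?T" "q' \<in> S - ?T" "(x, q') \<in> A" unfolding touch_def by blast
  then have "x \<noteq> p" unfolding nbrs_def by blast
  then show ?thesis using that[of x q'] x unfolding nbrs_def by blast
qed

text \<open>All neighbours of f are held together by K, so f is not a cut vertex.\<close>

lemma conn_remove:
  assumes A: "sym A" and S: "conn A S" and K: "conn A K" "K \<subseteq> S - {f}" and N: "nbrs A S f \<subseteq> K"
  shows "conn A (S - {f})"
  unfolding conn_def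
proof (intro conjI allI impI)
  show "S - {f} \<noteq> {}" using K conn_nonempty by blast
  fix T assume T: "T \<subseteq> S - {f} \<and> T \<noteq> {} \<and> T \<noteq> S - {f}"
  show "touch A T (S - {f} - T)"
  proof (rule ccontr)
    assume n: "\<not> touch A T (S - {f} - T)"
    have nf: "(x, f) \<notin> A" if "x \<in> S" "x \<notin> K" for x
      using N that symD[OF A] unfolding nbrs_def by blast
    have "K \<subseteq> T \<or> K \<inter> T = {}" using closed_absorb[OF K n] by blast
    then show False
    proof
      assume KT: "K \<inter> T = {}"
      have "touch A T (S - T)" by (rule connD[OF S]) (use T K in auto)
      then obtain x y where xy: "x \<in> T" "y \<in> S - T" "(x, y) \<in> A" unfolding touch_def by blast
      then have "y \<noteq> f" using nf[of x] KT T by blast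
      then show False using n xy unfolding touch_def by blast
    next
      assume KT: "K \<subseteq> T"
      let ?U = "S - {f} - T"
      have "touch A ?U (S - ?U)" by (rule connD[OF S]) (use T in auto)
      then obtain x y where xy: "x \<in> ?U" "y \<in> S - ?U" "(x, y) \<in> A" unfolding touch_def by blast
      then have "y \<noteq> f" using nf[of x] KT by blast
      then have "y \<in> T" "(y, x) \<in> A" using xy symD[OF A] by blast+
      then show False using n xy unfolding touch_def by blast
    qed
  qed
qed

text \<open>K lies within a single component; F is another one.\<close>

lemma ex_closed_part:
  assumes A: "sym A" and S: "S \<noteq> {}" "\<not> conn A S" and K: "K \<subseteq> S" "K = {} \<or> conn A K"
  obtains F where "conn A F" "F \<subseteq> S - K" "\<not> touch A F (S - F)" "S - F \<noteq> {}"
proof -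
  obtain k where k: "k \<in> S" "K \<noteq> {} \<Longrightarrow> k \<in> K" using S(1) K(1) by blast
  have Kk: "K \<subseteq> component A S k"
    using K k component_max[of A K S k] by blast
  have "component A S k \<noteq> S" using S(2) component_conn[OF k(1), of A] by metis
  then obtain x where x: "x \<in> S" "x \<notin> component A S k" using component_subset[of A S k] by blast
  let ?F = "component A S x"
  have dj: "?F \<inter> component A S k = {}"
  proof (rule ccontr)
    assume "\<not> ?thesis"
    then obtain u where "u \<in> ?F" "u \<in> component A S k" by blast
    then have "?F = component A S k" using component_eq[OF A x(1)] component_eq[OF A k(1)] by metis
    then show False using x component_self[OF x(1), of A] by blast
  qed
  show ?thesis
  proof (rule that[of ?F])
    show "conn A ?F" by (rule component_conn[OF x(1)])
    show "?F \<subseteq> S - K" using dj Kk component_subset[of A S x] by blast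
    show "\<not> touch A ?F (S - ?F)" by (rule component_closed[OF A x(1)])
    show "S - ?F \<noteq> {}" using dj k component_self[OF k(1), of A] by blast
  qed
qed

context cover_graph begin

text \<open>A leaf block without its cut vertex w is an end with W = {w}; the whole set is an end with
  W = {} if it has no cut vertex.\<close>
definition end_of :: "'a set \<Rightarrow> 'a set \<Rightarrow> 'a set \<Rightarrow> bool" where
  "end_of Q E W \<longleftrightarrow> conn A E \<and> E \<subseteq> Q \<and> W \<subseteq> Q - E \<and> finite W \<and> card W \<le> 1 \<and> (\<forall>x\<in>E. noncut Q x) \<and>
     \<not> touch A E (Q - E - W) \<and> (W = {} \<longrightarrow> E = Q)"

lemma end_ofD:
  assumes "end_of Q E W"
  shows "conn A E" "E \<subseteq> Q" "W \<subseteq> Q - E" "\<And>x. x \<in> E \<Longrightarrow> noncut Q x" "\<not> touch A E (Q - E - W)"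
  using assms unfolding end_of_def by auto

lemma end_of_whole: "conn A Q \<Longrightarrow> (\<And>x. x \<in> Q \<Longrightarrow> noncut Q x) \<Longrightarrow> end_of Q Q {}"
  unfolding end_of_def touch_def by auto

text \<open>If the component D of Q - z contains no cut vertex of Q, it is an end itself. Otherwise
  a cut vertex x in D leaves a component of Q - x that avoids z; it lies properly inside D, and x
  takes over the role of z.\<close>

lemma end_inside:
  assumes "finite Q" "conn A Q" "z \<in> Q" "conn A D" "D \<subseteq> Q - {z}" "\<not> touch A D (Q - {z} - D)"
  shows "\<exists>E w. end_of Q E {w} \<and> E \<subseteq> D \<and> w \<in> insert z D"
  using assms
proof (induction "card D" arbitrary: D z rule: less_induct)
  case less
  have fD: "finite D" using less.prems(1,5) finite_subset by blast
  show ?case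
  proof (cases "\<forall>x\<in>D. noncut Q x")
    case True
    have "\<not> touch A D (Q - D - {z})" using less.prems(6) unfolding touch_def by blast
    then have "end_of Q D {z}" unfolding end_of_def using less.prems True by auto
    then show ?thesis by blast
  next
    case False
    then obtain x where x: "x \<in> D" "\<not> noncut Q x" by blast
    let ?S = "Q - {x}"
    have S: "\<not> conn A ?S" using x unfolding noncut_def by blast
    have zS: "z \<in> ?S" using less.prems(3,5) x by blast
    obtain D' where D': "conn A D'" "D' \<subseteq> ?S - {z}" "\<not> touch A D' (?S - D')"
      using ex_closed_part[OF symA _ S, of "{z}"] zS by auto
    have "touch A D' (Q - D')" by (rule connD[OF less.prems(2)]) (use D' less.prems conn_nonempty in auto)
    then obtain a b where "a \<in> D'" "b \<in> Q - D'" "(a, b) \<in> A" unfolding touch_def by blast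
    with D'(3) have tx: "touch A D' {x}" unfolding touch_def by blast
    have "conn A (insert x D')" by (rule conn_insert[OF symA D'(1)]) (use tx touch_commute[OF symA] in blast)
    then have "insert x D' \<subseteq> D"
      by (rule closed_absorb[OF _ _ less.prems(6)]) (use D' x less.prems(5) in auto)
    then have sub: "D' \<subset> D" "x \<in> D" using D' x by auto
    have "\<exists>E w. end_of Q E {w} \<and> E \<subseteq> D' \<and> w \<in> insert x D'"
    proof (rule less.hyps)
      show "card D' < card D" by (rule psubset_card_mono[OF fD sub(1)])
    qed (use less.prems x D' in auto)
    then show ?thesis using sub by blast
  qed
qed

lemma end_conn_Diff:
  assumes Q: "conn A Q" and E: "end_of Q E {w}"
  shows "conn A (Q - E)"
proof (rule conn_Diff_pendant[OF symA Q])
  show "w \<in> Q - E" using end_ofD(3)[OF E] by blast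
  fix x assume x: "x \<in> Q - E" "touch A {x} E"
  then have "touch A E {x}" using touch_commute[OF symA] by blast
  then show "x = w" using end_ofD(5)[OF E] x(1) unfolding touch_def by blast
qed

text \<open>Two components of Q - x contain one end each. The part between them stays connected
  because each end is attached at a single vertex; it later serves as a branch set of K33.\<close>

lemma two_ends:
  assumes Q: "finite Q" "conn A Q" and cut: "x \<in> Q" "\<not> noncut Q x"
  obtains E1 w1 E2 w2 where "end_of Q E1 {w1}" "end_of Q E2 {w2}" "E1 \<inter> E2 = {}" "w1 \<notin> E2" "w2 \<notin> E1"
    "conn A (Q - E1 - E2)"
proof -
  let ?S = "Q - {x}"
  have S: "?S \<noteq> {}" "\<not> conn A ?S" using cut Q unfolding noncut_def by blast+
  obtain D1 where D1: "conn A D1" "D1 \<subseteq> ?S" "\<not> touch A D1 (?S - D1)" "?S - D1 \<noteq> {}"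
    using ex_closed_part[OF symA S, of "{}"] by auto
  obtain D2 where D2: "conn A D2" "D2 \<subseteq> ?S - D1" "\<not> touch A D2 (?S - D2)"
    using ex_closed_part[OF symA S D1(2) disjI2[OF D1(1)]] by blast
  obtain E1 w1 where E1: "end_of Q E1 {w1}" "E1 \<subseteq> D1" "w1 \<in> insert x D1"
    using end_inside[OF Q cut(1) D1(1-3)] by blast
  obtain E2 w2 where E2: "end_of Q E2 {w2}" "E2 \<subseteq> D2" "w2 \<in> insert x D2"
    using end_inside[OF Q cut(1) D2(1) _ D2(3)] D2(2) by blast
  have dj: "E1 \<inter> E2 = {}" "w1 \<notin> E2" "w2 \<notin> E1" using E1 E2 D1(2) D2(2) by blast+
  have "conn A (Q - E1 - E2)"
  proof (rule conn_Diff_pendant[OF symA end_conn_Diff[OF Q(2) E1(1)]])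
    show "w2 \<in> Q - E1 - E2" using end_ofD(3)[OF E2(1)] dj by blast
    fix u assume u: "u \<in> Q - E1 - E2" "touch A {u} E2"
    then have "touch A E2 {u}" using touch_commute[OF symA] by blast
    then show "u = w2" using end_ofD(5)[OF E2(1)] u(1) unfolding touch_def by blast
  qed
  then show ?thesis using that[OF E1(1) E2(1) dj] by blast
qed

lemma end_touch:
  assumes Q: "conn A Q" and E: "end_of Q E {w}"
  obtains x where "x \<in> E" "(x, w) \<in> A"
proof -
  have "touch A E (Q - E)" by (rule connD[OF Q]) (use end_ofD[OF E] conn_nonempty in auto)
  then obtain x y where xy: "x \<in> E" "y \<in> Q - E" "(x, y) \<in> A" unfolding touch_def by blast
  then have "y = w" using end_ofD(5)[OF E] unfolding touch_def by blast
  then show ?thesis using that xy by blast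
qed

text \<open>If w had only one neighbour in E, that neighbour would be a cut vertex, and an end
  contains none.\<close>

lemma end_two_nbrs:
  assumes Q: "conn A Q" and E: "end_of Q E {w}" and two: "\<And>e. E \<noteq> {e}"
  obtains x y where "x \<in> E" "y \<in> E" "x \<noteq> y" "(x, w) \<in> A" "(y, w) \<in> A"
proof -
  obtain x where x: "x \<in> E" "(x, w) \<in> A" using end_touch[OF Q E] by blast
  have w: "w \<in> Q" "w \<notin> E" using end_ofD(3)[OF E] by blast+
  have "conn A (Q - {x})" by (rule noncut_conn[OF end_ofD(4)[OF E x(1)] w(1)]) (use x w in auto)
  then have "touch A (E - {x}) (Q - {x} - (E - {x}))"
    by (rule connD) (use end_ofD(2)[OF E] w x two[of x] in auto)
  then obtain y q where y: "y \<in> E - {x}" "q \<in> Q - E" "(y, q) \<in> A" unfolding touch_def using x by blast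
  then have "q = w" using end_ofD(5)[OF E] unfolding touch_def by blast
  then show ?thesis using that[of x y] x y by blast
qed

text \<open>An argument in the style of Brooks' theorem within one end. Nonadjacent vertices yield
  y, z in E and a component F of Q - {y, z} inside E with something left over. For a smallest F,
  every vertex of F is adjacent to all the others in F and to y and z. The degree d then leaves y
  and z one further neighbour each, and this must be w. So E is a complete graph without the edge
  yz, hanging at w, and Q is coloured directly.\<close>

theorem end_clique:
  assumes bad: "badlist Q R" and Q: "finite Q" "conn A Q" and E: "end_of Q E W"
    and d: "\<And>x. x \<in> E \<Longrightarrow> deg Q x = d" "3 \<le> d"
    and pq: "p \<in> E" "q \<in> E" "p \<noteq> q"
  shows "(p, q) \<in> A"
proof (rule ccontr)
  assume npq: "(p, q) \<notin> A"
  note EQ = end_ofD[OF E]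
  define P where "P F y z \<longleftrightarrow> y \<in> E \<and> z \<in> E \<and> y \<noteq> z \<and> conn A F \<and> F \<subseteq> E - {y, z} \<and>
    \<not> touch A F (Q - {y, z} - F) \<and> Q - {y, z} - F \<noteq> {}" for F y z
  have "\<exists>F y z. P F y z"
  proof -
    obtain x z where xz: "x \<in> E" "z \<in> E" "(p, x) \<in> A" "(x, z) \<in> A" "z \<noteq> p" "(p, z) \<notin> A"
      using conn_distance_two[OF EQ(1) pq npq] by blast
    let ?S = "Q - {p, z}"
    have "\<not> conn A ?S"
      by (rule badlist_no_triple[OF bad Q, of p z x]) (use xz EQ pq arcD in auto)
    moreover have "x \<in> ?S" using xz EQ(2) irreflA by auto
    moreover have "W \<subseteq> ?S" using EQ(3) pq xz by blast
    moreover have "W = {} \<or> conn A W"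
    proof -
      have "finite W" "card W \<le> 1" using E unfolding end_of_def by auto
      then have "W = {} \<or> (\<exists>w. W = {w})" by (metis card_0_eq card_1_singletonE le_neq_implies_less less_one)
      then show ?thesis by auto
    qed
    ultimately obtain F where F: "conn A F" "F \<subseteq> ?S - W" "\<not> touch A F (?S - F)" "?S - F \<noteq> {}"
      using ex_closed_part[OF symA, of ?S W] by blast
    have "touch A F (Q - F)" by (rule connD[OF Q(2)]) (use F conn_nonempty pq EQ(2) in auto)
    then obtain f v where fv: "f \<in> F" "v \<in> Q - F" "(f, v) \<in> A" unfolding touch_def by blast
    then have v: "v \<in> {p, z}" using F(3) unfolding touch_def by blast
    have "conn A (insert v F)" by (rule conn_insert[OF symA F(1)]) (use fv arcD in \<open>auto simp: touch_def\<close>)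
    moreover have "\<not> touch A E (Q - W - E)" using EQ(5) unfolding touch_def by blast
    ultimately have "insert v F \<subseteq> E"
      by (intro closed_absorb[of A "insert v F" "Q - W" E]) (use v pq xz F EQ in auto)
    then show ?thesis using F xz pq unfolding P_def by blast
  qed
  then have ex: "\<exists>n. \<exists>F y z. P F y z \<and> card F = n" by blast
  define n where "n = (LEAST n. \<exists>F y z. P F y z \<and> card F = n)"
  obtain F y z where Fyz: "P F y z" "card F = n" using LeastI_ex[OF ex] unfolding n_def by blast
  have least: "n \<le> card F'" if "P F' y' z'" for F' y' z'
    unfolding n_def by (rule Least_le) (use that in blast)
  have yz: "y \<in> E" "z \<in> E" "y \<noteq> z" and F: "conn A F" "F \<subseteq> E - {y, z}" "\<not> touch A F (Q - {y, z} - F)"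
    and ne: "Q - {y, z} - F \<noteq> {}" using Fyz(1) unfolding P_def by auto
  let ?S = "Q - {y, z}"
  define Rst where "Rst = ?S - F"
  have fF: "finite F" using F(2) EQ(2) Q(1) by (meson Diff_subset finite_subset subset_trans)
  have yzQ: "y \<in> Q" "z \<in> Q" using yz EQ(2) by auto
  have tt: "touch A {v} T" if T: "T \<subseteq> ?S" "T \<noteq> {}" "\<not> touch A T (?S - T)" and v: "v \<in> {y, z}" for T v
  proof -
    obtain v' where v': "{v, v'} = {y, z}" "v' \<noteq> v" using v yz(3) by auto
    have "conn A (Q - {v'})" by (rule noncut_conn[of _ _ v]) (use EQ(4) yz yzQ v v' in auto)
    then have "touch A T (Q - {v'} - T)" by (rule connD) (use T v v' yzQ in auto)
    moreover have "Q - {v'} - T \<subseteq> insert v (?S - T)" using v' by blast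
    ultimately have "touch A T {v}" using T(3) unfolding touch_def by blast
    then show ?thesis using touch_commute[OF symA] by blast
  qed
  have tF: "touch A {v} F" if "v \<in> {y, z}" for v
    by (rule tt) (use F EQ(2) that conn_nonempty in auto)
  have comp: "\<exists>D. conn A D \<and> D \<subseteq> Rst \<and> x \<in> D \<and> touch A D {y} \<and> touch A D {z}" if x: "x \<in> Rst" for x
  proof -
    have xS: "x \<in> ?S" using x unfolding Rst_def by blast
    let ?D = "component A ?S x"
    have D: "conn A ?D" "?D \<subseteq> ?S" "x \<in> ?D" "\<not> touch A ?D (?S - ?D)"
      using component_conn[OF xS, of A] component_subset[of A ?S x] component_self[OF xS, of A] component_closed[OF symA xS] by auto
    have "?D \<inter> F = {}"
    proof (rule ccontr)
      assume "?D \<inter> F \<noteq> {}"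
      then have "?D \<subseteq> F" by (rule closed_absorb[OF D(1,2) F(3)])
      then show False using D(3) x unfolding Rst_def by blast
    qed
    then have "?D \<subseteq> Rst" using D(2) unfolding Rst_def by blast
    moreover have "touch A {y} ?D" "touch A {z} ?D" using tt[OF D(2) _ D(4)] D(3) by blast+
    ultimately show ?thesis using D touch_commute[OF symA] by blast
  qed
  have core1: "conn A (insert v Rst)" if v: "v \<in> {y, z}" for v
  proof (rule conn_star[OF symA, of "{v}"])
    fix x assume x: "x \<in> insert v Rst"
    show "\<exists>D. conn A D \<and> D \<subseteq> insert v Rst \<and> x \<in> D \<and> (D \<inter> {v} \<noteq> {} \<or> touch A D {v})"
    proof (cases "x = v")
      case True then show ?thesis by (intro exI[of _ "{v}"]) auto
    next
      case False
      then obtain D where "conn A D" "D \<subseteq> Rst" "x \<in> D" "touch A D {y}" "touch A D {z}" using comp[of x] x by blast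
      then show ?thesis using v by (intro exI[of _ D]) auto
    qed
  qed auto
  have tR: "touch A {v} Rst" if v: "v \<in> {y, z}" for v
  proof -
    obtain x where "x \<in> Rst" using ne unfolding Rst_def by blast
    from comp[OF this] obtain D where "D \<subseteq> Rst" "touch A D {v}" using v by blast
    then show ?thesis using touch_commute[OF symA] touch_mono by blast
  qed
  have core2: "conn A (insert y (insert z Rst))"
    by (rule conn_insert[OF symA core1]) (use tR[of y] in \<open>auto simp: touch_def\<close>)
  \<comment> \<open>A missing edge at f would give another separating pair containing f, and a part
    of Q that this pair cuts off would lie properly inside F.\<close>
  have adj: "(f, g) \<in> A" if f: "f \<in> F" and g: "g \<in> F \<union> {y, z}" "g \<noteq> f" for f g
  proof (rule ccontr)
    assume nfg: "(f, g) \<notin> A"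
    have "conn A (insert g F)"
    proof (cases "g \<in> F")
      case True then show ?thesis using F(1) by (simp add: insert_absorb)
    next
      case False then show ?thesis using g tF[of g] by (intro conn_insert[OF symA F(1)]) auto
    qed
    then obtain x g' where x: "x \<in> insert g F" "g' \<in> insert g F" "(f, x) \<in> A" "(x, g') \<in> A" "g' \<noteq> f" "(f, g') \<notin> A"
      using conn_distance_two[of A "insert g F" f g] f g nfg by blast
    have xF: "x \<in> F" using x nfg by auto
    have g': "g' \<in> F \<union> {y, z}" using x(2) g(1) by blast
    have inE: "f \<in> E" "g' \<in> E" "x \<in> E" using f g' xF F(2) yz by auto
    let ?S' = "Q - {f, g'}" and ?K = "insert y (insert z Rst) - {g'}"
    have nS: "\<not> conn A ?S'"
      by (rule badlist_no_triple[OF bad Q, of f g' x]) (use x inE EQ arcD in auto)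
    have gR: "g' \<notin> Rst" using g' unfolding Rst_def by blast
    have K: "conn A ?K"
    proof -
      consider "g' \<in> F" "g' \<noteq> y" "g' \<noteq> z" | "g' = y" | "g' = z" using g' F(2) by blast
      then show ?thesis
      proof cases
        case 1 then have "?K = insert y (insert z Rst)" using gR by blast
        then show ?thesis using core2 by simp
      next
        case 2 then have "?K = insert z Rst" using gR yz by blast
        then show ?thesis using core1 by simp
      next
        case 3 then have "?K = insert y Rst" using gR yz by blast
        then show ?thesis using core1 by simp
      qed
    qed
    have KS: "?K \<subseteq> ?S'" using yzQ f F(2) unfolding Rst_def by blast
    have "?S' \<noteq> {}" using conn_nonempty[OF K] KS by blast
    then obtain F' where F': "conn A F'" "F' \<subseteq> ?S' - ?K" "\<not> touch A F' (?S' - F')" "?S' - F' \<noteq> {}"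
      using ex_closed_part[OF symA _ nS KS disjI2[OF K]] by blast
    have sub: "F' \<subseteq> F - {f}" using F'(2) unfolding Rst_def by blast
    have "P F' f g'" unfolding P_def using F' sub inE x F(2) by blast
    from least[OF this] have "card F \<le> card F'" using Fyz(2) by simp
    moreover have "card F' < card F" by (rule psubset_card_mono[OF fF]) (use sub f in blast)
    ultimately show False by simp
  qed
  have nbF: "nbrs A Q f = insert y (insert z F) - {f}" if f: "f \<in> F" for f
  proof
    show "nbrs A Q f \<subseteq> insert y (insert z F) - {f}"
      using F(3) f irreflA unfolding nbrs_def touch_def by blast
    show "insert y (insert z F) - {f} \<subseteq> nbrs A Q f"
      using adj[OF f] yzQ F(2) EQ(2) unfolding nbrs_def by blast
  qed
  have yF: "y \<notin> F" "z \<notin> F" using F(2) by auto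
  obtain f0 where f0: "f0 \<in> F" using F(1) conn_nonempty by blast
  have cF: "d = card F + 1"
  proof -
    have "deg Q f0 = card (insert y (insert z F) - {f0})" using nbF[OF f0] by simp
    also have "\<dots> = card F + 1" using f0 yF yz(3) fF by simp
    finally show ?thesis using d(1)[of f0] f0 F(2) by auto
  qed
  have Fv: "F \<subseteq> nbrs A Q v" if v: "v \<in> {y, z}" for v
  proof
    fix f assume f: "f \<in> F"
    then have "(f, v) \<in> A" using adj[OF f, of v] v yF by blast
    then show "f \<in> nbrs A Q v" using arcD f F(2) EQ(2) unfolding nbrs_def by blast
  qed
  have nbv: "\<exists>r. r \<in> Rst \<and> r \<in> W \<and> nbrs A Q v = insert r F" if v: "v \<in> {y, z}" for v
  proof -
    obtain r where r: "r \<in> Rst" "(v, r) \<in> A" using tR[OF v] unfolding touch_def by blast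
    have rF: "r \<notin> F" "r \<in> Q" "r \<noteq> y" "r \<noteq> z" using r(1) unfolding Rst_def by auto
    have vE: "v \<in> E" using v yz by auto
    have sub: "insert r F \<subseteq> nbrs A Q v" using Fv[OF v] r rF unfolding nbrs_def by blast
    have "card (insert r F) = card (nbrs A Q v)" using d(1)[OF vE] cF rF fF by simp
    then have eq: "nbrs A Q v = insert r F" using card_subset_eq[OF finite_nbrs[OF Q(1)] sub] by simp
    \<comment> \<open>For r in E the path f, v, r would make Q - {f, r} disconnected. But Q - {r} is
      connected, and the neighbours of f lie in the connected set \<open>?K\<close>, so f can be
      removed as well. That F has a second vertex g uses d \<ge> 3.\<close>
    have "r \<notin> E"
    proof
      assume rE: "r \<in> E"
      obtain f where f: "f \<in> F" using f0 by blast
      obtain g where g: "g \<in> F" "g \<noteq> f"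
      proof -
        have "card (F - {f}) > 0" using cF d(2) f fF by simp
        then obtain g where "g \<in> F - {f}" by (metis card_gt_0_iff ex_in_conv)
        then show ?thesis using that by blast
      qed
      let ?K = "insert y (insert z F) - {f}"
      have K: "conn A ?K"
      proof (rule conn_star[OF symA, of "{g}"])
        fix x assume x: "x \<in> ?K"
        show "\<exists>D. conn A D \<and> D \<subseteq> ?K \<and> x \<in> D \<and> (D \<inter> {g} \<noteq> {} \<or> touch A D {g})"
        proof (intro exI[of _ "{x}"] conjI)
          show "{x} \<inter> {g} \<noteq> {} \<or> touch A {x} {g}"
          proof (cases "x = g")
            case False
            then have "(g, x) \<in> A" using adj[OF g(1), of x] x by blast
            then show ?thesis using arcD by simp
          qed simp
        qed (use x in auto)
      qed (use g in auto)
      have c1: "conn A (Q - {r})" by (rule noncut_conn[OF EQ(4)[OF rE] yzQ(1)]) (use rF in auto)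
      have c2: "conn A (Q - {r} - {f})"
      proof (rule conn_remove[OF symA c1 K])
        show "?K \<subseteq> Q - {r} - {f}" using rF yzQ F(2) EQ(2) by auto
        show "nbrs A (Q - {r}) f \<subseteq> ?K" using nbF[OF f] nbrs_mono[of "Q - {r}" Q A f] by blast
      qed
      have fr: "(f, r) \<notin> A"
      proof
        assume "(f, r) \<in> A"
        then have "r \<in> nbrs A Q f" using rF unfolding nbrs_def by blast
        then show False using nbF[OF f] rF by auto
      qed
      have "\<not> conn A (Q - {f, r})"
      proof (rule badlist_no_triple[OF bad Q, of f r v])
        show "(v, f) \<in> A" using Fv[OF v] f unfolding nbrs_def by blast
      qed (use r rF fr f F(2) EQ(2,4) rE vE in auto)
      moreover have "Q - {f, r} = Q - {r} - {f}" by blast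
      ultimately show False using c2 by simp
    qed
    then have "r \<in> W" using EQ(5) vE r rF unfolding touch_def by blast
    then show ?thesis using r eq by blast
  qed
  obtain w where w: "w \<in> Rst" "w \<in> W" "nbrs A Q y = insert w F" using nbv[of y] by blast
  have Ww: "W = {w}"
  proof -
    have "finite W" "card W \<le> 1" using E unfolding end_of_def by auto
    then show ?thesis using w(2) card_le_Suc0_iff_eq[of W] by auto
  qed
  have wz: "nbrs A Q z = insert w F" using nbv[of z] Ww by auto
  have wE: "w \<in> Q" "w \<notin> E" using EQ(3) Ww by auto
  have nyz: "(y, z) \<notin> A"
  proof
    assume "(y, z) \<in> A"
    then have "z \<in> nbrs A Q y" using yzQ unfolding nbrs_def by blast
    then show False using w yF yz wE by auto
  qed
  have Eeq: "E = insert y (insert z F)"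
  proof (rule ccontr)
    assume n: "\<not> ?thesis"
    have "touch A (insert y (insert z F)) (E - insert y (insert z F))"
      by (rule connD[OF EQ(1)]) (use n F(2) yz in auto)
    then obtain a b where ab: "a \<in> insert y (insert z F)" "b \<in> E" "b \<notin> insert y (insert z F)" "(a, b) \<in> A"
      unfolding touch_def by blast
    then have "b \<in> nbrs A Q a" using EQ(2) unfolding nbrs_def by blast
    then show False using ab nbF w(3) wz wE by auto
  qed
  have R: "\<And>u. u \<in> Q \<Longrightarrow> R u \<subseteq> L u" "\<And>u. u \<in> Q \<Longrightarrow> card (R u) = deg Q u" and sub: "sublists Q R"
    using bad badlist_card[OF bad Q] unfolding badlist_def sublists_def by auto
  let ?S0 = "Q - E"
  \<comment> \<open>Outside E the vertex w has a spare colour, because its neighbour y is not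
    coloured yet. Afterwards y and z each lose at most the colour forbidden by w.\<close>
  have "colourable ?S0 R"
  proof (rule greedy_conn)
    show "conn A ?S0" using end_conn_Diff[OF Q(2)] E Ww by simp
    show "w \<in> ?S0" using wE by simp
    have "(w, y) \<in> A" using w(3) arcD unfolding nbrs_def by blast
    then show "deg ?S0 w < card (R w)" using card_nbrs_less[OF Q(1), of ?S0 y w A] yz yzQ R(2) wE by auto
    show "deg ?S0 u \<le> card (R u)" if "u \<in> ?S0" for u
      using card_nbrs_mono[OF Q(1), of ?S0 A u] R(2)[of u] that by simp
  qed (use Q sub sublists_subset in auto)
  then obtain \<phi> where \<phi>: "proper ?S0 R \<phi>" unfolding colourable_def by blast
  let ?R = "resid R \<phi> ?S0"
  have cr: "card (R u) \<le> card (?R u) + deg ?S0 u" if "u \<in> E" for u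
    by (rule card_resid) (use Q \<phi> R(1) EQ(2) that in \<open>auto simp: proper_def\<close>)
  have D: "deg Q u = deg ?S0 u + deg E u" for u by (rule card_nbrs_Diff[OF Q(1) EQ(2)])
  have f0E: "f0 \<in> E" using f0 F(2) by blast
  have cv: "d - 1 \<le> card (?R v)" if v: "v \<in> {y, z}" for v
  proof -
    have "nbrs A ?S0 v \<subseteq> {w}" using v w(3) wz F(2) nbrs_mono[of ?S0 Q A v] unfolding nbrs_def by auto
    then have "deg ?S0 v \<le> 1" using card_mono[of "{w}" "nbrs A ?S0 v"] by simp
    moreover have "v \<in> E" using v yz by auto
    ultimately show ?thesis using cr[of v] R(2)[of v] d(1)[of v] EQ(2) by auto
  qed
  have Rf0: "?R f0 = R f0"
  proof -
    have "nbrs A ?S0 f0 \<subseteq> nbrs A Q f0" by (rule nbrs_mono) blast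
    moreover have "nbrs A Q f0 \<subseteq> E" using nbF[OF f0] yz F(2) by auto
    moreover have "nbrs A ?S0 f0 \<subseteq> ?S0" by (rule nbrs_subset)
    ultimately have "nbrs A ?S0 f0 = {}" by blast
    then show ?thesis unfolding resid_def nbrs_def by blast
  qed
  define I where "I v = {\<beta> \<in> R f0. \<exists>\<alpha>\<in>?R v. (\<alpha>, \<beta>) \<in> C}" for v
  have cI: "d - 1 \<le> card (I v)" if v: "v \<in> {y, z}" for v
  proof -
    have vE: "v \<in> E" "v \<in> Q" using v yz yzQ by auto
    have vf: "(v, f0) \<in> A" using Fv[OF v] f0 unfolding nbrs_def by blast
    have "card (?R v) \<le> card (I v)"
    proof (rule card_partner_le[OF vf])
      show "?R v \<subseteq> L v" using resid_subset R(1)[OF vE(2)] by blast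
      show "I v \<subseteq> L f0" using R(1)[of f0] f0E EQ(2) unfolding I_def by blast
      fix \<alpha> assume \<alpha>: "\<alpha> \<in> ?R v"
      have "\<exists>\<beta>\<in>R f0. (\<alpha>, \<beta>) \<in> C"
        by (rule badlist_partner[OF bad Q vE(2) _ vf EQ(4)[OF vE(1)]]) (use \<alpha> f0E EQ(2) in \<open>auto simp: resid_def\<close>)
      then show "\<exists>\<beta>\<in>I v. (\<alpha>, \<beta>) \<in> C" using \<alpha> unfolding I_def by blast
    qed
    then show ?thesis using cv[OF v] by simp
  qed
  have fR: "finite (R f0)" using R(1)[of f0] finL f0E EQ(2) finite_subset by blast
  \<comment> \<open>Two sets of at least d - 1 colours in a list of size d must meet, since 2(d - 1)
    > d for d \<ge> 3. A common element is the colour at \<open>f0\<close> that both y and z can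
    forbid.\<close>
  have "I y \<inter> I z \<noteq> {}"
  proof
    assume dj: "I y \<inter> I z = {}"
    have "card (I y \<union> I z) = card (I y) + card (I z)"
      by (rule card_Un_disjoint[OF _ _ dj]) (use fR in \<open>auto simp: I_def\<close>)
    moreover have "card (I y \<union> I z) \<le> card (R f0)" by (rule card_mono[OF fR]) (auto simp: I_def)
    moreover have "card (R f0) = d" using R(2)[of f0] d(1)[OF f0E] f0E EQ(2) by auto
    ultimately show False using cI[of y] cI[of z] d(2) by auto
  qed
  then obtain \<alpha> \<gamma> \<beta> where col: "\<alpha> \<in> ?R y" "\<gamma> \<in> ?R z" "\<beta> \<in> R f0" "(\<alpha>, \<beta>) \<in> C" "(\<gamma>, \<beta>) \<in> C"
    unfolding I_def by blast
  have EF: "E - {y, z} = F" using Eeq yF by blast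
  have "colourable E ?R"
  proof (rule colourable_two_first[of _ _ y z f0 \<alpha> \<gamma> \<beta>])
    show "finite E" using Q(1) EQ(2) finite_subset by blast
    show "sublists E ?R" by (rule sublists_resid[OF sub EQ(2)])
    show "deg E u \<le> card (?R u)" if "u \<in> E" for u using cr[OF that] D[of u] R(2)[of u] EQ(2) that by auto
    show "(f0, y) \<in> A" "(f0, z) \<in> A" using adj[OF f0, of y] adj[OF f0, of z] f0 yF by auto
    show "conn A (E - {y, z})" using EF F(1) by simp
    show "(\<beta>, \<gamma>) \<in> C" using col(5) by (rule conflictD)
  qed (use yz nyz f0E col Rf0 in auto)
  then have "colourable Q R" by (rule colourable_extend[OF \<phi>]) (use EQ(2) in auto)
  then show False using bad unfolding badlist_def by blast
qed

end

section \<open>Saving an island\<close>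

lemma sum_degree_le:
  assumes H: "finite H" and A: "sym A" "irrefl A" "k33_free A" and two: "2 \<le> card H"
  shows "(\<Sum>x\<in>H. card (nbrs A H x)) + 10 \<le> 6 * card H"
proof -
  let ?A = "A \<inter> H \<times> H"
  have "card ?A = (\<Sum>x\<in>H. card (?A `` {x}))" by (rule card_eq_sum_degree) (use H in auto)
  also have "\<dots> = (\<Sum>x\<in>H. card (nbrs A H x))"
    by (rule sum.cong[OF refl], rule arg_cong[of _ _ card]) (auto simp: nbrs_def)
  finally have "card ?A = (\<Sum>x\<in>H. card (nbrs A H x))" .
  moreover have "card ?A + 10 \<le> 6 * card H"
  proof (rule k33_free_card_arcs[OF H])
    show "sym ?A" using A(1) by (auto simp: sym_def)
    show "irrefl ?A" using A(2) by (auto simp: irrefl_def)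
    show "k33_free ?A" by (rule k33_free_subset[OF A(3)]) blast
  qed (use two in auto)
  ultimately show ?thesis by simp
qed

definition bound :: "('a \<times> 'a) set \<Rightarrow> 'a set \<Rightarrow> 'a set" where
  "bound A S = {x. x \<notin> S \<and> touch A S {x}}"

context cover_graph begin

lemma ex_end:
  assumes Q: "finite Q" "conn A Q"
  shows "\<exists>E W. end_of Q E W"
proof (cases "\<forall>x\<in>Q. noncut Q x")
  case True then show ?thesis using end_of_whole[OF Q(2)] by blast
next
  case False then show ?thesis using two_ends[OF Q] by blast
qed

end

text \<open>\<open>small\<close> and \<open>big\<close> are the two sides of the truncation at 16.
  \<open>three\<close> is 3-connectivity, phrased as a bound on the boundary of a set that does not
  exhaust V together with its boundary.\<close>

locale truncated_cover = cover_graph A L C for A :: "('a \<times> 'a) set" and L :: "'a \<Rightarrow> 'b set" and C +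
  fixes V B :: "'a set"
  assumes finV: "finite V" and AV: "A \<subseteq> V \<times> V" and BV: "B \<subseteq> V"
    and small: "y \<in> V - B \<Longrightarrow> card (nbrs A V y) \<le> card (L y)"
    and big: "b \<in> B \<Longrightarrow> 16 \<le> card (L b)"
    and free: "k33_free A"
    and three: "S \<subseteq> V \<Longrightarrow> S \<noteq> {} \<Longrightarrow> V - S - bound A S \<noteq> {} \<Longrightarrow> 3 \<le> card (bound A S)"
begin

lemma finB: "finite B" using finV BV finite_subset by blast

lemma irrA: "irrefl A" using irreflA by (simp add: irrefl_def)

lemma bound_V: "bound A S \<subseteq> V"
  unfolding bound_def touch_def using AV by blast

definition nbB :: "'a set \<Rightarrow> 'a set" where
  "nbB D = {b \<in> B. touch A D {b}}"

lemma nbB_subset: "nbB D \<subseteq> B" unfolding nbB_def by blast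

lemma finite_nbB: "finite (nbB D)" using finB nbB_subset finite_subset by blast

lemma nbB_mono: "D \<subseteq> D' \<Longrightarrow> nbB D \<subseteq> nbB D'" unfolding nbB_def touch_def by blast

lemma nbB_iff: "b \<in> nbB D \<longleftrightarrow> b \<in> B \<and> (\<exists>y\<in>D. (y, b) \<in> A)" unfolding nbB_def touch_def by blast

definition island :: "'a set \<Rightarrow> bool" where
  "island Q \<longleftrightarrow> conn A Q \<and> Q \<subseteq> V - B \<and> \<not> touch A Q (V - B - Q)"

lemma islandD:
  assumes "island Q" shows "conn A Q" "Q \<subseteq> V" "Q \<inter> B = {}" "finite Q" "\<not> touch A Q (V - B - Q)"
  using assms finV finite_subset[of Q V] unfolding island_def by auto

lemma island_nbr:
  assumes "island Q" "y \<in> Q" "(y, x) \<in> A" "x \<notin> Q" shows "x \<in> B" "x \<in> nbB Q"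
proof -
  show "x \<in> B" using islandD(5)[OF assms(1)] assms AV unfolding touch_def by blast
  then show "x \<in> nbB Q" using assms unfolding nbB_iff by blast
qed

lemma deg_island:
  assumes Q: "island Q" and y: "y \<in> Q"
  shows "deg V y = deg Q y + deg B y"
proof -
  have "nbrs A V y = nbrs A (Q \<union> B) y" using island_nbr(1)[OF Q y] islandD(2)[OF Q] BV unfolding nbrs_def by blast
  then show ?thesis using card_nbrs_Un[OF islandD(4)[OF Q] finB islandD(3)[OF Q]] by simp
qed

text \<open>Colourings of B are total from the start: vertices not yet treated carry an arbitrary
  colour of their list, and conflicts inside B are dealt with separately.\<close>

definition valued :: "('a \<Rightarrow> 'b) \<Rightarrow> bool" where
  "valued \<phi> \<longleftrightarrow> (\<forall>b\<in>B. \<phi> b \<in> L b)"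

lemma card_resid_B:
  assumes Q: "island Q" "y \<in> Q" and \<psi>: "valued \<psi>" and P: "P \<subseteq> B"
  shows "deg Q y + deg B y \<le> card (resid L \<psi> P y) + deg P y"
proof -
  have "card (L y) \<le> card (resid L \<psi> P y) + deg P y"
    by (rule card_resid) (use P \<psi> finite_subset[OF P finB] in \<open>auto simp: valued_def\<close>)
  moreover have "deg V y \<le> card (L y)" using small islandD(2,3)[OF Q(1)] Q(2) by blast
  ultimately show ?thesis using deg_island[OF Q] by simp
qed

lemma card_resid_full: "island Q \<Longrightarrow> y \<in> Q \<Longrightarrow> valued \<psi> \<Longrightarrow> deg Q y \<le> card (resid L \<psi> B y)"
  using card_resid_B[of Q y \<psi> B] by simp

lemma card_resid_minus:
  assumes "island Q" "y \<in> Q" "valued \<psi>" "v \<in> B" "(y, v) \<in> A"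
  shows "deg Q y < card (resid L \<psi> (B - {v}) y)"
proof -
  have "deg (B - {v}) y < deg B y" by (rule card_nbrs_less[OF finB, of _ v]) (use assms in auto)
  then show ?thesis using card_resid_B[OF assms(1-3), of "B - {v}"] by simp
qed

lemma sublists_L: "sublists Q (resid L \<psi> P)"
  unfolding sublists_def resid_def by blast

text \<open>The lists are existentially quantified, so this is a property of the island and not of a
  colouring of B.\<close>

definition bad :: "'a set \<Rightarrow> bool" where
  "bad Q \<longleftrightarrow> (\<exists>R. badlist Q R)"

lemma island_colourable:
  assumes "island Q" "valued \<psi>" "\<not> bad Q"
  shows "colourable Q (resid L \<psi> B)"
  using assms card_resid_full[of Q _ \<psi>] sublists_L[of Q \<psi> B] unfolding bad_def badlist_def by blast

lemma island_badlist:
  assumes "island Q" "valued \<psi>" "\<not> colourable Q (resid L \<psi> B)"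
  shows "badlist Q (resid L \<psi> B)"
  using assms card_resid_full[of Q _ \<psi>] sublists_L[of Q \<psi> B] unfolding badlist_def by blast

definition saved :: "'a set \<Rightarrow> 'a set \<Rightarrow> ('a \<Rightarrow> 'b) \<Rightarrow> bool" where
  "saved Q X \<phi> \<longleftrightarrow> (\<forall>\<psi>. (\<forall>x\<in>X. \<psi> x = \<phi> x) \<and> valued \<psi> \<longrightarrow> colourable Q (resid L \<psi> B))"

text \<open>As being saved depends on the colours on X only, F depends only on the colours of the other
  vertices of X: once these are fixed, v has to avoid k colours.\<close>
definition saver :: "'a set \<Rightarrow> 'a set \<Rightarrow> 'a \<Rightarrow> nat \<Rightarrow> bool" where
  "saver Q X v k \<longleftrightarrow> v \<in> X \<and> X \<subseteq> B \<and>
     (\<forall>\<phi>. valued \<phi> \<longrightarrow> (\<exists>F. finite F \<and> card F \<le> k \<and> (\<forall>\<alpha>\<in>L v - F. saved Q X (\<phi>(v := \<alpha>)))))"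

lemma saver_mono:
  assumes s: "saver Q X v k" and X: "X \<subseteq> X'" "X' \<subseteq> B" and k: "k \<le> k'"
  shows "saver Q X' v k'"
proof -
  have "saved Q X' \<phi>" if "saved Q X \<phi>" for \<phi>
    using that X(1) unfolding saved_def by (meson subsetD)
  then show ?thesis using s X k unfolding saver_def by (meson le_trans subsetD)
qed

text \<open>Splits the list at y into what the other neighbours in B leave and the single
  restriction added by v.\<close>

lemma resid_agree:
  assumes "\<And>x. x \<in> B - {v} \<Longrightarrow> (y, x) \<in> A \<Longrightarrow> \<psi> x = \<phi> x"
  shows "resid L \<psi> B y = {\<beta> \<in> resid L \<phi> (B - {v}) y. v \<in> B \<longrightarrow> (y, v) \<in> A \<longrightarrow> (\<beta>, \<psi> v) \<notin> C}"
proof -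
  have "(\<forall>x\<in>B. (y, x) \<in> A \<longrightarrow> (\<beta>, \<psi> x) \<notin> C) \<longleftrightarrow>
    (\<forall>x\<in>B - {v}. (y, x) \<in> A \<longrightarrow> (\<beta>, \<phi> x) \<notin> C) \<and> (v \<in> B \<longrightarrow> (y, v) \<in> A \<longrightarrow> (\<beta>, \<psi> v) \<notin> C)" (is "?l = ?r") for \<beta>
  proof
    assume l: ?l
    show ?r
    proof (intro conjI ballI impI)
      fix x assume "x \<in> B - {v}" "(y, x) \<in> A"
      then show "(\<beta>, \<phi> x) \<notin> C" using l assms[of x] by auto
    qed (use l in auto)
  next
    assume r: ?r
    show ?l
    proof (intro ballI impI)
      fix x assume "x \<in> B" "(y, x) \<in> A"
      then show "(\<beta>, \<psi> x) \<notin> C" using r assms[of x] by (cases "x = v") auto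
    qed
  qed
  then show ?thesis unfolding resid_def by blast
qed

lemma conflicts_finite:
  assumes "(y, v) \<in> A" "S \<subseteq> L y" "finite S"
  shows "finite {\<alpha> \<in> L v. \<exists>\<gamma>\<in>S. (\<alpha>, \<gamma>) \<in> C}" "card {\<alpha> \<in> L v. \<exists>\<gamma>\<in>S. (\<alpha>, \<gamma>) \<in> C} \<le> card S"
proof -
  have eq: "{\<alpha> \<in> L v. \<exists>\<gamma>\<in>S. (\<alpha>, \<gamma>) \<in> C} = (\<Union>\<gamma>\<in>S. {\<alpha> \<in> L v. (\<alpha>, \<gamma>) \<in> C})" by blast
  show "finite {\<alpha> \<in> L v. \<exists>\<gamma>\<in>S. (\<alpha>, \<gamma>) \<in> C}" using finL by simp
  have "card (\<Union>\<gamma>\<in>S. {\<alpha> \<in> L v. (\<alpha>, \<gamma>) \<in> C}) \<le> (\<Sum>\<gamma>\<in>S. card {\<alpha> \<in> L v. (\<alpha>, \<gamma>) \<in> C})"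
    by (rule card_UN_le[OF assms(3)])
  also have "\<dots> \<le> (\<Sum>\<gamma>\<in>S. 1)"
    by (rule sum_mono, rule card_partners(2)[OF assms(1)]) (use assms(2) in auto)
  finally show "card {\<alpha> \<in> L v. \<exists>\<gamma>\<in>S. (\<alpha>, \<gamma>) \<in> C} \<le> card S" using eq by simp
qed

text \<open>While v is ignored, y has more than \<open>deg Q y\<close> colours. If v avoids the
  partners of \<open>deg Q y + 1\<close> of them, y keeps a spare colour and greedy colouring
  works.\<close>

lemma saver_vertex:
  assumes Q: "island Q" and y: "y \<in> Q" "(y, v) \<in> A" and X: "nbB {y} \<subseteq> X" "X \<subseteq> B" and v: "v \<in> X"
  shows "saver Q X v (deg Q y + 1)"
  unfolding saver_def
proof (intro conjI v X allI impI)
  fix \<phi> assume \<phi>: "valued \<phi>"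
  have vB: "v \<in> B" using v X by blast
  let ?Ro = "resid L \<phi> (B - {v})"
  have "deg Q y + 1 \<le> card (?Ro y)" using card_resid_minus[OF Q y(1) \<phi> vB y(2)] by simp
  then obtain S where S: "S \<subseteq> ?Ro y" "card S = deg Q y + 1" "finite S" by (rule obtain_subset_with_card_n)
  have SL: "S \<subseteq> L y" using S(1) resid_subset by blast
  let ?F = "{\<alpha> \<in> L v. \<exists>\<gamma>\<in>S. (\<alpha>, \<gamma>) \<in> C}"
  have F: "finite ?F" "card ?F \<le> deg Q y + 1" using conflicts_finite[OF y(2) SL S(3)] S(2) by simp_all
  have "saved Q X (\<phi>(v := \<alpha>))" if \<alpha>: "\<alpha> \<in> L v - ?F" for \<alpha>
    unfolding saved_def
  proof (intro allI impI)
    fix \<psi> assume \<psi>: "(\<forall>x\<in>X. \<psi> x = (\<phi>(v := \<alpha>)) x) \<and> valued \<psi>"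
    have "S \<subseteq> resid L \<psi> B y"
    proof
      fix \<gamma> assume \<gamma>: "\<gamma> \<in> S"
      have "resid L \<psi> B y = {\<beta> \<in> ?Ro y. v \<in> B \<longrightarrow> (y, v) \<in> A \<longrightarrow> (\<beta>, \<psi> v) \<notin> C}"
        by (rule resid_agree[where \<phi> = \<phi>]) (use \<psi> X in \<open>auto simp: nbB_iff\<close>)
      moreover have "\<psi> v = \<alpha>" using \<psi> v by simp
      moreover have "(\<gamma>, \<alpha>) \<notin> C" using \<alpha> \<gamma> conflictD by blast
      ultimately show "\<gamma> \<in> resid L \<psi> B y" using \<gamma> S(1) by blast
    qed
    then have "card S \<le> card (resid L \<psi> B y)"
      by (rule card_mono[rotated]) (use resid_subset finL finite_subset in metis)
    then have "deg Q y < card (resid L \<psi> B y)" using S(2) by simp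
    then show "colourable Q (resid L \<psi> B)"
      by (intro greedy_conn[OF islandD(4)[OF Q] sublists_L _ islandD(1)[OF Q] y(1)]) (use card_resid_full[OF Q] \<psi> in auto)
  qed
  then show "\<exists>F. finite F \<and> card F \<le> deg Q y + 1 \<and> (\<forall>\<alpha>\<in>L v - F. saved Q X (\<phi>(v := \<alpha>)))" using F by blast
qed

text \<open>The list of \<open>y'\<close> does not depend on v. If Q stayed uncolourable, partners
  would force the list of y to be P, the set of partners of the list of \<open>y'\<close>, which is
  known before v is coloured. While v is ignored, y has more than \<open>deg Q y\<close> colours.
  Either one of them lies outside P, and v only has to leave it alone; or all lie in P, and then P
  is too large to be the list of y.\<close>

lemma saver_edge:
  assumes Q: "island Q" and y: "y \<in> Q" "(y, v) \<in> A" and y': "y' \<in> Q" "(y', v) \<notin> A" "(y, y') \<in> A"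
    and nc: "noncut Q y" "noncut Q y'" and X: "nbB {y, y'} \<subseteq> X" "X \<subseteq> B" and v: "v \<in> X"
  shows "saver Q X v 1"
  unfolding saver_def
proof (intro conjI v X allI impI)
  fix \<phi> assume \<phi>: "valued \<phi>"
  have vB: "v \<in> B" using v X by blast
  let ?Ro = "resid L \<phi> (B - {v})"
  define P where "P = {\<gamma> \<in> L y. \<exists>\<beta>\<in>?Ro y'. (\<beta>, \<gamma>) \<in> C}"
  have yy: "(y', y) \<in> A" using y'(3) by (rule arcD)
  have finR: "finite (?Ro y)" using resid_subset finL finite_subset by metis
  show "\<exists>F. finite F \<and> card F \<le> 1 \<and> (\<forall>\<alpha>\<in>L v - F. saved Q X (\<phi>(v := \<alpha>)))"
  proof -
    obtain S where S: "finite S" "card S \<le> 1" "S \<subseteq> L y" "S = {} \<Longrightarrow> ?Ro y \<subseteq> P" "S \<subseteq> ?Ro y - P"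
    proof (cases "?Ro y \<subseteq> P")
      case True then show ?thesis using that[of "{}"] by simp
    next
      case False
      then obtain \<gamma> where "\<gamma> \<in> ?Ro y" "\<gamma> \<notin> P" by blast
      then show ?thesis using that[of "{\<gamma>}"] resid_subset[of L \<phi> "B - {v}" y] by auto
    qed
    let ?F = "{\<alpha> \<in> L v. \<exists>\<gamma>\<in>S. (\<alpha>, \<gamma>) \<in> C}"
    have F: "finite ?F" "card ?F \<le> 1" using conflicts_finite[OF y(2) S(3,1)] S(2) by simp_all
    have "saved Q X (\<phi>(v := \<alpha>))" if \<alpha>: "\<alpha> \<in> L v - ?F" for \<alpha>
      unfolding saved_def
    proof (intro allI impI)
      fix \<psi> assume \<psi>: "(\<forall>x\<in>X. \<psi> x = (\<phi>(v := \<alpha>)) x) \<and> valued \<psi>"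
      let ?R = "resid L \<psi> B"
      have eq: "?R u = {\<beta> \<in> ?Ro u. v \<in> B \<longrightarrow> (u, v) \<in> A \<longrightarrow> (\<beta>, \<psi> v) \<notin> C}" if "u \<in> {y, y'}" for u
        by (rule resid_agree[where \<phi> = \<phi>]) (use \<psi> X that in \<open>auto simp: nbB_iff\<close>)
      have Ry': "?R y' = ?Ro y'" using eq[of y'] y'(2) by simp
      have SR: "S \<subseteq> ?R y"
      proof
        fix \<gamma> assume \<gamma>: "\<gamma> \<in> S"
        have "\<psi> v = \<alpha>" using \<psi> v by simp
        moreover have "(\<gamma>, \<alpha>) \<notin> C" using \<alpha> \<gamma> conflictD by blast
        moreover have "\<gamma> \<in> ?Ro y" using \<gamma> S(5) by blast
        ultimately show "\<gamma> \<in> ?R y" using eq[of y] by simp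
      qed
      show "colourable Q ?R"
      proof (rule ccontr)
        assume "\<not> colourable Q ?R"
        then have bl: "badlist Q ?R" using island_badlist[OF Q] \<psi> by blast
        note fQ = islandD(4)[OF Q] islandD(1)[OF Q]
        have cy: "card (?R y) = deg Q y" "card (?R y') = deg Q y'" using badlist_card[OF bl fQ] y y' by blast+
        have dd: "deg Q y = deg Q y'" by (rule badlist_deg_eq[OF bl fQ y(1) y'(1,3) nc])
        have part: "\<exists>\<gamma>\<in>?R y. (\<beta>, \<gamma>) \<in> C" if "\<beta> \<in> ?R y'" for \<beta>
          by (rule badlist_partner[OF bl fQ y'(1) y(1) yy nc(2) that])
        have "P \<subseteq> ?R y"
        proof
          fix \<gamma> assume "\<gamma> \<in> P"
          then obtain \<beta> where \<beta>: "\<gamma> \<in> L y" "\<beta> \<in> ?R y'" "(\<beta>, \<gamma>) \<in> C" unfolding P_def Ry' by blast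
          obtain \<gamma>' where \<gamma>': "\<gamma>' \<in> ?R y" "(\<beta>, \<gamma>') \<in> C" using part[OF \<beta>(2)] by blast
          have "\<gamma> = \<gamma>'" by (rule matching[OF yy, of \<beta>]) (use \<beta> \<gamma>' resid_subset in \<open>auto simp: resid_def\<close>)
          then show "\<gamma> \<in> ?R y" using \<gamma>' by simp
        qed
        moreover have "card (?R y') \<le> card P"
        proof (rule card_partner_le[OF yy])
          show "\<exists>\<gamma>\<in>P. (\<beta>, \<gamma>) \<in> C" if "\<beta> \<in> ?R y'" for \<beta>
            using part[OF that] that resid_subset[of L \<psi> B y] unfolding P_def Ry' by blast
        qed (auto simp: resid_def P_def)
        moreover have finRy: "finite (?R y)" using resid_subset finL finite_subset by metis
        ultimately have PR: "P = ?R y" using cy dd card_seteq[of "?R y" P] by simp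
        then have "S = {}" using SR S(5) by blast
        then have "?Ro y \<subseteq> ?R y" using S(4) PR by simp
        then have "card (?Ro y) \<le> card (?R y)" using finRy by (rule card_mono[rotated])
        then show False using cy card_resid_minus[OF Q y(1) \<phi> vB y(2)] by simp
      qed
    qed
    then show ?thesis using F by blast
  qed
qed

text \<open>Vertices of Q outside K do not see v and can be coloured before it, as each component of
  Q - K has a spare colour towards K. Then the argument of \<open>saver_vertex\<close> runs inside
  K, where only the degree in K counts. The first colouring depends on all neighbours of Q in B,
  hence X is \<open>nbB Q\<close>.\<close>

lemma saver_core:
  assumes Q: "island Q" and v: "v \<in> nbB Q" and K: "conn A K" "nbrs A Q v \<subseteq> K" "K \<subseteq> Q"
    and u: "u \<in> K" "(u, v) \<in> A"
  shows "saver Q (nbB Q) v (deg K u + 1)"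
  unfolding saver_def
proof (intro conjI v nbB_subset allI impI)
  fix \<phi> assume \<phi>: "valued \<phi>"
  note fQ = islandD(4)[OF Q] islandD(1)[OF Q]
  have vB: "v \<in> B" using v nbB_subset by blast
  have fK: "finite K" using K(3) fQ(1) finite_subset by blast
  let ?Ro = "resid L \<phi> (B - {v})" and ?T = "Q - K"
  have D: "deg Q y = deg ?T y + deg K y" for y by (rule card_nbrs_Diff[OF fQ(1) K(3)])
  have c0: "deg Q y \<le> card (?Ro y)" if "y \<in> Q" for y
    using card_resid_B[OF Q that \<phi>, of "B - {v}"] card_nbrs_mono[OF finB, of "B - {v}" A y] by auto
  have "colourable ?T ?Ro"
  proof (rule greedy)
    show "deg ?T y \<le> card (?Ro y)" if "y \<in> ?T" for y using c0[of y] D[of y] that by simp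
    show "\<exists>z\<in>S. deg ?T z < card (?Ro z)" if S: "S \<subseteq> ?T" "S \<noteq> {}" "\<not> touch A S (?T - S)" for S
    proof -
      have "K \<noteq> {}" using K(1) by (rule conn_nonempty)
      then have "touch A S (Q - S)" by (intro connD[OF fQ(2)]) (use S K in auto)
      then obtain z k where z: "z \<in> S" "k \<in> K" "(z, k) \<in> A" using S(3) unfolding touch_def by blast
      have "deg ?T z < deg Q z" by (rule card_nbrs_less[OF fQ(1), of _ k]) (use z K in auto)
      then show ?thesis using c0[of z] z S(1) by (intro bexI[of _ z]) auto
    qed
  qed (use fQ sublists_L in auto)
  then obtain \<theta> where \<theta>: "proper ?T ?Ro \<theta>" unfolding colourable_def by blast
  let ?Rr = "resid ?Ro \<theta> ?T"
  have \<theta>L: "\<And>x. x \<in> ?T \<Longrightarrow> \<theta> x \<in> L x" using \<theta> unfolding proper_def resid_def by blast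
  have uQ: "u \<in> Q" using u K by blast
  have "card (?Ro u) \<le> card (?Rr u) + deg ?T u" by (rule card_resid) (use fQ \<theta>L resid_subset in auto)
  then have "deg K u + 1 \<le> card (?Rr u)" using card_resid_minus[OF Q uQ \<phi> vB u(2)] D[of u] by simp
  then obtain S where S: "S \<subseteq> ?Rr u" "card S = deg K u + 1" "finite S" by (rule obtain_subset_with_card_n)
  have SL: "S \<subseteq> L u" using S(1) unfolding resid_def by blast
  let ?F = "{\<alpha> \<in> L v. \<exists>\<gamma>\<in>S. (\<alpha>, \<gamma>) \<in> C}"
  have F: "finite ?F" "card ?F \<le> deg K u + 1" using conflicts_finite[OF u(2) SL S(3)] S(2) by simp_all
  have "saved Q (nbB Q) (\<phi>(v := \<alpha>))" if \<alpha>: "\<alpha> \<in> L v - ?F" for \<alpha>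
    unfolding saved_def
  proof (intro allI impI)
    fix \<psi> assume \<psi>: "(\<forall>x\<in>nbB Q. \<psi> x = (\<phi>(v := \<alpha>)) x) \<and> valued \<psi>"
    let ?R = "resid L \<psi> B"
    have \<psi>v: "\<psi> v = \<alpha>" using \<psi> v by simp
    have eq: "?R y = {\<beta> \<in> ?Ro y. v \<in> B \<longrightarrow> (y, v) \<in> A \<longrightarrow> (\<beta>, \<psi> v) \<notin> C}" if "y \<in> Q" for y
    proof (rule resid_agree[where \<phi> = \<phi>])
      fix x assume x: "x \<in> B - {v}" "(y, x) \<in> A"
      then have "x \<in> nbB Q" using that unfolding nbB_iff by blast
      then show "\<psi> x = \<phi> x" using \<psi> x by simp
    qed
    have nv: "(y, v) \<notin> A" if "y \<in> ?T" for y using that K(2) arcD unfolding nbrs_def by blast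
    have eqT: "?R y = ?Ro y" if "y \<in> ?T" for y using eq[of y] nv[OF that] that by blast
    have pr: "proper ?T ?R \<theta>" using \<theta> eqT unfolding proper_def by auto
    have "colourable K (resid ?R \<theta> ?T)"
    proof (rule greedy_conn[OF fK _ _ K(1) u(1)])
      show "sublists K (resid ?R \<theta> ?T)" unfolding sublists_def resid_def by blast
      show "deg K y \<le> card (resid ?R \<theta> ?T y)" if y: "y \<in> K" for y
      proof -
        have "card (?R y) \<le> card (resid ?R \<theta> ?T y) + deg ?T y"
          by (rule card_resid) (use fQ \<theta>L resid_subset in auto)
        then show ?thesis using card_resid_full[OF Q, of y \<psi>] y K(3) \<psi> D[of y] by auto
      qed
      have "S \<subseteq> resid ?R \<theta> ?T u"
      proof
        fix \<gamma> assume \<gamma>: "\<gamma> \<in> S"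
        then have "\<gamma> \<in> ?Ro u" "\<forall>x\<in>?T. (u, x) \<in> A \<longrightarrow> (\<gamma>, \<theta> x) \<notin> C" using S(1) unfolding resid_def[of ?Ro] by blast+
        moreover have "(\<gamma>, \<alpha>) \<notin> C" using \<alpha> \<gamma> conflictD by blast
        ultimately have "\<gamma> \<in> ?R u" using eq[OF uQ] \<psi>v by blast
        then show "\<gamma> \<in> resid ?R \<theta> ?T u" using \<open>\<forall>x\<in>?T. _ x\<close> unfolding resid_def[of ?R] by blast
      qed
      moreover have "finite (resid ?R \<theta> ?T u)" by (rule finite_subset[OF _ finL[of u]]) (auto simp: resid_def)
      ultimately have "card S \<le> card (resid ?R \<theta> ?T u)" by (rule card_mono[rotated])
      then show "deg K u < card (resid ?R \<theta> ?T u)" using S(2) by simp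
    qed
    then show "colourable Q ?R" by (rule colourable_extend[OF pr]) (use K in auto)
  qed
  then show "\<exists>F. finite F \<and> card F \<le> deg K u + 1 \<and> (\<forall>\<alpha>\<in>L v - F. saved Q (nbB Q) (\<phi>(v := \<alpha>)))" using F by blast
qed

text \<open>In a minimal connected set containing the neighbours of v, all noncut vertices are neighbours of v;
  if they all had degree at least 5, an end of that set together with v would have too many edges.\<close>
theorem saver_five:
  assumes Q: "island Q" and v: "v \<in> nbB Q"
  shows "saver Q (nbB Q) v 5"
proof -
  note fQ = islandD(4)[OF Q] islandD(1)[OF Q]
  have vQ: "v \<notin> Q" using v islandD(3)[OF Q] nbB_subset by blast
  let ?P = "\<lambda>K. conn A K \<and> nbrs A Q v \<subseteq> K \<and> K \<subseteq> Q"
  have "?P Q" using fQ nbrs_subset[of A Q v] by blast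
  then obtain K where K: "?P K" and least: "\<And>K'. ?P K' \<Longrightarrow> card K \<le> card K'"
    using ex_has_least_nat[of ?P Q card] by blast
  have fK: "finite K" using K fQ(1) finite_subset by blast
  have "\<exists>u\<in>K. (u, v) \<in> A \<and> deg K u \<le> 4"
  proof (rule ccontr)
    assume n: "\<not> ?thesis"
    have ncN: "(x, v) \<in> A" if x: "x \<in> K" "noncut K x" for x
    proof (rule ccontr)
      assume xv: "(x, v) \<notin> A"
      then have xN: "x \<notin> nbrs A Q v" using arcD unfolding nbrs_def by blast
      obtain y where "y \<in> Q" "(y, v) \<in> A" using v unfolding nbB_iff by blast
      then have "y \<in> K" "y \<noteq> x" using K xv arcD unfolding nbrs_def by blast+
      then have "conn A (K - {x})" using noncut_conn[OF x(2)] by blast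
      then have "?P (K - {x})" using K xN by blast
      then have "card K \<le> card (K - {x})" by (rule least)
      then show False using card_Diff1_less[OF fK x(1)] by simp
    qed
    obtain E W where E: "end_of K E W" using ex_end[OF fK] K by blast
    have fE: "finite E" and EK: "E \<subseteq> K" using end_ofD(2)[OF E] fK finite_subset by blast+
    have W: "finite W" "card W \<le> 1" "W \<subseteq> K - E" using E unfolding end_of_def by auto
    have vE: "v \<notin> E \<union> W" using vQ K EK W by blast
    have Ev: "(e, v) \<in> A" and Ed: "5 \<le> deg K e" if "e \<in> E" for e
    proof -
      show "(e, v) \<in> A" using ncN end_ofD(4)[OF E that] EK that by blast
      then show "5 \<le> deg K e" using n EK that by fastforce
    qed
    let ?H = "insert v (E \<union> W)"
    have fH: "finite ?H" using fE W by simp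
    have dK: "nbrs A K e \<subseteq> (E \<union> W) - {e}" if "e \<in> E" for e
      using end_ofD(5)[OF E] that irreflA unfolding nbrs_def touch_def by blast
    have cH: "card ?H = card E + card W + 1"
      using vE fE W card_Un_disjoint[of E W] by auto
    obtain e0 where e0: "e0 \<in> E" using end_ofD(1)[OF E] conn_nonempty by blast
    have "deg K e0 \<le> card ((E \<union> W) - {e0})" by (rule card_mono[OF _ dK[OF e0]]) (use fE W in auto)
    also have "\<dots> = card (E \<union> W) - 1" using e0 fE W by (intro card_Diff_singleton) auto
    also have "card (E \<union> W) = card E + card W" using fE W by (intro card_Un_disjoint) auto
    finally have m: "5 \<le> card E" using Ed[OF e0] W(2) by linarith
    have dH: "6 \<le> deg ?H e" if e: "e \<in> E" for e
    proof -
      have "insert v (nbrs A K e) \<subseteq> nbrs A ?H e" using dK[OF e] Ev[OF e] unfolding nbrs_def by blast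
      then have "card (insert v (nbrs A K e)) \<le> deg ?H e" by (rule card_mono[OF finite_nbrs[OF fH]])
      moreover have "v \<notin> nbrs A K e" using vQ K unfolding nbrs_def by blast
      ultimately show ?thesis using Ed[OF e] finite_nbrs[OF fK] by simp
    qed
    have dv: "card E \<le> deg ?H v"
      by (rule card_mono[OF finite_nbrs[OF fH]]) (use Ev arcD in \<open>auto simp: nbrs_def\<close>)
    \<comment> \<open>The degree sum in \<open>?H\<close> is at least 7 card E, with v contributing
      card E, whereas the edge bound allows at most 6 (card E + 2) - 10.\<close>
    have "6 * card E = (\<Sum>e\<in>E. 6)" by simp
    also have "\<dots> \<le> (\<Sum>e\<in>E. deg ?H e)" by (rule sum_mono) (rule dH)
    finally have "7 * card E \<le> deg ?H v + (\<Sum>e\<in>E. deg ?H e)" using dv by simp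
    also have "\<dots> = (\<Sum>e\<in>insert v E. deg ?H e)" using vE fE by simp
    also have "\<dots> \<le> (\<Sum>e\<in>?H. deg ?H e)" by (rule sum_mono2) (use fH in auto)
    finally have "7 * card E + 10 \<le> 6 * card ?H"
      using sum_degree_le[OF fH symA irrA free] cH m by linarith
    then show False using cH W(2) m by linarith
  qed
  then obtain u where u: "u \<in> K" "(u, v) \<in> A" "deg K u \<le> 4" by blast
  have "saver Q (nbB Q) v (deg K u + 1)" by (rule saver_core[OF Q v _ _ _ u(1,2)]) (use K in auto)
  then show ?thesis by (rule saver_mono) (use u nbB_subset in auto)
qed

text \<open>Here d is the common degree in Q of the vertices of E. The value 1 comes from an edge of
  E with exactly one end adjacent to v, the value d + 1 from a single vertex.\<close>

definition cost :: "'a set \<Rightarrow> nat \<Rightarrow> 'a \<Rightarrow> nat" where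
  "cost E d v = (if \<forall>y\<in>E. (y, v) \<in> A then d + 1 else 1)"

lemma saver_cost:
  assumes Q: "island Q" and E: "conn A E" "E \<subseteq> Q" "\<And>x. x \<in> E \<Longrightarrow> noncut Q x" "\<And>x. x \<in> E \<Longrightarrow> deg Q x = d"
    and v: "v \<in> nbB E"
  shows "saver Q (nbB E) v (cost E d v)"
proof (cases "\<forall>y\<in>E. (y, v) \<in> A")
  case True
  obtain y where y: "y \<in> E" using E(1) conn_nonempty by blast
  have "saver Q (nbB E) v (deg Q y + 1)"
    by (rule saver_vertex[OF Q]) (use y E(2) True v nbB_subset nbB_mono[of "{y}" E] in auto)
  then show ?thesis using True E(4)[OF y] unfolding cost_def by simp
next
  case False
  let ?S = "{y \<in> E. (y, v) \<in> A}"
  have "touch A ?S (E - ?S)" by (rule connD[OF E(1)]) (use False v in \<open>auto simp: nbB_iff\<close>)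
  then obtain y y' where y: "y \<in> E" "(y, v) \<in> A" "y' \<in> E" "(y', v) \<notin> A" "(y, y') \<in> A" unfolding touch_def by blast
  have "saver Q (nbB E) v 1"
    by (rule saver_edge[OF Q, of y _ y']) (use y E(2,3) v nbB_subset nbB_mono[of "{y, y'}" E] in auto)
  then show ?thesis using False unfolding cost_def by auto
qed

end

section \<open>Paying for an island\<close>

context truncated_cover begin

text \<open>A pair (P, N) provides unit_weight N units, which an adversary distributes over N according to m;
  a unit at v pays for five lost colours.\<close>
definition settled_by :: "'a set \<Rightarrow> ('a set \<times> 'a set) set \<Rightarrow> bool" where
  "settled_by Q \<P> \<longleftrightarrow> finite \<P> \<and>
     (\<forall>P N. (P, N) \<in> \<P> \<longrightarrow> conn A P \<and> P \<subseteq> Q \<and> N \<subseteq> B \<and> 2 \<le> card N \<and> (\<forall>n\<in>N. touch A P {n}) \<and>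
        (card N = 2 \<longrightarrow> (\<exists>a b. N = {a, b} \<and> a \<noteq> b \<and> separates A P a b))) \<and>
     (\<forall>p\<in>\<P>. \<forall>q\<in>\<P>. p \<noteq> q \<longrightarrow> fst p \<inter> fst q = {}) \<and>
     (\<forall>m. (\<forall>p\<in>\<P>. sum (m p) (snd p) = unit_weight (snd p)) \<longrightarrow>
        (\<exists>X c. X \<noteq> {} \<and> X \<subseteq> B \<and> (\<forall>v\<in>X. saver Q X v (c v)) \<and> sum c X \<le> 5 * (\<Sum>v\<in>X. \<Sum>p\<in>\<P>. m p v)))"

definition settled :: "'a set \<Rightarrow> bool" where
  "settled Q \<longleftrightarrow> (\<exists>\<P>. settled_by Q \<P>)"

lemma settled_choice:
  assumes P: "conn A P" "P \<subseteq> Q" and N: "N \<subseteq> nbB P" "3 \<le> card N"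
    and X: "\<And>m :: 'a \<Rightarrow> nat. sum m N = card N - 2 \<Longrightarrow>
      \<exists>X c. X \<noteq> {} \<and> X \<subseteq> B \<and> (\<forall>v\<in>X. saver Q X v (c v)) \<and> sum c X \<le> 5 * sum m X"
  shows "settled Q"
  unfolding settled_def settled_by_def
proof (intro exI[of _ "{(P, N)}"] conjI allI impI ballI)
  fix m :: "'a set \<times> 'a set \<Rightarrow> 'a \<Rightarrow> nat"
  assume "\<forall>p\<in>{(P, N)}. sum (m p) (snd p) = unit_weight (snd p)"
  then have "sum (m (P, N)) N = card N - 2" using N(2) unfolding unit_weight_def by simp
  from X[OF this] show "\<exists>X c. X \<noteq> {} \<and> X \<subseteq> B \<and> (\<forall>v\<in>X. saver Q X v (c v)) \<and>
    sum c X \<le> 5 * (\<Sum>v\<in>X. \<Sum>p\<in>{(P, N)}. m p v)" by simp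
qed (use P N nbB_subset in \<open>auto simp: nbB_def\<close>)

lemma settled_single:
  assumes P: "conn A P" "P \<subseteq> Q" and N: "N \<subseteq> nbB P" "3 \<le> card N"
    and c: "\<And>v. v \<in> N \<Longrightarrow> saver Q N v (c v)" "sum c N \<le> 5 * (card N - 2)"
  shows "settled Q"
proof (rule settled_choice[OF P N])
  fix m :: "'a \<Rightarrow> nat" assume "sum m N = card N - 2"
  moreover have "N \<noteq> {}" "N \<subseteq> B" using N nbB_subset by auto
  ultimately show "\<exists>X c. X \<noteq> {} \<and> X \<subseteq> B \<and> (\<forall>v\<in>X. saver Q X v (c v)) \<and> sum c X \<le> 5 * sum m X"
    using c by (intro exI[of _ N] exI[of _ c]) auto
qed

text \<open>Two disjoint pieces that see the same N earn twice the units, hence the factor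
  10.\<close>

lemma settled_double:
  assumes P: "conn A P1" "P1 \<subseteq> Q" "conn A P2" "P2 \<subseteq> Q" "P1 \<inter> P2 = {}"
    and N: "N \<subseteq> nbB P1" "N \<subseteq> nbB P2" "3 \<le> card N"
    and c: "\<And>v. v \<in> N \<Longrightarrow> saver Q N v (c v)" "sum c N \<le> 10 * (card N - 2)"
  shows "settled Q"
  unfolding settled_def settled_by_def
proof (intro exI[of _ "{(P1, N), (P2, N)}"] conjI allI impI)
  have ne: "P1 \<noteq> P2" using P conn_nonempty by blast
  fix m :: "'a set \<times> 'a set \<Rightarrow> 'a \<Rightarrow> nat"
  assume "\<forall>p\<in>{(P1, N), (P2, N)}. sum (m p) (snd p) = unit_weight (snd p)"
  then have "sum (m (P1, N)) N = card N - 2" "sum (m (P2, N)) N = card N - 2"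
    using N(3) unfolding unit_weight_def by auto
  then have "(\<Sum>v\<in>N. \<Sum>p\<in>{(P1, N), (P2, N)}. m p v) = 2 * (card N - 2)" using ne by (simp add: sum.distrib)
  moreover have "N \<noteq> {}" "N \<subseteq> B" using N nbB_subset by auto
  ultimately show "\<exists>X c. X \<noteq> {} \<and> X \<subseteq> B \<and> (\<forall>v\<in>X. saver Q X v (c v)) \<and>
    sum c X \<le> 5 * (\<Sum>v\<in>X. \<Sum>p\<in>{(P1, N), (P2, N)}. m p v)"
    using c by (intro exI[of _ N] exI[of _ c]) auto
qed (use P N nbB_subset in \<open>auto simp: nbB_def\<close>)

text \<open>For two neighbours the only unit is the extra one, which is granted under
  separation.\<close>

lemma settled_pair:
  assumes Q: "conn A Q" and ab: "a \<noteq> b" "{a, b} \<subseteq> nbB Q" "separates A Q a b"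
    and c: "\<And>v. v \<in> {a, b} \<Longrightarrow> saver Q {a, b} v (c v)" "sum c {a, b} \<le> 5"
  shows "settled Q"
  unfolding settled_def settled_by_def
proof (intro exI[of _ "{(Q, {a, b})}"] conjI allI impI ballI)
  fix m :: "'a set \<times> 'a set \<Rightarrow> 'a \<Rightarrow> nat"
  assume "\<forall>p\<in>{(Q, {a, b})}. sum (m p) (snd p) = unit_weight (snd p)"
  then have "sum (m (Q, {a, b})) {a, b} = 1" using ab(1) unfolding unit_weight_def by simp
  then show "\<exists>X c. X \<noteq> {} \<and> X \<subseteq> B \<and> (\<forall>v\<in>X. saver Q X v (c v)) \<and>
    sum c X \<le> 5 * (\<Sum>v\<in>X. \<Sum>p\<in>{(Q, {a, b})}. m p v)"
    using c ab nbB_subset by (intro exI[of _ "{a, b}"] exI[of _ c]) auto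
qed (use Q ab nbB_subset in \<open>auto simp: nbB_def\<close>)

section \<open>Restrictions from K33-freeness and 3-connectivity\<close>

lemma k33_hub:
  assumes q: "(q1, x1) \<in> A" "(q1, x2) \<in> A" "(q1, x3) \<in> A" "(q2, x1) \<in> A" "(q2, x2) \<in> A" "(q2, x3) \<in> A"
    and ne: "q1 \<noteq> q2" "x1 \<noteq> x2" "x1 \<noteq> x3" "x2 \<noteq> x3"
    and Y: "conn A Y" "touch A Y {x1}" "touch A Y {x2}" "touch A Y {x3}" "Y \<inter> {q1, q2, x1, x2, x3} = {}"
  shows False
proof -
  have ne': "q1 \<noteq> x1" "q1 \<noteq> x2" "q1 \<noteq> x3" "q2 \<noteq> x1" "q2 \<noteq> x2" "q2 \<noteq> x3" using q irreflA by blast+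
  show False
    by (rule k33_freeD[OF free, of "{q1}" "{q2}" Y "{x1}" "{x2}" "{x3}"]) (use q ne ne' Y in auto)
qed

lemma k33_points:
  assumes "(q1, x1) \<in> A" "(q1, x2) \<in> A" "(q1, x3) \<in> A" "(q2, x1) \<in> A" "(q2, x2) \<in> A" "(q2, x3) \<in> A"
    "(q3, x1) \<in> A" "(q3, x2) \<in> A" "(q3, x3) \<in> A"
    "q1 \<noteq> q2" "q1 \<noteq> q3" "q2 \<noteq> q3" "x1 \<noteq> x2" "x1 \<noteq> x3" "x2 \<noteq> x3"
  shows False
proof -
  have "q3 \<noteq> x1" "q3 \<noteq> x2" "q3 \<noteq> x3" using assms irreflA by blast+
  then show False using k33_hub[of q1 x1 x2 x3 q2 "{q3}"] assms by simp
qed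

lemma component_V:
  assumes "x \<in> V - S"
  shows "conn A (component A (V - S) x)" "component A (V - S) x \<subseteq> V - S" "x \<in> component A (V - S) x"
    "bound A (component A (V - S) x) \<subseteq> S"
proof -
  let ?K = "component A (V - S) x"
  show "conn A ?K" "?K \<subseteq> V - S" "x \<in> ?K"
    using component_conn[OF assms, of A] component_subset[of A "V - S" x] component_self[OF assms, of A] by auto
  have "\<not> touch A ?K (V - S - ?K)" by (rule component_closed[OF symA assms])
  then show "bound A ?K \<subseteq> S" unfolding bound_def touch_def using AV by blast
qed

lemma bound_touch: "x \<in> bound A S \<Longrightarrow> touch A S {x}"
  unfolding bound_def by blast

text \<open>A component outside five clique vertices has at least three neighbours among them by
  3-connectivity. These face the other two and the component in a K33 model.\<close>

lemma no_clique5: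
  assumes K: "K \<subseteq> V" "5 \<le> card K" "\<And>x y. x \<in> K \<Longrightarrow> y \<in> K \<Longrightarrow> x \<noteq> y \<Longrightarrow> (x, y) \<in> A" and K': "K \<noteq> V"
  shows False
proof -
  obtain z where z: "z \<in> V" "z \<notin> K" using K(1) K' by blast
  obtain T where T: "T \<subseteq> K" "card T = 5" by (rule obtain_subset_with_card_n[OF K(2)])
  have fT: "finite T" using T(2) card.infinite by fastforce
  let ?O = "component A (V - T) z"
  have oT: "z \<in> V - T" using z T by blast
  note O = component_V[OF oT]
  have "3 \<le> card (bound A ?O)"
  proof (cases "bound A ?O = T")
    case False
    then have "V - ?O - bound A ?O \<noteq> {}" using O(2,4) T(1) K(1) by blast
    then show ?thesis using three[of ?O] O by blast
  qed (use T in simp)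
  then obtain R where R: "R \<subseteq> bound A ?O" "card R = 3" by (meson obtain_subset_with_card_n)
  then obtain x1 x2 x3 where x: "R = {x1, x2, x3}" "x1 \<noteq> x2" "x1 \<noteq> x3" "x2 \<noteq> x3" unfolding card_3_iff by blast
  have RT: "R \<subseteq> T" using R(1) O(4) by blast
  have "card (T - R) = 2" using card_Diff_subset[of R T] RT R T fT finite_subset by fastforce
  then obtain q1 q2 where q: "T - R = {q1, q2}" "q1 \<noteq> q2" unfolding card_2_iff by blast
  have mem: "x1 \<in> K" "x2 \<in> K" "x3 \<in> K" "q1 \<in> K" "q2 \<in> K" using x q RT T(1) by blast+
  have neq: "q1 \<noteq> x1" "q1 \<noteq> x2" "q1 \<noteq> x3" "q2 \<noteq> x1" "q2 \<noteq> x2" "q2 \<noteq> x3" using x q by blast+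
  show False
  proof (rule k33_hub[of q1 x1 x2 x3 q2 ?O])
    show "touch A ?O {x1}" "touch A ?O {x2}" "touch A ?O {x3}" using R(1) x(1) bound_touch by blast+
    show "?O \<inter> {q1, q2, x1, x2, x3} = {}" using O(2) x(1) q(1) RT by blast
  qed (use mem neq K(3) q x O(1) in auto)
qed

lemma end_degree:
  assumes Q: "island Q" "bad Q" and E: "end_of Q E W"
  obtains d where "\<And>x. x \<in> E \<Longrightarrow> deg Q x = d"
proof -
  note EQ = end_ofD[OF E]
  obtain R where R: "badlist Q R" using Q(2) unfolding bad_def by blast
  obtain e where e: "e \<in> E" using EQ(1) conn_nonempty by blast
  let ?T = "{x \<in> E. deg Q x = deg Q e}"
  have "?T = E"
  proof (rule ccontr)
    assume n: "?T \<noteq> E"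
    have "touch A ?T (E - ?T)" by (rule connD[OF EQ(1)]) (use n e in auto)
    then obtain x y where xy: "x \<in> ?T" "y \<in> E - ?T" "(x, y) \<in> A" unfolding touch_def by blast
    have "deg Q x = deg Q y"
      by (rule badlist_deg_eq[OF R islandD(4,1)[OF Q(1)] _ _ xy(3)]) (use xy EQ in auto)
    then show False using xy by simp
  qed
  then show ?thesis using that[of "deg Q e"] by blast
qed

lemma sum_cost: "finite W \<Longrightarrow> sum (cost E d) W = card W + d * card {v \<in> W. \<forall>y\<in>E. (y, v) \<in> A}"
proof -
  assume W: "finite W"
  let ?U = "{v \<in> W. \<forall>y\<in>E. (y, v) \<in> A}"
  have "sum (cost E d) W = (\<Sum>v\<in>W. 1 + (if v \<in> ?U then d else 0))"
    by (rule sum.cong[OF refl]) (simp add: cost_def)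
  also have "\<dots> = (\<Sum>v\<in>W. 1) + (\<Sum>v\<in>W. if v \<in> ?U then d else 0)" by (rule sum.distrib)
  also have "(\<Sum>v\<in>W. if v \<in> ?U then d else 0) = (\<Sum>v\<in>W \<inter> ?U. d)"
    by (rule sum.inter_restrict[OF W, symmetric])
  also have "W \<inter> ?U = ?U" by blast
  finally show ?thesis by (simp add: mult.commute)
qed

lemma settled_end:
  assumes Q: "island Q" and E: "end_of Q E W" "\<And>x. x \<in> E \<Longrightarrow> deg Q x = d"
    and 3: "3 \<le> card (nbB E)" and c: "sum (cost E d) (nbB E) \<le> 5 * (card (nbB E) - 2)"
  shows "settled Q"
proof (rule settled_single[OF end_ofD(1,2)[OF E(1)] order_refl 3 _ c])
  show "saver Q (nbB E) v (cost E d v)" if "v \<in> nbB E" for v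
    by (rule saver_cost[OF Q end_ofD(1,2,4)[OF E(1)] E(2) that])
qed

lemma bound_end:
  assumes Q: "island Q" and E: "end_of Q E {w}"
  shows "bound A E \<subseteq> insert w (nbB E)"
proof
  fix x assume "x \<in> bound A E"
  then obtain y where y: "y \<in> E" "(y, x) \<in> A" "x \<notin> E" unfolding bound_def touch_def by blast
  note EQ = end_ofD[OF E]
  show "x \<in> insert w (nbB E)"
  proof (cases "x \<in> Q")
    case True then show ?thesis using EQ(5) y unfolding touch_def by blast
  next
    case False
    then have "x \<in> B" using island_nbr(1)[OF Q _ y(2)] y EQ(2) by blast
    then have "x \<in> nbB E" using y unfolding nbB_iff by blast
    then show ?thesis by simp
  qed
qed

text \<open>The boundary of E consists of vertices of B and possibly w, and z lies beyond it; of at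
  least three boundary vertices at most one is w.\<close>

lemma card_nbB_end:
  assumes Q: "island Q" and E: "end_of Q E {w}" and z: "z \<in> Q" "z \<notin> E" "z \<noteq> w"
  shows "2 \<le> card (nbB E)"
proof -
  have oB: "z \<notin> nbB E" using z(1) islandD(3)[OF Q] nbB_subset by blast
  have "3 \<le> card (bound A E)"
  proof (rule three)
    show "E \<subseteq> V" using end_ofD(2)[OF E] islandD(2)[OF Q] by blast
    show "E \<noteq> {}" using end_ofD(1)[OF E] by (rule conn_nonempty)
    show "V - E - bound A E \<noteq> {}" using bound_end[OF Q E] z oB islandD(2)[OF Q] by blast
  qed
  also have "\<dots> \<le> card (insert w (nbB E))" by (rule card_mono[OF _ bound_end[OF Q E]]) (use finite_nbB in auto)
  also have "\<dots> \<le> Suc (card (nbB E))" by (rule card_insert_le_m1) auto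
  finally show ?thesis by simp
qed

end

context truncated_cover begin

section \<open>Classification of the ends of a bad island\<close>

definition uni :: "'a set \<Rightarrow> 'a set" where
  "uni E = {v \<in> nbB E. \<forall>y\<in>E. (y, v) \<in> A}"

lemma uni_subset: "uni E \<subseteq> nbB E" unfolding uni_def by blast

lemma uniD: "v \<in> uni E \<Longrightarrow> y \<in> E \<Longrightarrow> (y, v) \<in> A" unfolding uni_def by blast

lemma finite_uni: "finite (uni E)" using finite_nbB uni_subset finite_subset by blast

lemma card_uni: "card (uni E) \<le> card (nbB E)" by (rule card_mono[OF finite_nbB uni_subset])

lemma sum_cost_nbB: "sum (cost E d) (nbB E) = card (nbB E) + d * card (uni E)"
  using sum_cost[OF finite_nbB] unfolding uni_def .

lemma cost_le: "cost E d v \<le> d + 1" unfolding cost_def by simp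

lemma nbB_notin: "island Q \<Longrightarrow> v \<in> nbB D \<Longrightarrow> v \<notin> Q"
  using islandD(3) nbB_subset by blast

lemma card_uni_le2:
  assumes "finite E" "3 \<le> card E" shows "card (uni E) \<le> 2"
proof (rule ccontr)
  assume n: "\<not> ?thesis"
  obtain q1 q2 q3 where q: "q1 \<in> E" "q2 \<in> E" "q3 \<in> E" "q1 \<noteq> q2" "q1 \<noteq> q3" "q2 \<noteq> q3"
    by (rule three_elements[OF assms(2)])
  obtain u1 u2 u3 where u: "u1 \<in> uni E" "u2 \<in> uni E" "u3 \<in> uni E" "u1 \<noteq> u2" "u1 \<noteq> u3" "u2 \<noteq> u3"
    by (rule three_elements[of "uni E"]) (use n in auto)
  show False by (rule k33_points[of q1 u1 u2 u3 q2 q3]) (use q u uniD in auto)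
qed

text \<open>For d \<ge> 3 the end is a clique. A vertex adjacent to w shows d = card E, and then
  equal degrees force all of E to be adjacent to w. So E and w form a clique of d + 1 vertices,
  which \<open>no_clique5\<close> limits to four.\<close>

lemma end_shape:
  assumes Q: "island Q" "bad Q" and E: "end_of Q E {w}" and d: "\<And>x. x \<in> E \<Longrightarrow> deg Q x = d"
    and z: "z \<in> Q" "z \<notin> E" "z \<noteq> w"
  shows "(d = 1 \<and> (\<exists>y. E = {y})) \<or> (d = 2 \<and> 2 \<le> card E) \<or>
    (d = 3 \<and> card E = 3 \<and> (\<forall>x\<in>E. (x, w) \<in> A) \<and> (\<forall>x\<in>E. \<forall>y\<in>E. x \<noteq> y \<longrightarrow> (x, y) \<in> A))"
proof -
  note EQ = end_ofD[OF E]
  note fQ = islandD(4,1)[OF Q(1)]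
  have fE: "finite E" using EQ(2) fQ(1) finite_subset by blast
  have w: "w \<in> Q" "w \<notin> E" using EQ(3) by blast+
  obtain x0 where x0: "x0 \<in> E" "(x0, w) \<in> A" by (rule end_touch[OF fQ(2) E])
  have nb: "nbrs A Q x \<subseteq> insert w (E - {x})" if "x \<in> E" for x
    using EQ(5) that irreflA unfolding nbrs_def touch_def by blast
  have wn: "w \<in> nbrs A Q x0" using w x0 unfolding nbrs_def by blast
  have d0: "d \<ge> 1"
  proof -
    have "0 < deg Q x0" using wn finite_nbrs[OF fQ(1)] card_gt_0_iff by blast
    then show ?thesis using d[OF x0(1)] by simp
  qed
  consider "d = 1" | "d = 2" | "3 \<le> d" using d0 by linarith
  then show ?thesis
  proof cases
    case 1
    have "E = {x0}"
    proof (rule ccontr)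
      assume "E \<noteq> {x0}"
      then have "touch A {x0} (E - {x0})" using connD[OF EQ(1), of "{x0}"] x0 by blast
      then obtain y where y: "y \<in> E" "(x0, y) \<in> A" unfolding touch_def by blast
      have "card {w, y} \<le> deg Q x0"
        by (rule card_mono[OF finite_nbrs[OF fQ(1)]]) (use y wn EQ(2) in \<open>auto simp: nbrs_def\<close>)
      moreover have "w \<noteq> y" using y w by blast
      ultimately show False using d[OF x0(1)] 1 by simp
    qed
    then show ?thesis using 1 by blast
  next
    case 2
    have "E \<noteq> {x0}"
    proof
      assume "E = {x0}"
      then have "nbrs A Q x0 \<subseteq> {w}" using nb[OF x0(1)] by blast
      then have "deg Q x0 \<le> card {w}" by (rule card_mono[rotated]) simp
      then show False using d[OF x0(1)] 2 by simp
    qed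
    then obtain y where "y \<in> E" "y \<noteq> x0" using x0 by blast
    then have "card {x0, y} \<le> card E" by (intro card_mono[OF fE]) (use x0 in auto)
    then show ?thesis using 2 \<open>y \<noteq> x0\<close> by simp
  next
    case 3
    obtain R where R: "badlist Q R" using Q(2) unfolding bad_def by blast
    have cl: "(x, y) \<in> A" if "x \<in> E" "y \<in> E" "x \<noteq> y" for x y
      by (rule end_clique[OF R fQ E d 3 that])
    have "nbrs A Q x0 = insert w (E - {x0})" using nb[OF x0(1)] wn cl[OF x0(1)] EQ(2) unfolding nbrs_def by blast
    then have "deg Q x0 = card E" using w x0(1) fE card_Suc_Diff1[OF fE x0(1)] by simp
    then have dE: "d = card E" using d[OF x0(1)] by simp
    have aw: "(x, w) \<in> A" if x: "x \<in> E" for x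
    proof (rule ccontr)
      assume "(x, w) \<notin> A"
      then have "nbrs A Q x \<subseteq> E - {x}" using nb[OF x] unfolding nbrs_def by blast
      then have "deg Q x \<le> card (E - {x})" by (rule card_mono[rotated]) (use fE in simp)
      then show False using d[OF x] dE card_Diff1_less[OF fE x] by simp
    qed
    have "d \<le> 3"
    proof (rule ccontr)
      assume d4: "\<not> d \<le> 3"
      show False
      proof (rule no_clique5[of "insert w E"])
        show "insert w E \<subseteq> V" using w EQ(2) islandD(2)[OF Q(1)] by blast
        show "5 \<le> card (insert w E)" using d4 dE w fE by simp
        show "(x, y) \<in> A" if "x \<in> insert w E" "y \<in> insert w E" "x \<noteq> y" for x y
          using that aw cl arcD by blast
        show "insert w E \<noteq> V" using z islandD(2)[OF Q(1)] by blast
      qed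
    qed
    then show ?thesis using 3 dE aw cl by auto
  qed
qed

text \<open>The truncated sum and the sums with one cost added are needed when two ends have boundary
  vertices in common, where the cheaper of two savers is taken.\<close>
definition pair_end :: "'a set \<Rightarrow> nat \<Rightarrow> bool" where
  "pair_end E d \<longleftrightarrow> card (nbB E) = 2 \<and> sum (cost E d) (nbB E) \<le> 5 \<and> (\<Sum>v\<in>nbB E. min 3 (cost E d v)) \<le> 4"

definition triple_end :: "'a set \<Rightarrow> nat \<Rightarrow> bool" where
  "triple_end E d \<longleftrightarrow> card (nbB E) = 3 \<and> sum (cost E d) (nbB E) \<le> 7 \<and> (\<forall>v. sum (cost E d) (nbB E) + cost E d v \<le> 10) \<and>
     ((d = 1 \<and> (\<exists>y. E = {y})) \<or> (d = 2 \<and> 2 \<le> card E \<and> card (uni E) = 2) \<or> (d = 3 \<and> card E = 3 \<and> card (uni E) = 1))"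

lemma twins_settled:
  assumes Q: "island Q" and E: "end_of Q E W" "\<And>x. x \<in> E \<Longrightarrow> deg Q x = d" and y: "y1 \<in> E" "y2 \<in> E" "y1 \<noteq> y2"
    and N: "nbB E \<subseteq> nbB {y1}" "nbB E \<subseteq> nbB {y2}" "3 \<le> card (nbB E)"
    and c: "sum (cost E d) (nbB E) \<le> 10 * (card (nbB E) - 2)"
  shows "settled Q"
proof (rule settled_double[of "{y1}" Q "{y2}" "nbB E" "cost E d"])
  show "saver Q (nbB E) v (cost E d v)" if "v \<in> nbB E" for v
    by (rule saver_cost[OF Q end_ofD(1,2,4)[OF E(1)] E(2) that])
qed (use y N c end_ofD(2)[OF E(1)] in auto)

text \<open>With n neighbours in B, u of which are adjacent to all of E, the total cost n + d u
  competes with 5 (n - 2). The comparison fails for small n only; cases that neither twins nor a K33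
  model settle are recorded as pair ends and triple ends.\<close>

theorem end_cases:
  assumes Q: "island Q" "bad Q" and E: "end_of Q E {w}" and d: "\<And>x. x \<in> E \<Longrightarrow> deg Q x = d"
    and z: "z \<in> Q" "z \<notin> E" "z \<noteq> w"
  shows "settled Q \<or> pair_end E d \<or> triple_end E d"
proof -
  note EQ = end_ofD[OF E]
  note fQ = islandD(4,1)[OF Q(1)]
  have fE: "finite E" using EQ(2) fQ(1) finite_subset by blast
  have w: "w \<in> Q" "w \<notin> E" using EQ(3) by blast+
  let ?W = "nbB E" and ?U = "uni E"
  define nW nU where "nW = card ?W" and "nU = card ?U"
  have s: "sum (cost E d) ?W = nW + d * nU" unfolding nW_def nU_def by (rule sum_cost_nbB)
  have UW: "nU \<le> nW" unfolding nW_def nU_def by (rule card_uni)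
  have W2: "2 \<le> nW" unfolding nW_def by (rule card_nbB_end[OF Q(1) E z])
  have good: "settled Q" if "3 \<le> nW" "nW + d * nU \<le> 5 * (nW - 2)"
    by (rule settled_end[OF Q(1) E d]) (use that s in \<open>auto simp: nW_def\<close>)
  have cl: "cost E d v \<le> d + 1" for v by (rule cost_le)
  have min2: "(\<Sum>v\<in>?W. min 3 (cost E d v)) \<le> nW + 2 * nU" if "1 \<le> d"
  proof -
    have "(\<Sum>v\<in>?W. min 3 (cost E d v)) \<le> sum (cost E 2) ?W" by (rule sum_mono) (auto simp: cost_def)
    then show ?thesis using sum_cost_nbB[of E 2] unfolding nW_def nU_def by simp
  qed
  have min1: "(\<Sum>v\<in>?W. min 3 (cost E d v)) \<le> nW + d * nU"
    unfolding s[symmetric] by (rule sum_mono) simp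
  from end_shape[OF Q E d z] consider (1) y where "d = 1" "E = {y}" | (2) "d = 2" "2 \<le> card E"
    | (3) "d = 3" "card E = 3" "\<And>x. x \<in> E \<Longrightarrow> (x, w) \<in> A" by blast
  then show ?thesis
  proof cases
    case 1
    have "?U = ?W" unfolding uni_def nbB_iff using 1(2) by (auto simp: nbB_iff)
    then have UWe: "nU = nW" unfolding nW_def nU_def by simp
    consider "nW = 2" | "nW = 3" | "4 \<le> nW" using W2 by linarith
    then show ?thesis
    proof cases
      case 1 then show ?thesis using s UWe min1 \<open>d = 1\<close> unfolding pair_end_def nW_def[symmetric] by simp
    next
      case a: 2
      have "sum (cost E d) ?W + cost E d v \<le> 10" for v using cl[of v] s UWe a 1(1) by simp
      then show ?thesis using s UWe a 1 unfolding triple_end_def nW_def[symmetric] by simp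
    next
      case 3 then show ?thesis using good UWe 1 by simp
    qed
  next
    case 2
    have big: "nU \<le> 2" if "card E \<noteq> 2" using card_uni_le2[OF fE] 2(2) that unfolding nU_def by simp
    \<comment> \<open>Each of the two vertices of E sees every neighbour and serves as a piece of
      its own.\<close>
    have twin: "settled Q" if cE: "card E = 2" and eq: "nU = nW" "3 \<le> nW"
    proof -
      obtain y1 y2 where y: "E = {y1, y2}" "y1 \<noteq> y2" using cE unfolding card_2_iff by blast
      have UWe: "?U = ?W" by (rule card_subset_eq[OF finite_nbB uni_subset]) (use eq in \<open>simp add: nW_def nU_def\<close>)
      have N: "?W \<subseteq> nbB {y}" if "y \<in> E" for y
      proof
        fix v assume "v \<in> ?W"
        then have "v \<in> B" "(y, v) \<in> A" using uniD[OF _ that, of v] UWe nbB_subset by blast+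
        then show "v \<in> nbB {y}" by (simp add: nbB_iff)
      qed
      show ?thesis
      proof (rule twins_settled[OF Q(1) E d])
        show "y1 \<in> E" "y2 \<in> E" "y1 \<noteq> y2" using y by auto
        then show "?W \<subseteq> nbB {y1}" "?W \<subseteq> nbB {y2}" using N by auto
        show "3 \<le> card ?W" "sum (cost E d) ?W \<le> 10 * (card ?W - 2)"
          using s eq 2(1) unfolding nW_def by simp_all
      qed
    qed
    consider "nW = 2" | "nW = 3" "nU \<le> 1" | "nW = 3" "nU = 2" | "nW = 3" "nU = 3" | "4 \<le> nW" using W2 UW by linarith
    then show ?thesis
    proof cases
      case a: 1
      have "nU \<le> 1"
      proof (rule ccontr)
        assume "\<not> nU \<le> 1"
        then have "?U = ?W" by (intro card_subset_eq[OF finite_nbB uni_subset]) (use UW a in \<open>simp add: nW_def nU_def\<close>)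
        moreover obtain a b where ab: "?W = {a, b}" "a \<noteq> b" using a unfolding nW_def card_2_iff by blast
        ultimately have un: "(y, a) \<in> A" "(y, b) \<in> A" if "y \<in> E" for y using uniD that by blast+
        obtain q1 q2 where q: "q1 \<in> E" "q2 \<in> E" "q1 \<noteq> q2" "(q1, w) \<in> A" "(q2, w) \<in> A"
          by (rule end_two_nbrs[OF fQ(2) E]) (use 2(2) in auto)
        have abQ: "a \<notin> Q" "b \<notin> Q" using nbB_notin[OF Q(1)] ab by blast+
        have abV: "a \<in> V" "b \<in> V" using ab nbB_subset BV by blast+
        \<comment> \<open>The component of z outside \<open>?S\<close> is bounded by a, b and w
          only, hence by 3-connectivity by all three. These three are also adjacent to q1 and
          q2.\<close>
        let ?S = "E \<union> {a, b, w}"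
        let ?Y = "component A (V - ?S) z"
        have zS: "z \<in> V - ?S" using z abQ islandD(2)[OF Q(1)] by blast
        note Y = component_V[OF zS]
        have "bound A ?Y \<inter> E = {}"
        proof (rule ccontr)
          assume "\<not> ?thesis"
          then obtain x y where xy: "x \<in> E" "y \<in> ?Y" "(y, x) \<in> A" unfolding bound_def touch_def by blast
          then have "y \<in> bound A E" using Y(2) arcD unfolding bound_def touch_def by blast
          then show False using bound_end[OF Q(1) E] ab(1) Y(2) xy(2) by blast
        qed
        then have bY: "bound A ?Y \<subseteq> {a, b, w}" using Y(4) by blast
        have "3 \<le> card (bound A ?Y)"
        proof (rule three)
          show "V - ?Y - bound A ?Y \<noteq> {}" using q(1) EQ(2) islandD(2)[OF Q(1)] Y(2) bY w abQ by blast
        qed (use Y in auto)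
        moreover have "card {a, b, w} \<le> 3" using card_length[of "[a, b, w]"] by simp
        ultimately have "bound A ?Y = {a, b, w}" using bY by (intro card_seteq) auto
        then have "touch A ?Y {a}" "touch A ?Y {b}" "touch A ?Y {w}" using bound_touch by blast+
        moreover have "?Y \<inter> {q1, q2, a, b, w} = {}" using Y(2) q(1,2) by blast
        moreover have "a \<noteq> w" "b \<noteq> w" using abQ w by blast+
        ultimately show False using k33_hub[of q1 a b w q2 ?Y] q un ab(2) Y(1) by blast
      qed
      then show ?thesis using s a min2 2(1) unfolding pair_end_def nW_def[symmetric] by simp
    next
      case a: 2 then show ?thesis using good 2(1) by simp
    next
      case a: 3
      have "cost E d v \<le> 3" for v using cl[of v] 2(1) by simp
      then have "sum (cost E d) ?W + cost E d v \<le> 10" for v using s a 2(1) by (simp add: add_mono_thms_linordered_semiring(1))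
      then show ?thesis using s a 2 unfolding triple_end_def nW_def[symmetric] nU_def[symmetric] by simp
    next
      case a: 4 then show ?thesis using twin big by fastforce
    next
      case a: 5
      show ?thesis
      proof (cases "card E = 2")
        case True
        show ?thesis
        proof (cases "nU = nW")
          case True then show ?thesis using twin \<open>card E = 2\<close> a by simp
        next
          case False then show ?thesis using good UW a 2(1) by simp
        qed
      next
        case False then show ?thesis using good big a 2(1) by simp
      qed
    qed
  next
    case 3
    obtain q1 q2 q3 where q: "q1 \<in> E" "q2 \<in> E" "q3 \<in> E" "q1 \<noteq> q2" "q1 \<noteq> q3" "q2 \<noteq> q3"
      using three_elements[of E] 3(2) by (metis order_refl)
    \<comment> \<open>Two such neighbours and w would all be adjacent to the three vertices of
      E.\<close>
    have U1: "nU \<le> 1"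
    proof (rule ccontr)
      assume "\<not> nU \<le> 1"
      then obtain u1 u2 where u: "u1 \<in> ?U" "u2 \<in> ?U" "u1 \<noteq> u2"
        unfolding nU_def using card_le_Suc0_iff_eq[OF finite_uni, of E] by auto
      have "w \<noteq> u1" "w \<noteq> u2" using u nbB_notin[OF Q(1)] uni_subset w by blast+
      then show False using k33_points[of q1 w u1 u2 q2 q3] q u 3(3) uniD by blast
    qed
    consider "nW = 2" | "nW = 3" "nU = 0" | "nW = 3" "nU = 1" | "4 \<le> nW" using W2 U1 by linarith
    then show ?thesis
    proof cases
      case a: 1 then show ?thesis using s U1 min2 3(1) unfolding pair_end_def nW_def[symmetric] by simp
    next
      case a: 2 then show ?thesis using good by simp
    next
      case a: 3
      have "cost E d v \<le> 4" for v using cl[of v] 3(1) by simp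
      then have "sum (cost E d) ?W + cost E d v \<le> 10" for v using s a 3(1) by (simp add: add_mono_thms_linordered_semiring(1))
      then show ?thesis using s a 3(1,2) unfolding triple_end_def nW_def[symmetric] nU_def[symmetric] by simp
    next
      case a: 4 then show ?thesis using good U1 3(1) by simp
    qed
  qed
qed

text \<open>Without cut vertices Q is its own end. The cost n + d u exceeds 5 (n - 2) only for n = 3
  with d = 1 or d = 2; there two vertices adjacent to all three neighbours act as twins, or a K33
  model appears.\<close>

theorem settled_whole:
  assumes Q: "island Q" "bad Q" and nc: "\<And>x. x \<in> Q \<Longrightarrow> noncut Q x" and 3: "3 \<le> card (nbB Q)"
  shows "settled Q"
proof -
  note fQ = islandD(4,1)[OF Q(1)]
  have E: "end_of Q Q {}" by (rule end_of_whole[OF fQ(2) nc])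
  obtain d where d: "\<And>x. x \<in> Q \<Longrightarrow> deg Q x = d" by (rule end_degree[OF Q E]) blast
  obtain R where R: "badlist Q R" using Q(2) unfolding bad_def by blast
  let ?W = "nbB Q" and ?U = "uni Q"
  define nW nU where "nW = card ?W" and "nU = card ?U"
  have s: "sum (cost Q d) ?W = nW + d * nU" unfolding nW_def nU_def by (rule sum_cost_nbB)
  have UW: "nU \<le> nW" unfolding nW_def nU_def by (rule card_uni)
  have W3: "3 \<le> nW" using 3 unfolding nW_def .
  have good: "settled Q" if "nW + d * nU \<le> 5 * (nW - 2)"
    by (rule settled_end[OF Q(1) E d]) (use that s W3 in \<open>auto simp: nW_def\<close>)
  have twin: "settled Q" if "y1 \<in> Q" "y2 \<in> Q" "y1 \<noteq> y2" "\<And>v. v \<in> ?W \<Longrightarrow> (y1, v) \<in> A \<and> (y2, v) \<in> A" "nW + d * nU \<le> 10 * (nW - 2)" for y1 y2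
  proof (rule twins_settled[OF Q(1) E d that(1-3)])
    show "nbB Q \<subseteq> nbB {y1}" "nbB Q \<subseteq> nbB {y2}" using that(4) nbB_subset by (auto simp: nbB_iff)
  qed (use that(5) s W3 in \<open>auto simp: nW_def\<close>)
  obtain x where x: "x \<in> Q" using conn_nonempty[OF fQ(2)] by blast
  have nx: "card (nbrs A Q x) = d" using d[OF x] .
  consider "d = 0" | "d = 1" | "d = 2" | "3 \<le> d" by linarith
  then show ?thesis
  proof cases
    case 1 then show ?thesis using good W3 by simp
  next
    case 2
    obtain y where y: "nbrs A Q x = {y}" using nx 2 card_1_singletonE by auto
    then have xy: "y \<in> Q" "(x, y) \<in> A" "x \<noteq> y" using irreflA unfolding nbrs_def by blast+
    obtain y' where y': "nbrs A Q y = {y'}" using d[OF xy(1)] 2 card_1_singletonE by auto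
    have "x \<in> nbrs A Q y" using x arcD[OF xy(2)] by (simp add: nbrs_def)
    then have "nbrs A Q y = {x}" using y' by simp
    have Qe: "Q = {x, y}"
    proof (rule ccontr)
      assume "Q \<noteq> {x, y}"
      then have "touch A {x, y} (Q - {x, y})" using connD[OF fQ(2), of "{x, y}"] x xy by blast
      then show False using y \<open>nbrs A Q y = {x}\<close> unfolding touch_def nbrs_def by blast
    qed
    consider "4 \<le> nW" | "nW = 3" "nU \<le> 2" | "nW = 3" "nU = 3" using W3 UW by linarith
    then show ?thesis
    proof cases
      case a: 3
      have "?U = ?W" by (rule card_subset_eq[OF finite_nbB uni_subset]) (use a in \<open>simp add: nW_def nU_def\<close>)
      then show ?thesis using twin[OF x xy(1,3)] uniD x xy(1) a 2 by auto
    qed (use good UW 2 in auto)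
  next
    case 3
    obtain q1 q2 where q: "nbrs A Q x = {q1, q2}" "q1 \<noteq> q2" using nx 3 card_2_iff by metis
    then have qQ: "q1 \<in> Q" "q2 \<in> Q" "q1 \<noteq> x" "q2 \<noteq> x" using irreflA unfolding nbrs_def by blast+
    have "card {x, q1, q2} \<le> card Q" by (rule card_mono[OF fQ(1)]) (use qQ x in auto)
    then have "3 \<le> card Q" using q(2) qQ by simp
    then have U2: "nU \<le> 2" unfolding nU_def by (rule card_uni_le2[OF fQ(1)])
    consider "4 \<le> nW" | "nW = 3" "nU \<le> 1" | "nW = 3" "nU = 2" using W3 U2 by linarith
    then show ?thesis
    proof cases
      case a: 3
      obtain a b where ab: "?U = {a, b}" "a \<noteq> b" using a(2) unfolding nU_def card_2_iff by blast
      have "card (?W - ?U) = 1" using a uni_subset card_Diff_subset[OF finite_uni uni_subset, of Q] unfolding nW_def nU_def by simp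
      then obtain c where c: "?W - ?U = {c}" by (rule card_1_singletonE)
      have W: "?W = {a, b, c}" using c ab uni_subset by blast
      have cc: "c \<noteq> a" "c \<noteq> b" "c \<in> ?W" using c ab by blast+
      obtain u where u: "u \<in> Q" "(u, c) \<in> A" using cc(3) unfolding nbB_iff by blast
      have un: "(y, a) \<in> A" "(y, b) \<in> A" if "y \<in> Q" for y using uniD[OF _ that] ab by blast+
      show ?thesis
      proof (cases "\<exists>y\<in>Q. y \<noteq> u \<and> (y, c) \<in> A")
        case True
        then obtain y where y: "y \<in> Q" "u \<noteq> y" "(y, c) \<in> A" by blast
        show ?thesis by (rule twin[OF u(1) y(1,2)]) (use W u y un a 3 in auto)
      next
        case False
        obtain p1 p2 where p: "nbrs A Q u = {p1, p2}" "p1 \<noteq> p2" using d[OF u(1)] 3 card_2_iff by metis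
        then have pQ: "p1 \<in> Q" "p2 \<in> Q" "p1 \<noteq> u" "p2 \<noteq> u" "(p1, u) \<in> A" "(p2, u) \<in> A"
          using irreflA arcD unfolding nbrs_def by blast+
        have nQ: "a \<notin> Q" "b \<notin> Q" "c \<notin> Q" using nbB_notin[OF Q(1)] W by blast+
        \<comment> \<open>As u is the only vertex of Q that sees c, the component of c is bounded by
          a, b and u. All three are adjacent to the neighbours p1 and p2 of u.\<close>
        let ?S = "Q \<union> {a, b}"
        let ?Y = "component A (V - ?S) c"
        have cS: "c \<in> V - ?S" using cc nQ nbB_subset BV by blast
        note Y = component_V[OF cS]
        have bY: "bound A ?Y \<subseteq> {a, b, u}"
        proof
          fix v assume v: "v \<in> bound A ?Y"
          show "v \<in> {a, b, u}"
          proof (cases "v \<in> Q")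
            case True
            obtain y where y: "y \<in> ?Y" "(y, v) \<in> A" using v unfolding bound_def touch_def by blast
            then have "y \<notin> Q" "(v, y) \<in> A" using Y(2) arcD by blast+
            then have "y \<in> {a, b, c}" using island_nbr(2)[OF Q(1) True] W by blast
            then have "y = c" using Y(2) y(1) by blast
            then show ?thesis using False True \<open>(v, y) \<in> A\<close> by blast
          qed (use v Y(4) in blast)
        qed
        have "3 \<le> card (bound A ?Y)"
        proof (rule three)
          show "V - ?Y - bound A ?Y \<noteq> {}" using pQ(1,3) islandD(2)[OF Q(1)] Y(2) bY nQ by blast
        qed (use Y in auto)
        moreover have "card {a, b, u} \<le> 3" using card_length[of "[a, b, u]"] by simp
        ultimately have "bound A ?Y = {a, b, u}" using bY by (intro card_seteq) auto
        then have "touch A ?Y {a}" "touch A ?Y {b}" "touch A ?Y {u}" using bound_touch by blast+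
        moreover have "?Y \<inter> {p1, p2, a, b, u} = {}" using Y(2) pQ(1,2) u(1) by blast
        moreover have "a \<noteq> u" "b \<noteq> u" using nQ u by blast+
        ultimately have False using k33_hub[of p1 a b u p2 ?Y] pQ p(2) un ab(2) Y(1) by blast
        then show ?thesis ..
      qed
    qed (use good UW U2 3 in auto)
  next
    case 4
    have cl: "(x, y) \<in> A" if "x \<in> Q" "y \<in> Q" "x \<noteq> y" for x y
      by (rule end_clique[OF R fQ E d 4 that])
    have "nbrs A Q x = Q - {x}" using cl[OF x] irreflA unfolding nbrs_def by blast
    then have cQ: "card Q = d + 1" using nx card_Suc_Diff1[OF fQ(1) x] by simp
    obtain a where a: "a \<in> ?W" using W3 unfolding nW_def by fastforce
    have aV: "a \<in> V" "a \<notin> Q" using a nbB_subset BV nbB_notin[OF Q(1)] by blast+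
    have "d = 3"
    proof (rule ccontr)
      assume "d \<noteq> 3"
      then show False using no_clique5[of Q] islandD(2)[OF Q(1)] cQ 4 cl aV by fastforce
    qed
    \<comment> \<open>A neighbour adjacent to all of Q would complete a clique on five vertices, and
      a further neighbour shows that this clique is not all of V.\<close>
    moreover have "?U = {}"
    proof (rule ccontr)
      assume "?U \<noteq> {}"
      then obtain u where u: "u \<in> ?U" by blast
      then have uW: "u \<in> ?W" using uni_subset by blast
      then have uQ: "u \<notin> Q" "u \<in> V" using nbB_subset BV nbB_notin[OF Q(1)] by blast+
      have "card (?W - {u}) \<noteq> 0" using W3 uW finite_nbB unfolding nW_def by simp
      then have "?W - {u} \<noteq> {}" by (metis card.empty)
      then obtain v where v: "v \<in> ?W" "v \<noteq> u" by blast
      then have vQ: "v \<notin> Q" "v \<in> V" using nbB_subset BV nbB_notin[OF Q(1)] by blast+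
      show False
      proof (rule no_clique5[of "insert u Q"])
        show "5 \<le> card (insert u Q)" using cQ 4 uQ fQ by simp
        show "(x, y) \<in> A" if "x \<in> insert u Q" "y \<in> insert u Q" "x \<noteq> y" for x y
          using that cl uniD[OF u] arcD by blast
      qed (use uQ vQ v islandD(2)[OF Q(1)] in auto)
    qed
    ultimately show ?thesis using good W3 by (simp add: nU_def)
  qed
qed

end

section \<open>Combining two ends of an island\<close>

context truncated_cover begin

text \<open>If some unit is placed on \<open>W1\<close>, that unit alone pays for \<open>W1\<close>;
  otherwise all units lie on \<open>W2\<close> and pay for it.\<close>

lemma settled_two_sets:
  assumes Q: "island Q" and W: "W1 \<subseteq> nbB Q" "W2 \<subseteq> nbB Q" "W1 \<noteq> {}" "W2 \<noteq> {}" and 3: "3 \<le> card (W1 \<union> W2)"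
    and c1: "\<And>v. v \<in> W1 \<Longrightarrow> saver Q W1 v (c1 v)" "sum c1 W1 \<le> 5"
    and c2: "\<And>v. v \<in> W2 \<Longrightarrow> saver Q W2 v (c2 v)" "sum c2 W2 \<le> 5 * (card (W1 \<union> W2) - 2)"
  shows "settled Q"
proof (rule settled_choice[OF islandD(1)[OF Q] order_refl _ 3])
  show "W1 \<union> W2 \<subseteq> nbB Q" using W by blast
  have WB: "W1 \<subseteq> B" "W2 \<subseteq> B" using W nbB_subset by blast+
  then have fin: "finite W1" "finite W2" using finB finite_subset by blast+
  fix m :: "'a \<Rightarrow> nat" assume m: "sum m (W1 \<union> W2) = card (W1 \<union> W2) - 2"
  show "\<exists>X c. X \<noteq> {} \<and> X \<subseteq> B \<and> (\<forall>v\<in>X. saver Q X v (c v)) \<and> sum c X \<le> 5 * sum m X"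
  proof (cases "sum m W1 = 0")
    case True
    have "sum m (W1 \<union> W2) \<le> sum m W1 + sum m W2" using sum.union_inter[OF fin, of m] by simp
    then have "sum c2 W2 \<le> 5 * sum m W2" using m c2(2) True by simp
    then show ?thesis using W WB c2(1) by (intro exI[of _ W2] exI[of _ c2]) auto
  next
    case False
    then have "sum c1 W1 \<le> 5 * sum m W1" using c1(2) by simp
    then show ?thesis using W WB c1(1) by (intro exI[of _ W1] exI[of _ c1]) auto
  qed
qed

text \<open>Common vertices use the cheaper of their two savers. If each set has one private vertex,
  the average of the two estimates is at most 10 = 5 (4 - 2); otherwise the union has at least five
  elements and 14 \<le> 15.\<close>

lemma settled_triples:
  assumes Q: "island Q" and W: "W1 \<subseteq> nbB Q" "W2 \<subseteq> nbB Q" "card W1 = 3" "card W2 = 3" "W1 \<noteq> W2"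
    and c1: "\<And>v. v \<in> W1 \<Longrightarrow> saver Q W1 v (c1 v)" "sum c1 W1 \<le> 7" "\<And>v. sum c1 W1 + c1 v \<le> 10"
    and c2: "\<And>v. v \<in> W2 \<Longrightarrow> saver Q W2 v (c2 v)" "sum c2 W2 \<le> 7" "\<And>v. sum c2 W2 + c2 v \<le> 10"
  shows "settled Q"
proof -
  have WB: "W1 \<subseteq> B" "W2 \<subseteq> B" using W nbB_subset by blast+
  then have fin: "finite W1" "finite W2" using finB finite_subset by blast+
  let ?N = "W1 \<union> W2"
  define c where "c v = (if v \<in> W1 then if v \<in> W2 then min (c1 v) (c2 v) else c1 v else c2 v)" for v
  have s1: "sum c ?N \<le> sum c1 W1 + sum c2 (W2 - W1)"
  proof -
    have "sum c ?N = sum c W1 + sum c (W2 - W1)" 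
      using sum.union_disjoint[of W1 "W2 - W1" c] fin by (simp add: Un_Diff_cancel)
    moreover have "sum c W1 \<le> sum c1 W1" "sum c (W2 - W1) \<le> sum c2 (W2 - W1)" by (rule sum_mono; simp add: c_def)+
    ultimately show ?thesis by linarith
  qed
  have s2: "sum c ?N \<le> sum c2 W2 + sum c1 (W1 - W2)"
  proof -
    have "sum c ?N = sum c W2 + sum c (W1 - W2)" 
      using sum.union_disjoint[of W2 "W1 - W2" c] fin by (simp add: Un_Diff_cancel Un_commute)
    moreover have "sum c W2 \<le> sum c2 W2" "sum c (W1 - W2) \<le> sum c1 (W1 - W2)" by (rule sum_mono; simp add: c_def)+
    ultimately show ?thesis by linarith
  qed
  have cN1: "card ?N = 3 + card (W2 - W1)"
  proof -
    have "?N = W1 \<union> (W2 - W1)" by blast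
    then show ?thesis using card_Un_disjoint[of W1 "W2 - W1"] fin W(3) by auto
  qed
  have cN2: "card ?N = 3 + card (W1 - W2)"
  proof -
    have "?N = W2 \<union> (W1 - W2)" by blast
    then show ?thesis using card_Un_disjoint[of W2 "W1 - W2"] fin W(4) by auto
  qed
  have "W2 - W1 \<noteq> {}"
  proof
    assume "W2 - W1 = {}"
    then have "W2 = W1" using W(3,4) card_subset_eq[OF fin(1), of W2] by simp
    then show False using W(5) by simp
  qed
  then have pos: "1 \<le> card (W2 - W1)" using fin by (simp add: Suc_leI card_gt_0_iff)
  have sub: "sum c2 (W2 - W1) \<le> sum c2 W2" by (rule sum_mono2) (use fin in auto)
  have le: "sum c ?N \<le> 5 * (card ?N - 2)"
  proof (cases "card (W2 - W1) = 1")
    case True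
    then obtain q where q: "W2 - W1 = {q}" by (rule card_1_singletonE)
    have "card (W1 - W2) = 1" using cN1 cN2 True by simp
    then obtain p where p: "W1 - W2 = {p}" by (rule card_1_singletonE)
    have "2 * sum c ?N \<le> (sum c1 W1 + c1 p) + (sum c2 W2 + c2 q)" using s1 s2 p q by simp
    also have "\<dots> \<le> 20" using c1(3)[of p] c2(3)[of q] by linarith
    finally show ?thesis using cN1 True by simp
  next
    case False
    then show ?thesis using s1 sub c1(2) c2(2) cN1 pos by linarith
  qed
  show ?thesis
  proof (rule settled_single[OF islandD(1)[OF Q] order_refl _ _ _ le])
    show "?N \<subseteq> nbB Q" using W by blast
    show "3 \<le> card ?N" using cN1 by simp
    have NB: "?N \<subseteq> B" using WB by blast
    show "saver Q ?N v (c v)" if "v \<in> ?N" for v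
    proof -
      have "saver Q ?N v (c1 v)" if "v \<in> W1" using saver_mono[OF c1(1)[OF that] _ NB] by blast
      moreover have "saver Q ?N v (c2 v)" if "v \<in> W2" using saver_mono[OF c2(1)[OF that] _ NB] by blast
      ultimately show ?thesis using that unfolding c_def min_def by auto
    qed
  qed
qed

text \<open>All other neighbours cost 5 by \<open>saver_five\<close>, so n neighbours cost at most 5
  + 5 (n - 3).\<close>

lemma settled_cheap_triple:
  assumes Q: "island Q" and abe: "{a, b, e} \<subseteq> nbB Q" "a \<noteq> b" "a \<noteq> e" "b \<noteq> e"
    and c: "saver Q (nbB Q) a ca" "saver Q (nbB Q) b cb" "saver Q (nbB Q) e ce" "ca + cb + ce \<le> 5"
  shows "settled Q"
proof -
  define c where "c = (\<lambda>_. 5)(a := ca, b := cb, e := ce)"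
  let ?N = "nbB Q"
  have N: "?N = {a, b, e} \<union> (?N - {a, b, e})" using abe(1) by blast
  have card: "card ?N = 3 + card (?N - {a, b, e})"
    using abe card_Un_disjoint[of "{a, b, e}" "?N - {a, b, e}"] finite_nbB N by auto
  have "sum c ?N = sum c {a, b, e} + sum c (?N - {a, b, e})"
    by (subst N, rule sum.union_disjoint) (use finite_nbB in auto)
  also have "sum c {a, b, e} = ca + cb + ce" using abe unfolding c_def by simp
  also have "sum c (?N - {a, b, e}) = (\<Sum>v\<in>?N - {a, b, e}. 5)" by (rule sum.cong) (auto simp: c_def)
  finally have s: "sum c ?N \<le> 5 * (card ?N - 2)" using assms(9) card by simp
  show ?thesis
  proof (rule settled_single[OF islandD(1)[OF Q] order_refl order_refl _ _ s])
    show "3 \<le> card ?N" using card by simp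
    show "saver Q ?N v (c v)" if "v \<in> ?N" for v
      using saver_five[OF Q that] c unfolding c_def by auto
  qed
qed

end

locale two_ended = truncated_cover A L C V B for A :: "('a \<times> 'a) set" and L :: "'a \<Rightarrow> 'b set" and C V B +
  fixes Q E1 E2 :: "'a set" and w1 w2 :: 'a and d1 d2 :: nat
  assumes isl: "island Q" and badQ: "bad Q" and E1: "end_of Q E1 {w1}" and E2: "end_of Q E2 {w2}"
    and dj: "E1 \<inter> E2 = {}" "w1 \<notin> E2" "w2 \<notin> E1" and mid: "conn A (Q - E1 - E2)"
    and d1: "x \<in> E1 \<Longrightarrow> deg Q x = d1" and d2: "x \<in> E2 \<Longrightarrow> deg Q x = d2"
begin

lemmas EQ1 = end_ofD[OF E1]
lemmas EQ2 = end_ofD[OF E2]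

lemma connQ: "conn A Q" by (rule islandD(1)[OF isl])

lemma saver1: "v \<in> nbB E1 \<Longrightarrow> saver Q (nbB E1) v (cost E1 d1 v)"
  by (rule saver_cost[OF isl EQ1(1,2,4) d1])

lemma saver2: "v \<in> nbB E2 \<Longrightarrow> saver Q (nbB E2) v (cost E2 d2 v)"
  by (rule saver_cost[OF isl EQ2(1,2,4) d2])

lemma nbB_ends: "nbB E1 \<subseteq> nbB Q" "nbB E2 \<subseteq> nbB Q" "nbB E1 \<subseteq> nbB (Q - E2)" "nbB E2 \<subseteq> nbB (Q - E1)"
  by (rule nbB_mono; use EQ1(2) EQ2(2) dj(1) in blast)+

lemma connQ2: "conn A (Q - E2)" by (rule end_conn_Diff[OF connQ E2])

lemma connQ1: "conn A (Q - E1)" by (rule end_conn_Diff[OF connQ E1])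

text \<open>Different pairs have at least three vertices together, which gives a unit to work with.
  If the pairs agree, Q separates a from b: otherwise a, b and the middle part would face the two
  ends and a set outside Q in a K33 model.\<close>

lemma pair_pair:
  assumes p1: "pair_end E1 d1" and p2: "pair_end E2 d2"
  shows "settled Q"
proof (cases "nbB E1 = nbB E2")
  case False
  have c: "card (nbB E1) = 2" "card (nbB E2) = 2" and s: "sum (cost E1 d1) (nbB E1) \<le> 5" "sum (cost E2 d2) (nbB E2) \<le> 5"
    using p1 p2 unfolding pair_end_def by auto
  have "nbB E1 \<subset> nbB E1 \<union> nbB E2"
  proof -
    have "\<not> nbB E2 \<subseteq> nbB E1" using card_subset_eq[OF finite_nbB, of "nbB E2" E1] c False by auto
    then show ?thesis by blast
  qed
  then have "card (nbB E1) < card (nbB E1 \<union> nbB E2)" by (intro psubset_card_mono) (use finite_nbB in auto)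
  then have 3: "3 \<le> card (nbB E1 \<union> nbB E2)" using c by simp
  show ?thesis
    by (rule settled_two_sets[OF isl nbB_ends(1,2) _ _ 3 saver1 s(1) saver2]) (use c s 3 in auto)
next
  case True
  obtain a b where ab: "nbB E1 = {a, b}" "a \<noteq> b" using p1 unfolding pair_end_def card_2_iff by blast
  let ?M = "Q - E1 - E2"
  have sep: "separates A Q a b"
    unfolding separates_def
  proof
    assume "\<exists>Y. conn A Y \<and> Y \<inter> (Q \<union> {a, b}) = {} \<and> touch A Y {a} \<and> touch A Y {b}"
    then obtain Y where Y: "conn A Y" "Y \<inter> (Q \<union> {a, b}) = {}" "touch A Y {a}" "touch A Y {b}" by blast
    obtain y where y: "y \<in> Y" using conn_nonempty[OF Y(1)] by blast
    have YV: "Y \<subseteq> V - (Q \<union> {a, b})" using conn_subset_field[OF Y(1,3) AV] Y(2) by blast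
    then have yV: "y \<in> V - (Q \<union> {a, b})" using y by blast
    let ?Z = "component A (V - (Q \<union> {a, b})) y"
    note Z = component_V[OF yV]
    have YZ: "Y \<subseteq> ?Z" by (rule component_max[OF Y(1) YV y])
    have nE: "x \<notin> bound A ?Z" if x: "x \<in> E1 \<union> E2" for x
    proof
      assume "x \<in> bound A ?Z"
      then obtain u where u: "u \<in> ?Z" "(x, u) \<in> A" using arcD unfolding bound_def touch_def by blast
      then have uQ: "u \<notin> Q" "u \<notin> {a, b}" using Z(2) by blast+
      have "x \<in> Q" using x EQ1(2) EQ2(2) by blast
      then have "u \<in> B" using island_nbr(1)[OF isl _ u(2) uQ(1)] by blast
      then have "u \<in> nbB E1 \<union> nbB E2" using x u(2) unfolding nbB_iff Un_iff by blast
      then show False using True ab uQ by blast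
    qed
    \<comment> \<open>By 3-connectivity the outside set has a boundary vertex other than a and b. It
      is not in an end, because the ends have no neighbours in B except a and b.\<close>
    have tM: "touch A ?Z ?M"
    proof (rule ccontr)
      assume "\<not> touch A ?Z ?M"
      then have bZ: "bound A ?Z \<subseteq> {a, b}" using Z(4) nE unfolding bound_def touch_def by blast
      obtain e where "e \<in> E1" using conn_nonempty[OF EQ1(1)] by blast
      then have e: "e \<in> Q" "e \<notin> {a, b}" using EQ1(2) ab nbB_notin[OF isl] by blast+
      have "3 \<le> card (bound A ?Z)"
      proof (rule three)
        show "V - ?Z - bound A ?Z \<noteq> {}" using e bZ Z(2) islandD(2)[OF isl] by blast
      qed (use Z in auto)
      moreover have "card (bound A ?Z) \<le> card {a, b}" by (rule card_mono[OF _ bZ]) simp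
      ultimately show False using ab by simp
    qed
    have tE: "touch A ?M E1" "touch A ?M E2"
    proof -
      obtain x where "x \<in> E1" "(x, w1) \<in> A" by (rule end_touch[OF connQ E1])
      then show "touch A ?M E1" using EQ1(3) dj arcD unfolding touch_def by blast
      obtain x where "x \<in> E2" "(x, w2) \<in> A" by (rule end_touch[OF connQ E2])
      then show "touch A ?M E2" using EQ2(3) dj arcD unfolding touch_def by blast
    qed
    have ta: "touch A {v} E1" "touch A {v} E2" if "v \<in> {a, b}" for v
    proof -
      have "v \<in> nbB E1" "v \<in> nbB E2" using that ab(1) True by blast+
      then show "touch A {v} E1" "touch A {v} E2" using arcD unfolding nbB_iff touch_def by blast+
    qed
    have tZ: "touch A {v} ?Z" if "v \<in> {a, b}" for v
    proof -
      have "touch A Y {v}" using that Y by blast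
      then show ?thesis using touch_commute[OF symA] touch_mono YZ by blast
    qed
    have abQ: "a \<notin> Q" "b \<notin> Q" using ab nbB_notin[OF isl] by blast+
    show False
    proof (rule k33_freeD[OF free, of "{a}" "{b}" ?M E1 E2 ?Z])
      show "touch A ?M ?Z" using tM touch_commute[OF symA] by blast
      show "E1 \<inter> ?Z = {}" "E2 \<inter> ?Z = {}" "?M \<inter> ?Z = {}" "{a} \<inter> ?Z = {}" "{b} \<inter> ?Z = {}"
        using Z(2) EQ1(2) EQ2(2) by blast+
      show "{a} \<inter> E1 = {}" "{b} \<inter> E1 = {}" "{a} \<inter> E2 = {}" "{b} \<inter> E2 = {}" "{a} \<inter> ?M = {}" "{b} \<inter> ?M = {}"
        using abQ EQ1(2) EQ2(2) by blast+
    qed (use ta tZ tE mid EQ1(1) EQ2(1) Z(1) ab dj in auto)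
  qed
  show ?thesis
    by (rule settled_pair[OF connQ ab(2) _ sep, where c = "cost E1 d1"])
      (use ab nbB_ends(1) saver1 p1 in \<open>auto simp: pair_end_def\<close>)
qed

text \<open>If both ends see the same three vertices, \<open>E1\<close> and its complement in Q are
  two pieces with these neighbours, and 7 \<le> 10.\<close>

lemma triple_triple:
  assumes t1: "triple_end E1 d1" and t2: "triple_end E2 d2"
  shows "settled Q"
proof (cases "nbB E1 = nbB E2")
  case False
  show ?thesis
    by (rule settled_triples[OF isl nbB_ends(1,2) _ _ False saver1 _ _ saver2])
      (use t1 t2 in \<open>auto simp: triple_end_def\<close>)
next
  case True
  show ?thesis
    by (rule settled_double[OF EQ1(1,2) connQ1 _ _ order_refl _ _ saver1])
      (use True nbB_ends(4) t1 in \<open>auto simp: triple_end_def\<close>)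
qed

text \<open>The hard case is a pair a, b inside a triple a, b, e. Where possible Q is split into two
  pieces that both see a, b and e, one of them getting a and b through \<open>E1\<close>. Where this
  fails, the three vertices are cheap or a K33 model exists.\<close>

lemma pair_triple:
  assumes p1: "pair_end E1 d1" and t2: "triple_end E2 d2"
  shows "settled Q"
proof (cases "4 \<le> card (nbB E1 \<union> nbB E2)")
  case True
  have "nbB E1 \<noteq> {}" "nbB E2 \<noteq> {}" using p1 t2 unfolding pair_end_def triple_end_def by auto
  then show ?thesis
    by (intro settled_two_sets[OF isl nbB_ends(1,2) _ _ _ saver1 _ saver2])
      (use p1 t2 True in \<open>auto simp: pair_end_def triple_end_def\<close>)
next
  case False
  have c: "card (nbB E1) = 2" "card (nbB E2) = 3" using p1 t2 unfolding pair_end_def triple_end_def by auto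
  have s2: "sum (cost E2 d2) (nbB E2) \<le> 7" using t2 unfolding triple_end_def by simp
  have fU: "finite (nbB E1 \<union> nbB E2)" using finite_nbB by simp
  have "nbB E1 \<union> nbB E2 = nbB E2" by (rule card_seteq[OF fU, symmetric]) (use False c in auto)
  then have sub: "nbB E1 \<subseteq> nbB E2" by blast
  obtain a b where ab: "nbB E1 = {a, b}" "a \<noteq> b" using c(1) unfolding card_2_iff by blast
  have "card (nbB E2 - nbB E1) = 1" using card_Diff_subset[OF finite_nbB sub] c by simp
  then obtain e where e: "nbB E2 - nbB E1 = {e}" by (rule card_1_singletonE)
  have W2: "nbB E2 = {a, b, e}" and ne: "a \<noteq> e" "b \<noteq> e" using e sub ab by blast+
  have WQ: "{a, b, e} \<subseteq> nbB Q" using nbB_ends(2) W2 by simp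
  have abQ: "a \<notin> Q" "b \<notin> Q" "e \<notin> Q" using W2 nbB_notin[OF isl] by blast+
  have split: "settled Q" if P: "conn A P1" "P1 \<subseteq> Q" "conn A P2" "P2 \<subseteq> Q" "P1 \<inter> P2 = {}"
    "{a, b, e} \<subseteq> nbB P1" "{a, b, e} \<subseteq> nbB P2" for P1 P2
    by (rule settled_double[OF P[folded W2] _ saver2]) (use c s2 in auto)
  have leaf: "saver Q (nbB Q) v (cost E2 d2 v)" if "v \<in> {a, b, e}" for v
    using saver_mono[OF saver2 nbB_ends(2) nbB_subset order_refl] that W2 by blast
  have leaf1: "saver Q (nbB Q) v (cost E1 d1 v)" if "v \<in> {a, b}" for v
    using saver_mono[OF saver1 nbB_ends(1) nbB_subset order_refl] that ab by blast
  have fE2: "finite E2" using EQ2(2) islandD(4)[OF isl] finite_subset by blast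
  obtain r where r: "r \<in> E1" using conn_nonempty[OF EQ1(1)] by blast
  have rQ: "r \<in> Q" "r \<notin> E2" "r \<noteq> w2" using r EQ1(2) dj by blast+
  have w2: "w2 \<in> Q" "w2 \<notin> E2" using EQ2(3) by blast+
  have E1sub: "{a, b} \<subseteq> nbB P" if "E1 \<subseteq> P" for P using nbB_mono[OF that] ab by blast
  \<comment> \<open>A single vertex y that sees all three is one piece; the rest of Q sees a and b
    through \<open>E1\<close>, and e through \<open>y'\<close>.\<close>
  have split1: "settled Q" if y: "y \<in> E2" "{a, b, e} \<subseteq> nbB {y}" and y': "y' \<in> E2" "y' \<noteq> y" "(y', e) \<in> A" for y y'
  proof (rule split[of "{y}" "Q - {y}"])
    show "conn A (Q - {y})" by (rule noncut_conn[OF EQ2(4)[OF y(1)] rQ(1)]) (use y rQ in blast)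
    have "e \<in> nbB (Q - {y})" using y' EQ2(2) W2 nbB_subset unfolding nbB_iff by blast
    moreover have "{a, b} \<subseteq> nbB (Q - {y})" by (rule E1sub) (use EQ1(2) dj y in blast)
    ultimately show "{a, b, e} \<subseteq> nbB (Q - {y})" by blast
  qed (use y EQ2(2) in auto)
  show ?thesis
  proof (cases "e \<in> nbB (Q - E2)")
    case True
    show ?thesis
      by (rule split[OF EQ2(1,2) connQ2]) (use True W2 nbB_ends(3) ab in auto)
  next
    case False
    have shape: "(d2 = 1 \<and> (\<exists>y. E2 = {y})) \<or> (d2 = 2 \<and> 2 \<le> card E2 \<and> card (uni E2) = 2) \<or> (d2 = 3 \<and> card E2 = 3 \<and> card (uni E2) = 1)"
      using t2 unfolding triple_end_def by blast
    have uW: "uni E2 \<subseteq> {a, b, e}" using uni_subset W2 by blast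
    have adjv: "\<exists>y\<in>E2. (y, v) \<in> A" if "v \<in> {a, b, e}" for v using that W2[symmetric] by (simp add: nbB_iff)
    have vB: "v \<in> B" if "v \<in> {a, b, e}" for v using that W2[symmetric] by (simp add: nbB_iff)
    \<comment> \<open>Here e costs 1. Both a and b can be saved at cost at most 3 at
      \<open>E2\<close> and possibly more cheaply at \<open>E1\<close>; the truncated sum in
      \<open>pair_end\<close> bounds the two by 4.\<close>
    have cheap: "settled Q" if "d2 = 2" "e \<notin> uni E2"
    proof -
      have ce: "cost E2 d2 e = 1" using that W2 unfolding cost_def uni_def by auto
      have mn: "saver Q (nbB Q) v (min 3 (cost E1 d1 v))" if v: "v \<in> {a, b}" for v
      proof (cases "cost E1 d1 v \<le> 3")
        case True
        then have "min 3 (cost E1 d1 v) = cost E1 d1 v" by (rule min_absorb2)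
        then show ?thesis using leaf1[OF v] by simp
      next
        case False
        have "cost E2 d2 v \<le> 3" using cost_le[of E2 d2 v] \<open>d2 = 2\<close> by simp
        then have "saver Q (nbB Q) v 3" using leaf[of v] v saver_mono[OF _ order_refl nbB_subset] by blast
        then show ?thesis using False by simp
      qed
      have "min 3 (cost E1 d1 a) + min 3 (cost E1 d1 b) \<le> 4" using p1 ab unfolding pair_end_def by simp
      then show ?thesis
        by (intro settled_cheap_triple[OF isl WQ ab(2) ne mn mn leaf[of e, unfolded ce]]) auto
    qed
    from shape consider (1) y where "d2 = 1" "E2 = {y}" | (2) "d2 = 2" "2 \<le> card E2" "card (uni E2) = 2" "e \<in> uni E2"
      | (20) "d2 = 2" "e \<notin> uni E2" | (3) "d2 = 3" "card E2 = 3" "card (uni E2) = 1" by blast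
    then show ?thesis
    proof cases
      case 1
      \<comment> \<open>As y is the only vertex of Q that sees e, \<open>saver_core\<close> with K =
        {y} lowers the cost of e from 2 to 1. With 2 for each of a and b the total is 5.\<close>
      have "nbrs A Q e \<subseteq> {y}"
      proof
        fix x assume "x \<in> nbrs A Q e"
        then have x: "x \<in> Q" "(x, e) \<in> A" using arcD unfolding nbrs_def by blast+
        then have "x \<in> E2" using False vB[of e] unfolding nbB_iff by blast
        then show "x \<in> {y}" using 1 by simp
      qed
      moreover have "(y, e) \<in> A" using adjv[of e] 1 by simp
      moreover have "y \<in> Q" using EQ2(2) 1 by simp
      ultimately have "saver Q (nbB Q) e (deg {y} y + 1)" using WQ by (intro saver_core[OF isl]) auto
      moreover have "deg {y} y = 0" using irreflA unfolding nbrs_def by simp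
      ultimately have se: "saver Q (nbB Q) e 1" by simp
      have s: "saver Q (nbB Q) v 2" if "v \<in> {a, b}" for v
        by (rule saver_mono[OF leaf[of v] order_refl nbB_subset]) (use that cost_le[of E2 d2 v] 1 in auto)
      show ?thesis by (rule settled_cheap_triple[OF isl WQ ab(2) ne s s se]) auto
    next
      case 2
      obtain u where u: "uni E2 = {e, u}" "u \<noteq> e"
      proof -
        obtain p q where pq: "uni E2 = {p, q}" "p \<noteq> q" using 2(3) unfolding card_2_iff by blast
        show ?thesis
        proof (cases "p = e")
          case True then show ?thesis using that[of q] pq by auto
        next
          case False then show ?thesis using that[of p] pq 2(4) by auto
        qed
      qed
      then have uab: "u \<in> {a, b}" using uW by blast
      obtain v where v: "{a, b} = {u, v}"
      proof (cases "u = a")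
        case True then show ?thesis using that[of b] by simp
      next
        case False then show ?thesis using that[of a] uab by auto
      qed
      obtain y where y: "y \<in> E2" "(y, v) \<in> A" using adjv[of v] v by auto
      have un: "(x, e) \<in> A" "(x, u) \<in> A" if "x \<in> E2" for x using uniD[OF _ that] u by blast+
      have "card (E2 - {y}) \<noteq> 0" using 2(2) y fE2 by simp
      then have "E2 - {y} \<noteq> {}" by (metis card.empty)
      then obtain y' where "y' \<in> E2" "y' \<noteq> y" by blast
      moreover have "{a, b, e} \<subseteq> nbB {y}"
      proof
        fix x assume x: "x \<in> {a, b, e}"
        then have "x = e \<or> x = u \<or> x = v" using v by blast
        then have "(y, x) \<in> A" using un[OF y(1)] y(2) by blast
        then show "x \<in> nbB {y}" using vB[OF x] by (simp add: nbB_iff)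
      qed
      ultimately show ?thesis using split1[OF y(1)] un by blast
    next
      case 20 then show ?thesis using cheap by blast
    next
      case 3
      from end_shape[OF isl badQ E2 d2 rQ] 3 have sh: "\<And>x. x \<in> E2 \<Longrightarrow> (x, w2) \<in> A"
        "\<And>x y. x \<in> E2 \<Longrightarrow> y \<in> E2 \<Longrightarrow> x \<noteq> y \<Longrightarrow> (x, y) \<in> A" by auto
      obtain u where u: "uni E2 = {u}" using 3(3) by (rule card_1_singletonE)
      have un: "(x, u) \<in> A" if "x \<in> E2" for x using uniD[OF _ that] u by blast
      have other: "\<exists>x\<in>E2. x \<noteq> y \<and> x \<noteq> y'" for y y'
      proof -
        have "card {y, y'} \<le> 2" using card_length[of "[y, y']"] by simp
        then have "\<not> E2 \<subseteq> {y, y'}" using card_mono[of "{y, y'}" E2] 3(2) by auto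
        then show ?thesis by blast
      qed
      show ?thesis
      proof (cases "u = e")
        case True
        show ?thesis
        proof (cases "\<exists>y\<in>E2. (y, a) \<in> A \<and> (y, b) \<in> A")
          case ex: True
          then obtain y where y: "y \<in> E2" "(y, a) \<in> A" "(y, b) \<in> A" by blast
          obtain y' where "y' \<in> E2" "y' \<noteq> y" using other[of y y] by blast
          moreover have "{a, b, e} \<subseteq> nbB {y}" using vB un[OF y(1)] y True by (auto simp: nbB_iff)
          ultimately show ?thesis using split1[OF y(1)] un True by blast
        next
          case nex: False
          \<comment> \<open>No vertex sees both a and b, but y1 and y2 together do; the third vertex
            y3 carries e over to the other piece.\<close>
          obtain y1 y2 where y: "y1 \<in> E2" "(y1, a) \<in> A" "y2 \<in> E2" "(y2, b) \<in> A" using adjv by blast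
          then have y12: "y1 \<noteq> y2" using nex by blast
          obtain y3 where y3: "y3 \<in> E2" "y3 \<noteq> y1" "y3 \<noteq> y2" using other[of y1 y2] by blast
          have "card {y1, y2, y3} = 3" using y12 y3 by auto
          then have Ee: "E2 = {y1, y2, y3}" using 3(2) card_subset_eq[OF fE2, of "{y1, y2, y3}"] y y3 by simp
          have Qe: "Q - {y1, y2} = insert y3 (Q - E2)" using Ee y3 EQ2(2) by blast
          have c2: "conn A (insert y3 (Q - E2))"
            by (rule conn_insert[OF symA connQ2]) (use sh(1)[OF y3(1)] w2 in \<open>auto simp: touch_def\<close>)
          show ?thesis
          proof (rule split[of "{y1, y2}" "insert y3 (Q - E2)"])
            show "conn A {y1, y2}" by (rule conn_pair[OF symA sh(2)[OF y(1,3) y12]])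
            show "{a, b, e} \<subseteq> nbB {y1, y2}" using vB un y True by (auto simp: nbB_iff)
            have "e \<in> nbB (insert y3 (Q - E2))" using vB un[OF y3(1)] True by (auto simp: nbB_iff)
            moreover have "{a, b} \<subseteq> nbB (insert y3 (Q - E2))" by (rule E1sub) (use EQ1(2) dj in blast)
            ultimately show "{a, b, e} \<subseteq> nbB (insert y3 (Q - E2))" by blast
          qed (use c2 y y3 EQ2(2) in auto)
        qed
      next
        case ue: False
        then have uab: "u \<in> {a, b}" using u uW by blast
        \<comment> \<open>The component of r touches u, w2 and, by 3-connectivity, some x in
          \<open>E2\<close>. The other two vertices of the triangle \<open>E2\<close> are adjacent
          to these three as well.\<close>
        let ?S = "E2 \<union> {u, w2}"
        let ?O = "component A (V - ?S) r"
        have uV: "u \<in> V" "u \<notin> Q" using uab vB BV abQ by blast+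
        have rS: "r \<in> V - ?S" using rQ islandD(2)[OF isl] uV by blast
        note O = component_V[OF rS]
        have E1O: "E1 \<subseteq> ?O"
          by (rule component_max[OF EQ1(1) _ r]) (use EQ1(2) dj islandD(2)[OF isl] uV in blast)
        have tu: "touch A ?O {u}"
        proof -
          have "u \<in> nbB E1" using uab ab by blast
          then show ?thesis using E1O unfolding nbB_iff touch_def by blast
        qed
        have tw: "touch A ?O {w2}"
        proof -
          let ?D = "Q - E2 - {w2}"
          let ?T = "component A ?D r"
          have rD: "r \<in> ?D" using rQ by blast
          have T: "conn A ?T" "?T \<subseteq> ?D" "r \<in> ?T" "\<not> touch A ?T (?D - ?T)"
            using component_conn[OF rD, of A] component_subset[of A ?D r] component_self[OF rD, of A] component_closed[OF symA rD] by auto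
          have "touch A ?T (Q - E2 - ?T)" by (rule connD[OF connQ2]) (use T w2 in auto)
          then have "touch A ?T {w2}" using T(4) unfolding touch_def by blast
          moreover have "?T \<subseteq> ?O"
            by (rule component_max[OF T(1) _ T(3)]) (use T(2) islandD(2)[OF isl] uV in blast)
          ultimately show ?thesis using touch_mono by blast
        qed
        have "\<exists>x\<in>E2. touch A ?O {x}"
        proof (rule ccontr)
          assume "\<not> ?thesis"
          then have bO: "bound A ?O \<subseteq> {u, w2}" using O(4) bound_touch by blast
          obtain x where "x \<in> E2" using other by blast
          then have x: "x \<in> V" "x \<notin> ?O" "x \<noteq> u" "x \<noteq> w2" using EQ2(2) islandD(2)[OF isl] O(2) uV w2 by blast+
          have "3 \<le> card (bound A ?O)" by (rule three) (use x bO O in auto)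
          moreover have "card (bound A ?O) \<le> card {u, w2}" by (rule card_mono[OF _ bO]) simp
          moreover have "card {u, w2} \<le> 2" using card_length[of "[u, w2]"] by simp
          ultimately show False by simp
        qed
        then obtain x where x: "x \<in> E2" "touch A ?O {x}" by blast
        obtain y where y: "y \<in> E2" "y \<noteq> x" using other[of x x] by blast
        obtain z where z: "z \<in> E2" "z \<noteq> x" "z \<noteq> y" using other[of x y] by blast
        have neq: "u \<noteq> w2" "u \<noteq> x" "w2 \<noteq> x" using uV w2 x EQ2(2) by blast+
        have "?O \<inter> {y, z, u, w2, x} = {}" using O(2) x y z by blast
        then have Fls: False
          by (intro k33_hub[of y u w2 x z ?O]) (use un sh x y z neq tu tw O(1) in auto)
        then show ?thesis ..
      qed
    qed
  qed
qed

end

context truncated_cover begin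

theorem island_settled:
  assumes Q: "island Q" "bad Q" and 3: "3 \<le> card (nbB Q)"
  shows "settled Q"
proof (cases "\<forall>x\<in>Q. noncut Q x")
  case True then show ?thesis using settled_whole[OF Q _ 3] by blast
next
  case False
  then obtain x where x: "x \<in> Q" "\<not> noncut Q x" by blast
  obtain E1 w1 E2 w2 where E: "end_of Q E1 {w1}" "end_of Q E2 {w2}" "E1 \<inter> E2 = {}" "w1 \<notin> E2" "w2 \<notin> E1"
    "conn A (Q - E1 - E2)" by (rule two_ends[OF islandD(4,1)[OF Q(1)] x])
  obtain d1 where d1: "\<And>x. x \<in> E1 \<Longrightarrow> deg Q x = d1" by (rule end_degree[OF Q E(1)]) blast
  obtain d2 where d2: "\<And>x. x \<in> E2 \<Longrightarrow> deg Q x = d2" by (rule end_degree[OF Q E(2)]) blast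
  interpret I: two_ended A L C V B Q E1 E2 w1 w2 d1 d2
    by unfold_locales (use Q E d1 d2 in auto)
  have E21: "Q - E2 - E1 = Q - E1 - E2" by blast
  interpret J: two_ended A L C V B Q E2 E1 w2 w1 d2 d1
    by unfold_locales (use Q E d1 d2 E21 in auto)
  obtain r1 where r1: "r1 \<in> E1" using conn_nonempty[OF end_ofD(1)[OF E(1)]] by blast
  obtain r2 where r2: "r2 \<in> E2" using conn_nonempty[OF end_ofD(1)[OF E(2)]] by blast
  have "settled Q \<or> pair_end E1 d1 \<or> triple_end E1 d1"
    by (rule end_cases[OF Q E(1) d1, of r2]) (use r2 E end_ofD(2)[OF E(2)] in auto)
  moreover have "settled Q \<or> pair_end E2 d2 \<or> triple_end E2 d2"
    by (rule end_cases[OF Q E(2) d2, of r1]) (use r1 E end_ofD(2)[OF E(1)] in auto)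
  ultimately show ?thesis
    using I.pair_pair I.pair_triple I.triple_triple J.pair_triple by blast
qed

end

section \<open>Colouring the big vertices\<close>

context truncated_cover begin

lemma saved_cong:
  assumes "saved Q X \<phi>" "\<And>x. x \<in> X \<Longrightarrow> \<phi>' x = \<phi> x" shows "saved Q X \<phi>'"
  using assms unfolding saved_def by simp

text \<open>The vertex v supplied by \<open>low\<close> is coloured last within D. An island is
  dealt with when the last member of its X is coloured, that is when v is in X and X is contained in
  D; later choices do not affect it, because being saved depends on X only. At most 15 colours are
  lost at v.\<close>

theorem assemble:
  assumes fin: "finite \<Q>" and X: "\<And>Q. Q \<in> \<Q> \<Longrightarrow> X Q \<noteq> {}" "\<And>Q. Q \<in> \<Q> \<Longrightarrow> X Q \<subseteq> B"
    and c: "\<And>Q v. Q \<in> \<Q> \<Longrightarrow> v \<in> X Q \<Longrightarrow> saver Q (X Q) v (c Q v)"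
    and low: "\<And>D. D \<subseteq> B \<Longrightarrow> D \<noteq> {} \<Longrightarrow>
      \<exists>v\<in>D. deg D v + (\<Sum>Q\<in>{Q\<in>\<Q>. v \<in> X Q \<and> X Q \<subseteq> D}. c Q v) \<le> 15"
  shows "\<exists>\<phi>. valued \<phi> \<and> proper B L \<phi> \<and> (\<forall>Q\<in>\<Q>. colourable Q (resid L \<phi> B))"
proof -
  have "\<exists>\<phi>. valued \<phi> \<and> proper D L \<phi> \<and> (\<forall>Q\<in>\<Q>. X Q \<subseteq> D \<longrightarrow> saved Q (X Q) \<phi>)" if "D \<subseteq> B" for D
    using that
  proof (induction "card D" arbitrary: D rule: less_induct)
    case less
    show ?case
    proof (cases "D = {}")
      case True
      have "L b \<noteq> {}" if "b \<in> B" for b using big[OF that] by auto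
      then have "valued (\<lambda>b. SOME \<alpha>. \<alpha> \<in> L b)" unfolding valued_def by (simp add: some_in_eq)
      then show ?thesis using True X(1) unfolding proper_def by auto
    next
      case False
      obtain v where v: "v \<in> D" "deg D v + (\<Sum>Q\<in>{Q\<in>\<Q>. v \<in> X Q \<and> X Q \<subseteq> D}. c Q v) \<le> 15"
        using low[OF less.prems False] by blast
      have fD: "finite D" using less.prems finB finite_subset by blast
      have vB: "v \<in> B" using v less.prems by blast
      let ?D = "D - {v}"
      have "card ?D < card D" by (rule card_Diff1_less[OF fD v(1)])
      then obtain \<phi> where \<phi>: "valued \<phi>" "proper ?D L \<phi>" "\<And>Q. Q \<in> \<Q> \<Longrightarrow> X Q \<subseteq> ?D \<Longrightarrow> saved Q (X Q) \<phi>"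
        using less.hyps[of ?D] less.prems by blast
      let ?\<Q> = "{Q\<in>\<Q>. v \<in> X Q \<and> X Q \<subseteq> D}"
      have "\<forall>Q\<in>?\<Q>. \<exists>F. finite F \<and> card F \<le> c Q v \<and> (\<forall>\<alpha>\<in>L v - F. saved Q (X Q) (\<phi>(v := \<alpha>)))"
        using c \<phi>(1) unfolding saver_def by blast
      from bchoice[OF this] obtain F where F': "\<forall>Q\<in>?\<Q>. finite (F Q) \<and> card (F Q) \<le> c Q v \<and>
        (\<forall>\<alpha>\<in>L v - F Q. saved Q (X Q) (\<phi>(v := \<alpha>)))" by (rule exE)
      then have F: "\<And>Q. Q \<in> ?\<Q> \<Longrightarrow> finite (F Q)" "\<And>Q. Q \<in> ?\<Q> \<Longrightarrow> card (F Q) \<le> c Q v"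
        "\<And>Q \<alpha>. Q \<in> ?\<Q> \<Longrightarrow> \<alpha> \<in> L v - F Q \<Longrightarrow> saved Q (X Q) (\<phi>(v := \<alpha>))" by blast+
      let ?R = "resid L \<phi> ?D v"
      have \<phi>L: "\<And>x. x \<in> ?D \<Longrightarrow> \<phi> x \<in> L x" using \<phi>(2) unfolding proper_def by blast
      have "card (L v) \<le> card ?R + deg ?D v" by (rule card_resid) (use fD \<phi>L in auto)
      moreover have "deg ?D v \<le> deg D v" by (rule card_nbrs_mono[OF fD]) blast
      moreover have "card (\<Union>Q\<in>?\<Q>. F Q) \<le> (\<Sum>Q\<in>?\<Q>. card (F Q))" by (rule card_UN_le) (use fin in simp)
      moreover have "(\<Sum>Q\<in>?\<Q>. card (F Q)) \<le> (\<Sum>Q\<in>?\<Q>. c Q v)" by (rule sum_mono) (rule F(2))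
      ultimately have lt: "card (\<Union>Q\<in>?\<Q>. F Q) < card ?R" using big[OF vB] v(2) by linarith
      have "finite (\<Union>Q\<in>?\<Q>. F Q)" using fin F(1) by simp
      then have "\<not> ?R \<subseteq> (\<Union>Q\<in>?\<Q>. F Q)" using lt card_mono by (meson not_le)
      then obtain \<alpha> where \<alpha>: "\<alpha> \<in> ?R" "\<alpha> \<notin> (\<Union>Q\<in>?\<Q>. F Q)" by blast
      have \<alpha>L: "\<alpha> \<in> L v" "\<And>x. x \<in> ?D \<Longrightarrow> (v, x) \<in> A \<Longrightarrow> (\<alpha>, \<phi> x) \<notin> C" using \<alpha>(1) unfolding resid_def by auto
      let ?\<phi> = "\<phi>(v := \<alpha>)"
      have "valued ?\<phi>" using \<phi>(1) \<alpha>L unfolding valued_def by simp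
      moreover have "proper D L ?\<phi>"
      proof -
        have "(\<phi> x, \<alpha>) \<notin> C" if "x \<in> ?D" "(x, v) \<in> A" for x
          using \<alpha>L(2)[OF that(1) arcD[OF that(2)]] conflictD by blast
        then show ?thesis using \<phi>(2) \<alpha>L v irreflA unfolding proper_def by auto
      qed
      moreover have "saved Q (X Q) ?\<phi>" if Q: "Q \<in> \<Q>" "X Q \<subseteq> D" for Q
      proof (cases "v \<in> X Q")
        case True
        then show ?thesis using F(3)[of Q \<alpha>] Q \<alpha>L(1) \<alpha>(2) by blast
      next
        case False
        then have "saved Q (X Q) \<phi>" using \<phi>(3)[OF Q(1)] Q(2) by blast
        then show ?thesis by (rule saved_cong) (use False in auto)
      qed
      ultimately show ?thesis by blast
    qed
  qed
  from this[of B] obtain \<phi> where \<phi>: "valued \<phi>" "proper B L \<phi>" "\<And>Q. Q \<in> \<Q> \<Longrightarrow> saved Q (X Q) \<phi>" using X(2) by blast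
  then have "colourable Q (resid L \<phi> B)" if "Q \<in> \<Q>" for Q using that unfolding saved_def by blast
  then show ?thesis using \<phi> by blast
qed

definition islands :: "'a set set" where
  "islands = component A (V - B) ` (V - B)"

lemma islands: "Q \<in> islands \<Longrightarrow> island Q"
  unfolding islands_def island_def
  using component_conn[of _ "V - B" A] component_subset[of A "V - B"] component_closed[OF symA, of _ "V - B"] by auto

lemma finite_islands: "finite islands" unfolding islands_def using finV by simp

lemma islands_disjoint:
  assumes "Q \<in> islands" "Q' \<in> islands" "Q \<noteq> Q'" shows "Q \<inter> Q' = {}"
proof (rule ccontr)
  assume "Q \<inter> Q' \<noteq> {}"
  then obtain x where x: "x \<in> Q" "x \<in> Q'" by blast
  obtain y y' where y: "y \<in> V - B" "y' \<in> V - B" "Q = component A (V - B) y" "Q' = component A (V - B) y'"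
    using assms unfolding islands_def by blast
  show False using component_eq[OF symA y(1), of x] component_eq[OF symA y(2), of x] x y assms(3) by simp
qed

lemma colour_islands:
  assumes \<phi>: "proper B L \<phi>" and Q: "\<And>Q. Q \<in> islands \<Longrightarrow> colourable Q (resid L \<phi> B)"
  shows "\<exists>\<phi>. proper V L \<phi>"
proof -
  from Q obtain \<theta> where \<theta>: "\<And>Q. Q \<in> islands \<Longrightarrow> proper Q (resid L \<phi> B) (\<theta> Q)" unfolding colourable_def by metis
  let ?K = "component A (V - B)"
  let ?\<theta> = "\<lambda>x. \<theta> (?K x) x"
  have K: "?K x \<in> islands" "x \<in> ?K x" if "x \<in> V - B" for x
    using that component_self[OF that, of A] unfolding islands_def by blast+
  have "proper (V - B) (resid L \<phi> B) ?\<theta>"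
    unfolding proper_def
  proof (intro conjI ballI impI)
    fix x assume x: "x \<in> V - B"
    show "?\<theta> x \<in> resid L \<phi> B x" using \<theta>[OF K(1)[OF x]] K(2)[OF x] unfolding proper_def by blast
    fix y assume y: "y \<in> V - B" "(x, y) \<in> A"
    have yx: "y \<in> ?K x" using component_closed[OF symA x] K(2)[OF x] y unfolding touch_def by blast
    then have "?K y = ?K x" by (rule component_eq[OF symA x])
    then show "(?\<theta> x, ?\<theta> y) \<notin> C" using \<theta>[OF K(1)[OF x]] K(2)[OF x] yx y(2) unfolding proper_def by simp
  qed
  from proper_extend[OF \<phi> this] have "proper (B \<union> (V - B)) L (\<lambda>x. if x \<in> B then \<phi> x else ?\<theta> x)" by blast
  moreover have "B \<union> (V - B) = V" using BV by blast
  ultimately show ?thesis by auto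
qed

section \<open>Cases by the number of big vertices\<close>

lemma conn_minus:
  assumes T: "T \<subseteq> V" "card T \<le> 2" and 4: "4 \<le> card V"
  shows "conn A (V - T)"
  unfolding conn_def
proof (intro conjI allI impI)
  have fT: "finite T" using T(1) finV finite_subset by blast
  show "V - T \<noteq> {}"
  proof
    assume "V - T = {}"
    then have "card V \<le> card T" by (intro card_mono[OF fT]) blast
    then show False using T 4 by simp
  qed
  fix S assume S: "S \<subseteq> V - T \<and> S \<noteq> {} \<and> S \<noteq> V - T"
  show "touch A S (V - T - S)"
  proof (rule ccontr)
    assume n: "\<not> touch A S (V - T - S)"
    have b: "bound A S \<subseteq> T" using n bound_V[of S] unfolding bound_def touch_def by blast
    have "3 \<le> card (bound A S)" by (rule three) (use S b in auto)
    then show False using card_mono[OF fT b] T(2) by simp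
  qed
qed

text \<open>V is then its own end. Bad lists would make all degrees equal and, these being at least
  3 by 3-connectivity, the graph complete.\<close>

lemma colourable_no_big:
  assumes "B = {}" and 4: "4 \<le> card V" and nc: "u \<in> V" "v \<in> V" "u \<noteq> v" "(u, v) \<notin> A"
  shows "colourable V L"
proof (rule ccontr)
  assume n: "\<not> colourable V L"
  have bad: "badlist V L" using n small assms(1) unfolding badlist_def sublists_def by simp
  have V: "conn A V" using conn_minus[of "{}"] 4 by simp
  have noncut: "noncut V x" if "x \<in> V" for x
    using conn_minus[of "{x}"] 4 that unfolding noncut_def by simp
  have E: "end_of V V {}" by (rule end_of_whole[OF V noncut])
  let ?T = "{x \<in> V. deg V x = deg V u}"
  have eq: "?T = V"
  proof (rule ccontr)
    assume ne: "?T \<noteq> V"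
    have "touch A ?T (V - ?T)" by (rule connD[OF V]) (use ne nc in auto)
    then obtain x y where "x \<in> ?T" "y \<in> V - ?T" "(x, y) \<in> A" unfolding touch_def by blast
    then show False using badlist_deg_eq[OF bad finV V, of x y] noncut by auto
  qed
  have "bound A {u} = nbrs A V u" using AV irreflA unfolding bound_def nbrs_def touch_def by auto
  moreover have "v \<in> V - {u} - bound A {u}" using nc unfolding bound_def by auto
  ultimately have d3: "3 \<le> deg V u" using three[of "{u}"] nc by auto
  have "(u, v) \<in> A" by (rule end_clique[OF bad finV V E _ d3 nc(1-3)]) (use eq in blast)
  then show False using nc by blast
qed

text \<open>At most two big vertices leave a single island, which has too few neighbours for
  \<open>island_settled\<close>. Every big vertex saves it at cost 5, and 2 + 5 \<le> 15.\<close>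

lemma colourable_few_big:
  assumes B: "B \<noteq> {}" "card B \<le> 2" and 4: "4 \<le> card V"
  shows "\<exists>\<phi>. proper V L \<phi>"
proof -
  let ?Q = "V - B"
  have Q: "conn A ?Q" by (rule conn_minus[OF BV B(2) 4])
  have isl: "island ?Q" unfolding island_def touch_def using Q by blast
  obtain y where y: "y \<in> ?Q" using conn_nonempty[OF Q] by blast
  have nb: "nbB ?Q = B"
  proof
    show "B \<subseteq> nbB ?Q"
    proof
      fix b assume b: "b \<in> B"
      have "conn A (insert b ?Q)"
      proof -
        have "card (B - {b}) \<le> 2" using B(2) card_Diff1_le[of B b] by linarith
        then have "conn A (V - (B - {b}))" using BV by (intro conn_minus[OF _ _ 4]) auto
        moreover have "V - (B - {b}) = insert b ?Q" using b BV by blast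
        ultimately show ?thesis by simp
      qed
      then have "touch A {b} (insert b ?Q - {b})" by (rule connD) (use b y in auto)
      then show "b \<in> nbB ?Q" using b arcD unfolding nbB_iff touch_def by blast
    qed
  qed (rule nbB_subset)
  have "\<exists>\<phi>. valued \<phi> \<and> proper B L \<phi> \<and> (\<forall>Q\<in>{?Q}. colourable Q (resid L \<phi> B))"
  proof (rule assemble[of "{?Q}" "\<lambda>_. B" "\<lambda>_ _. 5"])
    show "saver Q B v 5" if "Q \<in> {?Q}" "v \<in> B" for Q v
      using saver_five[OF isl, unfolded nb] that by simp
    show "\<exists>v\<in>D. deg D v + (\<Sum>Q\<in>{Q\<in>{?Q}. v \<in> B \<and> B \<subseteq> D}. 5) \<le> 15" if D: "D \<subseteq> B" "D \<noteq> {}" for D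
    proof -
      obtain v where v: "v \<in> D" using D by blast
      have fD: "finite D" using D finB finite_subset by blast
      have "deg D v \<le> card D" by (rule card_mono[OF fD nbrs_subset])
      also have "\<dots> \<le> card B" by (rule card_mono[OF finB D(1)])
      finally have "deg D v \<le> 2" using B(2) by simp
      moreover have "(\<Sum>Q\<in>{Q\<in>{?Q}. v \<in> B \<and> B \<subseteq> D}. 5) \<le> (\<Sum>Q\<in>{?Q}. (5::nat))" by (rule sum_mono2) auto
      ultimately show ?thesis using v by (intro bexI[of _ v]) auto
    qed
  qed (use B in auto)
  then obtain \<phi> where \<phi>: "proper B L \<phi>" "colourable ?Q (resid L \<phi> B)" by blast
  have "islands = {?Q}"
  proof -
    have "component A ?Q x = ?Q" if "x \<in> ?Q" for x
      using component_max[OF Q order_refl that] component_subset[of A ?Q x] by blast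
    then show ?thesis unfolding islands_def using y by auto
  qed
  then show ?thesis using colour_islands[OF \<phi>(1)] \<phi>(2) by simp
qed

lemma settled_byD:
  assumes s: "settled_by Q \<P>" and P: "(P, N) \<in> \<P>"
  shows "conn A P" "P \<subseteq> Q" "N \<subseteq> B" "2 \<le> card N" "\<And>n. n \<in> N \<Longrightarrow> touch A P {n}"
    "card N = 2 \<Longrightarrow> \<exists>a b. N = {a, b} \<and> a \<noteq> b \<and> separates A P a b"
proof -
  have "\<forall>P N. (P, N) \<in> \<P> \<longrightarrow> conn A P \<and> P \<subseteq> Q \<and> N \<subseteq> B \<and> 2 \<le> card N \<and> (\<forall>n\<in>N. touch A P {n}) \<and>
        (card N = 2 \<longrightarrow> (\<exists>a b. N = {a, b} \<and> a \<noteq> b \<and> separates A P a b))"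
    using s unfolding settled_by_def by (elim conjE)
  from this[rule_format, OF P] show "conn A P" "P \<subseteq> Q" "N \<subseteq> B" "2 \<le> card N" "\<And>n. n \<in> N \<Longrightarrow> touch A P {n}"
    "card N = 2 \<Longrightarrow> \<exists>a b. N = {a, b} \<and> a \<noteq> b \<and> separates A P a b" by auto
qed

lemma colourable_many_big:
  assumes B3: "3 \<le> card B"
  shows "\<exists>\<phi>. proper V L \<phi>"
proof -
  \<comment> \<open>An island that is not bad can be completed after any colouring of B, so only bad
    islands receive units.\<close>
  define \<Q> where "\<Q> = {Q \<in> islands. bad Q}"
  have fin\<Q>: "finite \<Q>" unfolding \<Q>_def using finite_islands by simp
  have isl: "island Q" if "Q \<in> \<Q>" for Q using islands that unfolding \<Q>_def by blast
  have dj\<Q>: "Q \<inter> Q' = {}" if "Q \<in> \<Q>" "Q' \<in> \<Q>" "Q \<noteq> Q'" for Q Q'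
    using islands_disjoint that unfolding \<Q>_def by blast
  have "\<exists>\<P>. settled_by Q \<P>" if Q: "Q \<in> \<Q>" for Q
  proof -
    have b: "bound A Q = nbB Q"
    proof
      show "bound A Q \<subseteq> nbB Q" using island_nbr(2)[OF isl[OF Q]] unfolding bound_def touch_def by blast
      show "nbB Q \<subseteq> bound A Q" using islandD(3)[OF isl[OF Q]] unfolding bound_def nbB_def by blast
    qed
    \<comment> \<open>\<open>three\<close> asks for a vertex beyond Q and its boundary. If there is
      none, the boundary is all of B, which has at least three elements.\<close>
    have "3 \<le> card (nbB Q)"
    proof (cases "nbB Q = B")
      case False
      then have "V - Q - bound A Q \<noteq> {}" using b nbB_subset[of Q] BV islandD(3)[OF isl[OF Q]] by blast
      then show ?thesis using three[of Q] islandD(1,2)[OF isl[OF Q]] conn_nonempty b by metis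
    qed (use B3 in simp)
    then have "settled Q" using island_settled[OF isl[OF Q]] Q unfolding \<Q>_def by blast
    then show ?thesis unfolding settled_def .
  qed
  then obtain \<P> where s: "\<And>Q. Q \<in> \<Q> \<Longrightarrow> settled_by Q (\<P> Q)" by metis
  have pc: "conn A P" "P \<subseteq> Q" "N \<subseteq> B" "2 \<le> card N" "\<And>n. n \<in> N \<Longrightarrow> touch A P {n}"
    "card N = 2 \<Longrightarrow> \<exists>a b. N = {a, b} \<and> a \<noteq> b \<and> separates A P a b" if "Q \<in> \<Q>" "(P, N) \<in> \<P> Q" for Q P N
    by (rule settled_byD[OF s[OF that(1)] that(2)], assumption?)+
  have finP: "finite (\<P> Q)" if "Q \<in> \<Q>" for Q using s[OF that] unfolding settled_by_def by blast
  have djP: "fst p \<inter> fst q = {}" if "Q \<in> \<Q>" "p \<in> \<P> Q" "q \<in> \<P> Q" "p \<noteq> q" for Q p q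
    using s[OF that(1)] that(2-) unfolding settled_by_def by blast
  define \<P>' where "\<P>' = (\<Union>Q\<in>\<Q>. \<P> Q)"
  have finP': "finite \<P>'" unfolding \<P>'_def using fin\<Q> finP by blast
  have same: "Q = Q'" if "p \<in> \<P> Q" "q \<in> \<P> Q'" "Q \<in> \<Q>" "Q' \<in> \<Q>" "fst p \<inter> fst q \<noteq> {}" for p q Q Q'
  proof (rule ccontr)
    assume "Q \<noteq> Q'"
    then have "Q \<inter> Q' = {}" using dj\<Q> that by blast
    moreover have "fst p \<subseteq> Q" "fst q \<subseteq> Q'" using pc(2)[of _ "fst p" "snd p"] pc(2)[of _ "fst q" "snd q"] that by auto
    ultimately show False using that(5) by blast
  qed
  have djP': "fst p \<inter> fst q = {}" if pq: "p \<in> \<P>'" "q \<in> \<P>'" "p \<noteq> q" for p q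
  proof (rule ccontr)
    assume n: "fst p \<inter> fst q \<noteq> {}"
    obtain Q Q' where Q: "Q \<in> \<Q>" "p \<in> \<P> Q" "Q' \<in> \<Q>" "q \<in> \<P> Q'" using pq(1,2) unfolding \<P>'_def by blast
    then have "Q = Q'" using same n by blast
    then show False using djP[OF Q(1,2)] Q(4) pq(3) n by blast
  qed
  have dPP: "\<P> Q \<inter> \<P> Q' = {}" if "Q \<in> \<Q>" "Q' \<in> \<Q>" "Q \<noteq> Q'" for Q Q'
  proof (rule ccontr)
    assume "\<P> Q \<inter> \<P> Q' \<noteq> {}"
    then obtain p where p: "p \<in> \<P> Q" "p \<in> \<P> Q'" by blast
    have "fst p \<noteq> {}" using pc(1)[of Q "fst p" "snd p"] that p conn_nonempty by auto
    then show False using same[OF p that(1,2)] that(3) by simp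
  qed
  have count: "(\<Sum>p\<in>{p\<in>\<P>'. snd p \<subseteq> X}. unit_weight (snd p)) + 2 \<le> 2 * card X" if X: "X \<subseteq> B" "X \<noteq> {}" for X
  proof (rule unit_count[OF symA free finB finP' _ _ djP' X])
    fix P N assume PN: "(P, N) \<in> \<P>'"
    then obtain Q where Q: "Q \<in> \<Q>" "(P, N) \<in> \<P> Q" unfolding \<P>'_def by blast
    have "P \<inter> B = {}" using pc(2)[OF Q] islandD(3)[OF isl[OF Q(1)]] by blast
    then show "conn A P \<and> P \<inter> B = {} \<and> N \<subseteq> B \<and> 2 \<le> card N \<and> (\<forall>n\<in>N. touch A P {n})" using pc(1,3-5)[OF Q] by blast
    show "\<exists>a b. N = {a, b} \<and> a \<noteq> b \<and> separates A P a b" if "card N = 2" by (rule pc(6)[OF Q that])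
  qed
  \<comment> \<open>The units are listed one by one, so that Hall's theorem with capacity 2 can
    place them; \<open>count\<close> provides its condition.\<close>
  define I where "I = Sigma \<P>' (\<lambda>p. {..<unit_weight (snd p)})"
  have finI: "finite I" unfolding I_def using finP' by simp
  have sndB: "snd p \<subseteq> B" "snd p \<noteq> {}" if p: "p \<in> \<P>'" for p
  proof -
    obtain Q where Q: "Q \<in> \<Q>" "(fst p, snd p) \<in> \<P> Q" using p unfolding \<P>'_def by auto
    show "snd p \<subseteq> B" by (rule pc(3)[OF Q])
    show "snd p \<noteq> {}" using pc(4)[OF Q] by auto
  qed
  have "\<exists>u. (\<forall>i\<in>I. u i \<in> snd (fst i)) \<and> (\<forall>b. card {i\<in>I. u i = b} \<le> 2)"
  proof (rule hall_capacity[OF finI])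
    show "finite (snd (fst i))" if "i \<in> I" for i
      using sndB(1)[of "fst i"] that finB finite_subset unfolding I_def by auto
    fix J assume J: "J \<subseteq> I"
    let ?X = "\<Union>i\<in>J. snd (fst i)"
    show "card J \<le> (\<Sum>b\<in>?X. 2)"
    proof (cases "J = {}")
      case False
      have XB: "?X \<subseteq> B" using J sndB(1) unfolding I_def by fastforce
      have Xne: "?X \<noteq> {}" using False J sndB(2) unfolding I_def by fastforce
      let ?S = "{p\<in>\<P>'. snd p \<subseteq> ?X}"
      have "J \<subseteq> Sigma ?S (\<lambda>p. {..<unit_weight (snd p)})"
      proof
        fix i assume i: "i \<in> J"
        obtain p j where pj: "i = (p, j)" by (cases i)
        then have "p \<in> \<P>'" "j < unit_weight (snd p)" using i J unfolding I_def by auto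
        moreover have "snd p \<subseteq> ?X" using i pj by force
        ultimately show "i \<in> Sigma ?S (\<lambda>p. {..<unit_weight (snd p)})" unfolding pj by blast
      qed
      then have "card J \<le> card (Sigma ?S (\<lambda>p. {..<unit_weight (snd p)}))"
        by (rule card_mono[rotated]) (use finP' in simp)
      also have "\<dots> = (\<Sum>p\<in>?S. unit_weight (snd p))" using finP' by simp
      also have "\<dots> \<le> 2 * card ?X" using count[OF XB Xne] by simp
      finally show ?thesis by simp
    qed simp
  qed
  then obtain u where u: "\<And>i. i \<in> I \<Longrightarrow> u i \<in> snd (fst i)" "\<And>b. card {i\<in>I. u i = b} \<le> 2" by blast
  \<comment> \<open>This is the distribution of units against which \<open>settled_by\<close>
    promises a set X.\<close>
  define m where "m p b = card {j\<in>{..<unit_weight (snd p)}. u (p, j) = b}" for p b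
  have m1: "sum (m p) (snd p) = unit_weight (snd p)" if p: "p \<in> \<P>'" for p
  proof -
    have f: "finite (snd p)" using sndB(1)[OF p] finB finite_subset by blast
    have "sum (m p) (snd p) = card (\<Union>b\<in>snd p. {j\<in>{..<unit_weight (snd p)}. u (p, j) = b})"
      unfolding m_def by (rule card_UN_disjoint[symmetric]) (use f in auto)
    also have "(\<Union>b\<in>snd p. {j\<in>{..<unit_weight (snd p)}. u (p, j) = b}) = {..<unit_weight (snd p)}"
      using u(1)[of "(p, _)"] p unfolding I_def by auto
    finally show ?thesis by simp
  qed
  have m2: "(\<Sum>p\<in>\<P>'. m p b) \<le> 2" for b
  proof -
    have "{i\<in>I. u i = b} = Sigma \<P>' (\<lambda>p. {j\<in>{..<unit_weight (snd p)}. u (p, j) = b})" unfolding I_def by auto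
    then have "card {i\<in>I. u i = b} = (\<Sum>p\<in>\<P>'. m p b)" unfolding m_def using finP' by simp
    then show ?thesis using u(2)[of b] by simp
  qed
  have "\<exists>X c. X \<noteq> {} \<and> X \<subseteq> B \<and> (\<forall>v\<in>X. saver Q X v (c v)) \<and> sum c X \<le> 5 * (\<Sum>v\<in>X. \<Sum>p\<in>\<P> Q. m p v)" if Q: "Q \<in> \<Q>" for Q
  proof -
    have "\<forall>p\<in>\<P> Q. sum (m p) (snd p) = unit_weight (snd p)" using m1 Q unfolding \<P>'_def by blast
    then show ?thesis using s[OF Q] unfolding settled_by_def by blast
  qed
  then obtain X c where X: "\<And>Q. Q \<in> \<Q> \<Longrightarrow> X Q \<noteq> {}" "\<And>Q. Q \<in> \<Q> \<Longrightarrow> X Q \<subseteq> B"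
    "\<And>Q v. Q \<in> \<Q> \<Longrightarrow> v \<in> X Q \<Longrightarrow> saver Q (X Q) v (c Q v)"
    "\<And>Q. Q \<in> \<Q> \<Longrightarrow> sum (c Q) (X Q) \<le> 5 * (\<Sum>v\<in>X Q. \<Sum>p\<in>\<P> Q. m p v)" by metis
  have "\<exists>\<phi>. valued \<phi> \<and> proper B L \<phi> \<and> (\<forall>Q\<in>\<Q>. colourable Q (resid L \<phi> B))"
  proof (rule assemble[OF fin\<Q> X(1-3)])
    fix D assume D: "D \<subseteq> B" "D \<noteq> {}"
    have fD: "finite D" using D finB finite_subset by blast
    let ?S = "{Q\<in>\<Q>. X Q \<subseteq> D}"
    let ?l = "\<lambda>v. deg D v + (\<Sum>Q\<in>{Q\<in>\<Q>. v \<in> X Q \<and> X Q \<subseteq> D}. c Q v)"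
    have "(\<Sum>v\<in>D. \<Sum>Q\<in>{Q\<in>\<Q>. v \<in> X Q \<and> X Q \<subseteq> D}. c Q v) = (\<Sum>v\<in>D. \<Sum>Q\<in>?S. if v \<in> X Q then c Q v else 0)"
    proof (rule sum.cong[OF refl])
      fix v
      have "{Q\<in>\<Q>. v \<in> X Q \<and> X Q \<subseteq> D} = {Q\<in>?S. v \<in> X Q}" by blast
      then show "(\<Sum>Q\<in>{Q\<in>\<Q>. v \<in> X Q \<and> X Q \<subseteq> D}. c Q v) = (\<Sum>Q\<in>?S. if v \<in> X Q then c Q v else 0)"
        using sum.inter_filter[of ?S "\<lambda>Q. c Q v" "\<lambda>Q. v \<in> X Q"] fin\<Q> by simp
    qed
    also have "\<dots> = (\<Sum>Q\<in>?S. \<Sum>v\<in>D. if v \<in> X Q then c Q v else 0)" by (rule sum.swap)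
    also have "\<dots> = (\<Sum>Q\<in>?S. sum (c Q) (X Q))"
    proof (rule sum.cong[OF refl])
      fix Q assume "Q \<in> ?S"
      then have "X Q = {v\<in>D. v \<in> X Q}" by blast
      then show "(\<Sum>v\<in>D. if v \<in> X Q then c Q v else 0) = sum (c Q) (X Q)"
        using sum.inter_filter[OF fD, of "c Q" "\<lambda>v. v \<in> X Q"] by simp
    qed
    also have "\<dots> \<le> (\<Sum>Q\<in>?S. 5 * (\<Sum>v\<in>D. \<Sum>p\<in>\<P> Q. m p v))"
    proof (rule sum_mono)
      fix Q assume Q: "Q \<in> ?S"
      have "(\<Sum>v\<in>X Q. \<Sum>p\<in>\<P> Q. m p v) \<le> (\<Sum>v\<in>D. \<Sum>p\<in>\<P> Q. m p v)" by (rule sum_mono2[OF fD]) (use Q in auto)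
      then show "sum (c Q) (X Q) \<le> 5 * (\<Sum>v\<in>D. \<Sum>p\<in>\<P> Q. m p v)" using X(4)[of Q] Q by simp
    qed
    also have "\<dots> = 5 * (\<Sum>Q\<in>?S. \<Sum>v\<in>D. \<Sum>p\<in>\<P> Q. m p v)" by (rule sum_distrib_left[symmetric])
    also have "(\<Sum>Q\<in>?S. \<Sum>v\<in>D. \<Sum>p\<in>\<P> Q. m p v) = (\<Sum>v\<in>D. \<Sum>Q\<in>?S. \<Sum>p\<in>\<P> Q. m p v)" by (rule sum.swap)
    also have "(\<Sum>v\<in>D. \<Sum>Q\<in>?S. \<Sum>p\<in>\<P> Q. m p v) \<le> (\<Sum>v\<in>D. 2)"
    proof (rule sum_mono)
      fix v
      have "(\<Sum>Q\<in>?S. \<Sum>p\<in>\<P> Q. m p v) = (\<Sum>p\<in>(\<Union>Q\<in>?S. \<P> Q). m p v)"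
        by (rule sum.UNION_disjoint[symmetric]) (use fin\<Q> finP dPP in auto)
      also have "\<dots> \<le> (\<Sum>p\<in>\<P>'. m p v)" by (rule sum_mono2[OF finP']) (auto simp: \<P>'_def)
      finally show "(\<Sum>Q\<in>?S. \<Sum>p\<in>\<P> Q. m p v) \<le> 2" using m2[of v] by simp
    qed
    finally have c10: "(\<Sum>v\<in>D. \<Sum>Q\<in>{Q\<in>\<Q>. v \<in> X Q \<and> X Q \<subseteq> D}. c Q v) \<le> 10 * card D" by simp
    have n1: "1 \<le> card D" using D fD by (simp add: Suc_leI card_gt_0_iff)
    have d6: "(\<Sum>v\<in>D. deg D v) < 6 * card D"
    proof (cases "card D = 1")
      case True
      then obtain v where "D = {v}" by (rule card_1_singletonE)
      moreover have "nbrs A {v} v = {}" using irreflA unfolding nbrs_def by blast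
      ultimately show ?thesis by simp
    next
      case False
      then show ?thesis using sum_degree_le[OF fD symA irrA free] n1 by simp
    qed
    \<comment> \<open>The islands account for at most 10 per vertex of D and the edges inside D for
      less than 6.\<close>
    have total: "(\<Sum>v\<in>D. ?l v) < (\<Sum>v\<in>D. 16)" using c10 d6 by (simp add: sum.distrib)
    show "\<exists>v\<in>D. ?l v \<le> 15"
    proof (rule ccontr)
      assume "\<not> ?thesis"
      then have "16 \<le> ?l v" if "v \<in> D" for v using that by force
      then have "(\<Sum>v\<in>D. 16) \<le> (\<Sum>v\<in>D. ?l v)" by (rule sum_mono)
      then show False using total by simp
    qed
  qed
  then obtain \<phi> where \<phi>: "valued \<phi>" "proper B L \<phi>" "\<And>Q. Q \<in> \<Q> \<Longrightarrow> colourable Q (resid L \<phi> B)" by blast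
  show ?thesis
  proof (rule colour_islands[OF \<phi>(2)])
    fix Q assume Q: "Q \<in> islands"
    show "colourable Q (resid L \<phi> B)"
      using \<phi>(3)[of Q] island_colourable[OF islands[OF Q] \<phi>(1)] Q unfolding \<Q>_def by blast
  qed
qed

theorem colourable_all:
  assumes 4: "4 \<le> card V" and nc: "u \<in> V" "v \<in> V" "u \<noteq> v" "(u, v) \<notin> A"
  shows "\<exists>\<phi>. proper V L \<phi>"
proof -
  consider "B = {}" | "B \<noteq> {}" "card B \<le> 2" | "3 \<le> card B" by linarith
  then show ?thesis
  proof cases
    case 1 then show ?thesis using colourable_no_big[OF _ 4 nc] unfolding colourable_def by blast
  next
    case 2 then show ?thesis using colourable_few_big 4 by blast
  next
    case 3 then show ?thesis by (rule colourable_many_big)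
  qed
qed

end

section \<open>Plane drawings have no K33 model\<close>

fun pedges :: "'a list \<Rightarrow> ('a \<times> 'a) set" where
  "pedges (x # y # zs) = insert (x, y) (insert (y, x) (pedges (y # zs)))"
| "pedges _ = {}"

lemma pedges_subset: "pedges vs \<subseteq> set vs \<times> set vs"
  by (induction vs rule: pedges.induct) auto

lemma sym_pedges: "sym (pedges vs)"
  by (induction vs rule: pedges.induct) (auto simp: sym_def)

lemma pedges_append:
  "xs \<noteq> [] \<Longrightarrow> ys \<noteq> [] \<Longrightarrow>
    pedges (xs @ ys) = pedges xs \<union> pedges ys \<union> {(last xs, hd ys), (hd ys, last xs)}"
proof (induction xs rule: pedges.induct)
  case (1 x y zs) then show ?case by auto
next
  case ("2_2" v) then show ?case by (cases ys) auto
qed simp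

lemma pedges_rev: "pedges (rev vs) = pedges vs"
proof (induction vs rule: pedges.induct)
  case (1 x y zs)
  have "pedges (rev (x # y # zs)) = pedges (rev (y # zs) @ [x])" by simp
  also have "\<dots> = pedges (rev (y # zs)) \<union> {(y, x), (x, y)}" by (subst pedges_append) auto
  finally show ?case using 1 by auto
qed auto

lemma pedges_ends: "distinct (x # zs @ [y]) \<Longrightarrow> zs \<noteq> [] \<Longrightarrow> (x, y) \<notin> pedges (x # zs @ [y])"
proof
  assume d: "distinct (x # zs @ [y])" "zs \<noteq> []" "(x, y) \<in> pedges (x # zs @ [y])"
  obtain z ws where zs: "zs = z # ws" using d(2) by (cases zs) auto
  have "(x, y) \<in> pedges (z # ws @ [y])" using d zs by auto
  then show False using d(1) zs pedges_subset[of "z # ws @ [y]"] by auto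
qed

definition path_in :: "('a \<times> 'a) set \<Rightarrow> 'a set \<Rightarrow> 'a list \<Rightarrow> bool" where
  "path_in A X vs \<longleftrightarrow> vs \<noteq> [] \<and> distinct vs \<and> set vs \<subseteq> X \<and> pedges vs \<subseteq> A"

lemma conn_path:
  assumes A: "sym A" and X: "conn A X" and xy: "x \<in> X" "y \<in> X"
  shows "\<exists>vs. path_in A X vs \<and> hd vs = x \<and> last vs = y"
proof -
  let ?T = "{y \<in> X. \<exists>vs. path_in A X vs \<and> hd vs = x \<and> last vs = y}"
  have "path_in A X [x]" using xy unfolding path_in_def by simp
  then have xT: "x \<in> ?T" using xy by force
  have "?T = X"
  proof (rule ccontr)
    assume "?T \<noteq> X"
    then have "touch A ?T (X - ?T)" by (intro connD[OF X]) (use xT in auto)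
    then obtain u v where uv: "u \<in> ?T" "v \<in> X - ?T" "(u, v) \<in> A" unfolding touch_def by blast
    then obtain vs where vs: "path_in A X vs" "hd vs = x" "last vs = u" by blast
    have "\<exists>ws. path_in A X ws \<and> hd ws = x \<and> last ws = v"
    proof (cases "v \<in> set vs")
      case True
      then obtain us ws where e: "vs = us @ v # ws" by (meson split_list)
      have "path_in A X (us @ [v])"
      proof -
        have "pedges (us @ [v]) \<subseteq> pedges vs"
        proof (cases "ws = []")
          case False
          then have "pedges vs = pedges (us @ [v]) \<union> pedges ws \<union> {(last (us @ [v]), hd ws), (hd ws, last (us @ [v]))}"
            unfolding e by (subst pedges_append[symmetric]) auto
          then show ?thesis by blast
        qed (simp add: e)
        then show ?thesis using vs(1) unfolding path_in_def e by auto
      qed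
      moreover have "hd (us @ [v]) = x" using vs(2) e by (cases us) auto
      ultimately show ?thesis by (intro exI[of _ "us @ [v]"]) simp
    next
      case False
      have ne: "vs \<noteq> []" using vs(1) unfolding path_in_def by simp
      have "pedges (vs @ [v]) \<subseteq> A"
        using vs uv(3) symD[OF A uv(3)] pedges_append[OF ne, of "[v]"] unfolding path_in_def by auto
      then have "path_in A X (vs @ [v])" using vs(1) False uv(2) unfolding path_in_def by auto
      then show ?thesis using vs(2) ne by (intro exI[of _ "vs @ [v]"]) simp
    qed
    then show False using uv by blast
  qed
  then show ?thesis using xy by blast
qed

text \<open>Replaces a branch set X with three contacts by a path joining two of them and a
  connected set H that leads from a vertex a of the path to the third contact Z. H is the component
  of Z after deletion of the path; it touches the path because X with Z is connected.\<close>

lemma tripod: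
  assumes A: "sym A" and X: "conn A X" and Z: "conn A Z" "X \<inter> Z = {}" "touch A X Z" and xy: "x \<in> X" "y \<in> X"
  obtains vs a H where "path_in A X vs" "hd vs = x" "last vs = y" "a \<in> set vs"
    "conn A H" "Z \<subseteq> H" "H \<subseteq> X \<union> Z - set vs" "touch A {a} H"
proof -
  obtain vs where vs: "path_in A X vs" "hd vs = x" "last vs = y" using conn_path[OF A X xy] by blast
  have vsX: "set vs \<subseteq> X" "vs \<noteq> []" using vs(1) unfolding path_in_def by auto
  have XZ: "conn A (X \<union> Z)" by (rule conn_Un[OF A X Z(1)]) (use Z(3) in blast)
  obtain z where z: "z \<in> Z" using conn_nonempty[OF Z(1)] by blast
  let ?S = "X \<union> Z - set vs"
  have zS: "z \<in> ?S" using z Z(2) vsX by blast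
  let ?H = "component A ?S z"
  have H: "conn A ?H" "?H \<subseteq> ?S" "\<not> touch A ?H (?S - ?H)" "z \<in> ?H"
    using component_conn[OF zS, of A] component_subset[of A ?S z] component_closed[OF A zS] component_self[OF zS, of A] by auto
  have "Z \<subseteq> ?H" by (rule component_max[OF Z(1) _ z]) (use Z(2) vsX in blast)
  have "touch A ?H (X \<union> Z - ?H)"
  proof (rule connD[OF XZ])
    have "hd vs \<in> X" "hd vs \<notin> ?H" using vsX H(2) hd_in_set[OF vsX(2)] by blast+
    then show "?H \<noteq> X \<union> Z" by blast
  qed (use H in auto)
  then obtain h a where ha: "h \<in> ?H" "a \<in> X \<union> Z - ?H" "(h, a) \<in> A" unfolding touch_def by blast
  then have "a \<in> set vs" using H(3) unfolding touch_def by blast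
  moreover have "touch A {a} ?H" using ha symD[OF A] unfolding touch_def by blast
  ultimately show ?thesis using that[of vs a ?H] vs H \<open>Z \<subseteq> ?H\<close> by blast
qed

lemma conn_restrict:
  assumes S: "conn A S" and R: "A \<inter> S \<times> S \<subseteq> R" shows "conn R S"
  unfolding conn_def
proof (intro conjI allI impI)
  show "S \<noteq> {}" using S by (rule conn_nonempty)
  fix T assume T: "T \<subseteq> S \<and> T \<noteq> {} \<and> T \<noteq> S"
  then have "touch A T (S - T)" using connD[OF S] by blast
  then show "touch R T (S - T)" using T R unfolding touch_def by blast
qed

section \<open>Plane drawings as point sets\<close>

locale drawing =
  fixes V :: "'a set" and A :: "('a \<times> 'a) set" and p :: "'a \<Rightarrow> complex" and c :: "'a set \<Rightarrow> real \<Rightarrow> complex"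
  assumes finV: "finite V" and AV: "A \<subseteq> V \<times> V" and symA: "sym A" and irreflA: "(x, x) \<notin> A"
    and inj: "inj_on p V"
    and arcs: "(u, v) \<in> A \<Longrightarrow> arc (c {u, v})"
    and ends: "(u, v) \<in> A \<Longrightarrow> {pathstart (c {u, v}), pathfinish (c {u, v})} = {p u, p v}"
    and verts: "(u, v) \<in> A \<Longrightarrow> path_image (c {u, v}) \<inter> p ` V = {p u, p v}"
    and cross: "(u, v) \<in> A \<Longrightarrow> (u', v') \<in> A \<Longrightarrow> {u, v} \<noteq> {u', v'} \<Longrightarrow>
      path_image (c {u, v}) \<inter> path_image (c {u', v'}) = p ` ({u, v} \<inter> {u', v'})"
begin

definition drawn :: "'a set \<Rightarrow> ('a \<times> 'a) set \<Rightarrow> complex set" where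
  "drawn S R = p ` S \<union> (\<Union>(u, v)\<in>R. path_image (c {u, v}))"

lemma finA: "finite A" using finV AV finite_subset by blast

lemma drawn_compact:
  assumes "S \<subseteq> V" "R \<subseteq> A" shows "compact (drawn S R)"
proof -
  have "finite R" "finite S" using assms finA finV finite_subset by blast+
  moreover have "compact (path_image (c {u, v}))" if "(u, v) \<in> R" for u v
    using arcs that assms(2) compact_arc_image by blast
  moreover have "compact (p ` S)" using \<open>finite S\<close> by (simp add: finite_imp_compact)
  ultimately show ?thesis unfolding drawn_def by (intro compact_Un compact_UN) auto
qed

lemma edge_mem: "(u, v) \<in> A \<Longrightarrow> p u \<in> path_image (c {u, v}) \<and> p v \<in> path_image (c {u, v})"
  using verts by blast

lemma edge_connected: "(u, v) \<in> A \<Longrightarrow> Topological_Spaces.connected (path_image (c {u, v}))"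
  using arcs connected_arc_image by blast

lemma drawn_connected:
  assumes S: "conn R S" and R: "R \<subseteq> A" "R \<subseteq> S \<times> S"
  shows "Topological_Spaces.connected (drawn S R)"
proof -
  obtain x where x: "x \<in> S" using conn_nonempty[OF S] by blast
  let ?D = "drawn S R"
  have edge: "connected_component ?D (p u) z" if "(u, v) \<in> R" "z \<in> path_image (c {u, v})" for u v z
  proof -
    have "path_image (c {u, v}) \<subseteq> ?D" using that(1) unfolding drawn_def by blast
    then show ?thesis using edge_connected[of u v] edge_mem[of u v] that R(1)
      unfolding connected_component_def by blast
  qed
  let ?T = "{y \<in> S. connected_component ?D (p x) (p y)}"
  have "p x \<in> ?D" using x unfolding drawn_def by blast
  then have xT: "x \<in> ?T" using x by simp
  have T: "?T = S"
  proof (rule ccontr)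
    assume "?T \<noteq> S"
    then have "touch R ?T (S - ?T)" by (intro connD[OF S]) (use xT in auto)
    then obtain u v where uv: "u \<in> ?T" "v \<in> S - ?T" "(u, v) \<in> R" unfolding touch_def by blast
    have "connected_component ?D (p u) (p v)" using edge[OF uv(3)] edge_mem[of u v] uv(3) R(1) by blast
    then show False using uv connected_component_trans by blast
  qed
  have all: "connected_component ?D (p x) z" if "z \<in> ?D" for z
  proof -
    from that consider y where "y \<in> S" "z = p y" | u v where "(u, v) \<in> R" "z \<in> path_image (c {u, v})"
      unfolding drawn_def by blast
    then show ?thesis
    proof cases
      case 1 then show ?thesis using T by blast
    next
      case 2
      then have "u \<in> S" using R(2) by blast
      then show ?thesis using T edge[OF 2] connected_component_trans by blast
    qed
  qed
  then show ?thesis unfolding connected_iff_connected_component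
    using connected_component_sym connected_component_trans by meson
qed

text \<open>The incidences between parts of the drawing reduce to this set computation. Symmetry of
  R ensures that no edge occurs in R and, with the opposite orientation, in
  \<open>R'\<close>.\<close>

lemma drawn_Int:
  assumes S: "S \<subseteq> V" "S' \<subseteq> V" and R: "R \<subseteq> A" "R \<subseteq> S \<times> S" "R' \<subseteq> A" "R' \<subseteq> S' \<times> S'"
    and symR: "sym R" and dj: "R \<inter> R' = {}"
  shows "drawn S R \<inter> drawn S' R' = p ` (S \<inter> S')"
proof
  show "p ` (S \<inter> S') \<subseteq> drawn S R \<inter> drawn S' R'" unfolding drawn_def by blast
  have vv: "p s \<in> p ` (S \<inter> S')" if "s \<in> S" "s' \<in> S'" "p s = p s'" for s s'
    using that inj_onD[OF inj that(3)] S by blast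
  have ve: "z \<in> p ` (T \<inter> {u, v})" if uv: "(u, v) \<in> A" and z: "z \<in> path_image (c {u, v})" "z \<in> p ` T" and T: "T \<subseteq> V" for u v z T
  proof -
    obtain t where t: "t \<in> T" "z = p t" using z(2) by blast
    have V: "t \<in> V" "u \<in> V" "v \<in> V" using t T uv AV by blast+
    have "z \<in> path_image (c {u, v}) \<inter> p ` V" using z(1) t V by simp
    then have "p t = p u \<or> p t = p v" using verts[OF uv] t by simp
    then have "t = u \<or> t = v" using V inj_on_eq_iff[OF inj] by simp
    then show ?thesis using t by blast
  qed
  show "drawn S R \<inter> drawn S' R' \<subseteq> p ` (S \<inter> S')"
  proof
    fix z assume z: "z \<in> drawn S R \<inter> drawn S' R'"
    then consider (1) s s' where "s \<in> S" "s' \<in> S'" "z = p s" "z = p s'"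
      | (2) u v where "(u, v) \<in> R" "z \<in> path_image (c {u, v})" "z \<in> p ` S'"
      | (3) u v where "(u, v) \<in> R'" "z \<in> path_image (c {u, v})" "z \<in> p ` S"
      | (4) u v u' v' where "(u, v) \<in> R" "z \<in> path_image (c {u, v})" "(u', v') \<in> R'" "z \<in> path_image (c {u', v'})"
      unfolding drawn_def by blast
    then show "z \<in> p ` (S \<inter> S')"
    proof cases
      case 1 then show ?thesis using vv by blast
    next
      case 2
      have "z \<in> p ` (S' \<inter> {u, v})" by (rule ve[OF _ 2(2,3) S(2)]) (use 2 R in blast)
      then show ?thesis using 2(1) R(2) by blast
    next
      case 3
      have "z \<in> p ` (S \<inter> {u, v})" by (rule ve[OF _ 3(2,3) S(1)]) (use 3 R in blast)
      then show ?thesis using 3(1) R(4) by blast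
    next
      case 4
      have "{u, v} \<noteq> {u', v'}"
      proof
        assume "{u, v} = {u', v'}"
        then have "(u', v') = (u, v) \<or> (u', v') = (v, u)" by (auto simp: doubleton_eq_iff)
        then show False using 4(1,3) dj symD[OF symR 4(1)] by blast
      qed
      then have "z \<in> p ` ({u, v} \<inter> {u', v'})" using cross[of u v u' v'] 4 R by blast
      then show ?thesis using 4 R by blast
    qed
  qed
qed

text \<open>The curve of the first edge is reversed if necessary and, by \<open>drawn_Int\<close>,
  meets the remaining arc in its start only, so the two join to an arc.\<close>

lemma path_arc:
  assumes "distinct vs" "2 \<le> length vs" "set vs \<subseteq> V" "pedges vs \<subseteq> A"
  shows "\<exists>g. arc g \<and> pathstart g = p (hd vs) \<and> pathfinish g = p (last vs) \<and> path_image g = drawn (set vs) (pedges vs)"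
  using assms
proof (induction vs rule: pedges.induct)
  case (1 x y zs)
  have xy: "(x, y) \<in> A" "x \<noteq> y" using 1(2,5) by auto
  have "\<exists>e. arc e \<and> pathstart e = p x \<and> pathfinish e = p y \<and> path_image e = path_image (c {x, y})"
  proof (cases "pathstart (c {x, y}) = p x")
    case True
    then have "pathfinish (c {x, y}) = p y"
      using ends[OF xy(1)] arc_distinct_ends[OF arcs[OF xy(1)]] by (auto simp: doubleton_eq_iff)
    then show ?thesis using True arcs[OF xy(1)] by blast
  next
    case False
    then have "pathstart (c {x, y}) = p y" "pathfinish (c {x, y}) = p x"
      using ends[OF xy(1)] by (auto simp: doubleton_eq_iff)
    then show ?thesis using arcs[OF xy(1)] by (intro exI[of _ "reversepath (c {x, y})"]) (auto simp: arc_reversepath)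
  qed
  then obtain e where e: "arc e" "pathstart e = p x" "pathfinish e = p y" "path_image e = path_image (c {x, y})" by blast
  have pe: "path_image e = drawn {x, y} {(x, y), (y, x)}"
    using e(4) edge_mem[OF xy(1)] unfolding drawn_def by (auto simp: insert_commute)
  show ?case
  proof (cases zs)
    case Nil
    then show ?thesis using e pe by (intro exI[of _ e]) (auto simp: insert_commute)
  next
    case (Cons z ws)
    then obtain g where g: "arc g" "pathstart g = p y" "pathfinish g = p (last (y # zs))"
      "path_image g = drawn (set (y # zs)) (pedges (y # zs))"
      using 1 by auto
    have xn: "x \<notin> set (y # zs)" using 1(2) by simp
    have "path_image e \<inter> path_image g = p ` ({x, y} \<inter> set (y # zs))"
      unfolding pe g(4)
    proof (rule drawn_Int)
      show "{x, y} \<subseteq> V" "set (y # zs) \<subseteq> V" "pedges (y # zs) \<subseteq> A" using 1 by auto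
      show "{(x, y), (y, x)} \<subseteq> A" using xy symD[OF symA] by blast
      show "{(x, y), (y, x)} \<inter> pedges (y # zs) = {}" using pedges_subset[of "y # zs"] xn by blast
    qed (use pedges_subset[of "y # zs"] in \<open>auto simp: sym_def\<close>)
    then have int: "path_image e \<inter> path_image g \<subseteq> {pathstart g}" using xn g(2) by auto
    have "arc (e +++ g)" by (rule arc_join[OF e(1) g(1) _ int]) (simp add: e g)
    moreover have "path_image (e +++ g) = drawn (set (x # y # zs)) (pedges (x # y # zs))"
      using path_image_join[of e g] e(3) g(2,4) pe unfolding drawn_def by auto
    ultimately show ?thesis using e g by (intro exI[of _ "e +++ g"]) simp
  qed
qed auto

end

lemma distinct_append3:
  assumes "distinct us" "distinct vs" "distinct ws" "set us \<subseteq> X" "set vs \<subseteq> Y" "set ws \<subseteq> Z"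
    "X \<inter> Y = {}" "X \<inter> Z = {}" "Y \<inter> Z = {}"
  shows "distinct (us @ vs @ ws)"
proof -
  have "set us \<inter> set vs = {}" "set us \<inter> set ws = {}" "set vs \<inter> set ws = {}" using assms by blast+
  then show ?thesis using assms(1-3) by (simp add: Int_Un_distrib)
qed

lemma disjoint_Un_subset: "S \<subseteq> X \<union> Y \<Longrightarrow> T \<subseteq> Z \<Longrightarrow> X \<inter> Z = {} \<Longrightarrow> Y \<inter> Z = {} \<Longrightarrow> S \<inter> T = {}"
  by blast

lemma connected_arc_minus_start:
  assumes "arc g" shows "Topological_Spaces.connected (path_image g - {pathstart g})"
proof -
  have inj: "inj_on g {0..1}" and cont: "continuous_on {0..1} g"
    using assms unfolding arc_def path_def by auto
  have "path_image g - {pathstart g} = g ` {0<..1}"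
  proof
    show "path_image g - {pathstart g} \<subseteq> g ` {0<..1}"
    proof
      fix z assume z: "z \<in> path_image g - {pathstart g}"
      then obtain t where t: "t \<in> {0..1}" "z = g t" unfolding path_image_def by blast
      then have "t \<noteq> 0" using z unfolding pathstart_def by auto
      then show "z \<in> g ` {0<..1}" using t by auto
    qed
    show "g ` {0<..1} \<subseteq> path_image g - {pathstart g}"
    proof
      fix z assume "z \<in> g ` {0<..1}"
      then obtain t where t: "t \<in> {0<..1}" "z = g t" by blast
      then have "g t \<noteq> g 0" using inj_onD[OF inj, of t 0] by auto
      then show "z \<in> path_image g - {pathstart g}" using t unfolding path_image_def pathstart_def by auto
    qed
  qed
  moreover have "Topological_Spaces.connected (g ` {0<..1})"
    by (rule connected_continuous_image[OF continuous_on_subset[OF cont]]) auto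
  ultimately show ?thesis by simp
qed

text \<open>g1 and g2 form a Jordan curve, and K minus its ends lies on the same side as q. From the other
  side one reaches q across g1 without meeting g2 and K, and across g2 without meeting g1 and K, so by
  Janiszewski's theorem the curve would not separate the sides.\<close>
lemma theta_outsider:
  fixes g1 g2 :: "real \<Rightarrow> complex"
  assumes g: "arc g1" "arc g2" "pathstart g1 = x" "pathstart g2 = x" "pathfinish g1 = y" "pathfinish g2 = y"
    and g12: "path_image g1 \<inter> path_image g2 = {x, y}"
    and K: "compact K" "Topological_Spaces.connected K" "K \<inter> path_image g1 = {x, y}" "K \<inter> path_image g2 = {x, y}"
    and q: "q \<notin> K" "q \<notin> path_image g1" "q \<notin> path_image g2"
    and Kq: "\<And>z. z \<in> K - {x, y} \<Longrightarrow> connected_component (- (path_image g1 \<union> path_image g2)) q z"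
    and O1: "Topological_Spaces.connected O1" "q \<in> O1" "O1 \<inter> (path_image g2 \<union> K) = {}" "O1 \<inter> path_image g1 \<noteq> {}"
    and O2: "Topological_Spaces.connected O2" "q \<in> O2" "O2 \<inter> (path_image g1 \<union> K) = {}" "O2 \<inter> path_image g2 \<noteq> {}"
  shows False
proof -
  let ?J = "path_image g1 \<union> path_image g2"
  let ?h = "g1 +++ reversepath g2"
  have J: "path_image ?h = ?J" using g by (simp add: path_image_join)
  have sp: "simple_path ?h"
    by (rule simple_path_join_loop) (use g g12 in \<open>auto simp: arc_reversepath\<close>)
  have loop: "pathfinish ?h = pathstart ?h" using g by simp
  note jio = Jordan_inside_outside[OF sp loop, unfolded J]
  \<comment> \<open>D is the side of the Jordan curve that does not contain q; from here on it is
    irrelevant whether it is the inside or the outside.\<close>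
  obtain D where D: "Topological_Spaces.connected D" "D \<noteq> {}" "frontier D = ?J" "q \<notin> D" "D \<inter> ?J = {}"
    "\<And>z. connected_component (- ?J) q z \<Longrightarrow> z \<notin> D" "\<And>z w. z \<in> D \<Longrightarrow> connected_component (- ?J) z w \<Longrightarrow> w \<in> D"
  proof -
    have j: "Topological_Spaces.connected (inside ?J)" "Topological_Spaces.connected (outside ?J)" "inside ?J \<noteq> {}" "outside ?J \<noteq> {}"
      "frontier (inside ?J) = ?J" "frontier (outside ?J) = ?J" "inside ?J \<inter> outside ?J = {}"
      "inside ?J \<union> outside ?J = - ?J" using jio by simp_all
    have qJ: "q \<in> inside ?J \<union> outside ?J" using q unfolding j(8) by blast
    have sub: "inside ?J \<inter> ?J = {}" "outside ?J \<inter> ?J = {}" using j(8) by blast+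
    have same_in: "w \<in> inside ?J" if "z \<in> inside ?J" "connected_component (- ?J) z w" for z w
      using that inside_same_component by metis
    have same_out: "w \<in> outside ?J" if "z \<in> outside ?J" "connected_component (- ?J) z w" for z w
      using that outside_same_component by metis
    show ?thesis
    proof (cases "q \<in> inside ?J")
      case True
      show ?thesis
      proof (rule that[OF j(2,4,6) _ sub(2)])
        show "q \<notin> outside ?J" using True j(7) by blast
        show "z \<notin> outside ?J" if "connected_component (- ?J) q z" for z
          using same_in[OF True that] j(7) by blast
      qed (rule same_out)
    next
      case False
      then have qo: "q \<in> outside ?J" using qJ by blast
      show ?thesis
      proof (rule that[OF j(1,3,5) False sub(1)])
        show "z \<notin> inside ?J" if "connected_component (- ?J) q z" for z
          using same_out[OF qo that] j(7) by blast
      qed (rule same_in)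
    qed
  qed
  have DK: "D \<inter> K = {}"
  proof (rule ccontr)
    assume "D \<inter> K \<noteq> {}"
    then obtain z where z: "z \<in> D" "z \<in> K" by blast
    then have "z \<notin> {x, y}" using D(5) g12 by blast
    then show False using Kq[of z] D(6)[of z] z by blast
  qed
  obtain s where s: "s \<in> D" using D(2) by blast
  have JD: "?J \<subseteq> closure D" using D(3) unfolding frontier_def by blast
  \<comment> \<open>Every point of the curve is a limit of D, so a connected set that reaches the
    curve may be continued into D.\<close>
  have escape: "connected_component (- P) q s" if Oc: "Topological_Spaces.connected Oc" "q \<in> Oc" "Oc \<inter> P = {}" "Oc \<inter> ?J \<noteq> {}" and P: "P \<subseteq> ?J \<union> K" for Oc P
  proof -
    obtain f where f: "f \<in> Oc" "f \<in> ?J" using Oc(4) by blast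
    have "Topological_Spaces.connected (insert f D)"
      by (rule connected_intermediate_closure[OF D(1)]) (use f JD closure_subset in auto)
    then have "Topological_Spaces.connected (Oc \<union> insert f D)" by (rule connected_Un[OF Oc(1)]) (use f in blast)
    moreover have "Oc \<union> insert f D \<subseteq> - P" using f(1) Oc(3) P D(5) DK by blast
    ultimately show ?thesis unfolding connected_component_def using Oc(2) s by blast
  qed
  have c1: "connected_component (- (path_image g2 \<union> K)) q s"
    by (rule escape[OF O1(1,2,3)]) (use O1(4) in blast)+
  have c2: "connected_component (- (path_image g1 \<union> K)) q s"
    by (rule escape[OF O2(1,2,3)]) (use O2(4) in blast)+
  \<comment> \<open>The two obstacles meet exactly in K, which is connected, as Janiszewski's
    theorem demands.\<close>
  have "connected_component (- ((path_image g2 \<union> K) \<union> (path_image g1 \<union> K))) q s"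
  proof (rule Janiszewski[OF _ _ _ c1 c2])
    show "compact (path_image g2 \<union> K)" using K(1) compact_arc_image[OF g(2)] by blast
    show "closed (path_image g1 \<union> K)" using K(1) compact_arc_image[OF g(1)] by (intro closed_Un compact_imp_closed)
    have "(path_image g2 \<union> K) \<inter> (path_image g1 \<union> K) = K" using g12 K(3) by blast
    then show "Topological_Spaces.connected ((path_image g2 \<union> K) \<inter> (path_image g1 \<union> K))" using K(2) by simp
  qed
  then have "connected_component (- ?J) q s" by (rule connected_component_of_subset) blast
  then show False using D(6) s by blast
qed

context drawing begin

lemma edge_minus_end:
  assumes "(u, v) \<in> A"
  shows "Topological_Spaces.connected (path_image (c {u, v}) - {p u})"
proof (cases "pathstart (c {u, v}) = p u")
  case True then show ?thesis using connected_arc_minus_start[OF arcs[OF assms]] by simp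
next
  case False
  then have "pathstart (reversepath (c {u, v})) = p u" using ends[OF assms] by (auto simp: doubleton_eq_iff)
  then show ?thesis using connected_arc_minus_start[of "reversepath (c {u, v})"] arcs[OF assms]
    by (simp add: arc_reversepath)
qed

text \<open>A model yields two paths from a in \<open>X1\<close> to b in \<open>X2\<close>, through
  \<open>Y1\<close> and through \<open>Y2\<close>, and a connected set K joining a and b through
  \<open>Y3\<close>. A vertex of \<open>X3\<close> is the point q of \<open>theta_outsider\<close>:
  it lies on the side of K, and through \<open>Y1\<close> and \<open>Y2\<close> it reaches either
  path while avoiding the other path and K.\<close>

theorem k33_free_drawing: "k33_free A"
  unfolding k33_free_def
proof
  assume "\<exists>X1 X2 X3 Y1 Y2 Y3. k33 A X1 X2 X3 Y1 Y2 Y3"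
  then obtain X1 X2 X3 Y1 Y2 Y3 where k: "k33 A X1 X2 X3 Y1 Y2 Y3" by blast
  have cX: "conn A X1" "conn A X2" "conn A X3" "conn A Y1" "conn A Y2" "conn A Y3"
    and dX: "X1 \<inter> X2 = {}" "X1 \<inter> X3 = {}" "X2 \<inter> X3 = {}" "Y1 \<inter> Y2 = {}" "Y1 \<inter> Y3 = {}" "Y2 \<inter> Y3 = {}"
    and dXY: "X1 \<inter> Y1 = {}" "X1 \<inter> Y2 = {}" "X1 \<inter> Y3 = {}" "X2 \<inter> Y1 = {}" "X2 \<inter> Y2 = {}" "X2 \<inter> Y3 = {}"
      "X3 \<inter> Y1 = {}" "X3 \<inter> Y2 = {}" "X3 \<inter> Y3 = {}"
    and tXY: "touch A X1 Y1" "touch A X1 Y2" "touch A X1 Y3" "touch A X2 Y1" "touch A X2 Y2" "touch A X2 Y3"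
      "touch A X3 Y1" "touch A X3 Y2" "touch A X3 Y3"
    using k unfolding k33_def by simp_all
  note sm = symD[OF symA]
  have inV: "X1 \<subseteq> V" "X2 \<subseteq> V" "X3 \<subseteq> V" "Y1 \<subseteq> V" "Y2 \<subseteq> V" "Y3 \<subseteq> V"
    using conn_subset_field[OF _ _ AV] cX tXY touch_commute[OF symA] by metis+
  obtain x11 y11 where e11: "x11 \<in> X1" "y11 \<in> Y1" "(x11, y11) \<in> A" using tXY(1) unfolding touch_def by blast
  obtain x12 y12 where e12: "x12 \<in> X1" "y12 \<in> Y2" "(x12, y12) \<in> A" using tXY(2) unfolding touch_def by blast
  obtain x21 y21 where e21: "x21 \<in> X2" "y21 \<in> Y1" "(x21, y21) \<in> A" using tXY(4) unfolding touch_def by blast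
  obtain x22 y22 where e22: "x22 \<in> X2" "y22 \<in> Y2" "(x22, y22) \<in> A" using tXY(5) unfolding touch_def by blast
  obtain P1 a H1 where P1: "path_in A X1 P1" "hd P1 = x11" "last P1 = x12" "a \<in> set P1"
    and H1: "conn A H1" "Y3 \<subseteq> H1" "H1 \<subseteq> X1 \<union> Y3 - set P1" "touch A {a} H1"
    using tripod[OF symA cX(1,6) dXY(3) tXY(3) e11(1) e12(1)] by blast
  obtain P2 b H2 where P2: "path_in A X2 P2" "hd P2 = x21" "last P2 = x22" "b \<in> set P2"
    and H2: "conn A H2" "Y3 \<subseteq> H2" "H2 \<subseteq> X2 \<union> Y3 - set P2" "touch A {b} H2"
    using tripod[OF symA cX(2,6) dXY(6) tXY(6) e21(1) e22(1)] by blast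
  have tY: "touch A Y1 X3" "touch A Y2 X3" "Y1 \<inter> X3 = {}" "Y2 \<inter> X3 = {}"
    using tXY(7,8) touch_commute[OF symA] dXY(7,8) by blast+
  obtain R1 f1 G1 where R1: "path_in A Y1 R1" "hd R1 = y11" "last R1 = y21" "f1 \<in> set R1"
    and G1: "conn A G1" "X3 \<subseteq> G1" "G1 \<subseteq> Y1 \<union> X3 - set R1" "touch A {f1} G1"
    using tripod[OF symA cX(4,3) tY(3,1) e11(2) e21(2)] by blast
  obtain R2 f2 G2 where R2: "path_in A Y2 R2" "hd R2 = y12" "last R2 = y22" "f2 \<in> set R2"
    and G2: "conn A G2" "X3 \<subseteq> G2" "G2 \<subseteq> Y2 \<union> X3 - set R2" "touch A {f2} G2"
    using tripod[OF symA cX(5,3) tY(4,2) e12(2) e22(2)] by blast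
  have ps: "set P1 \<subseteq> X1" "set P2 \<subseteq> X2" "set R1 \<subseteq> Y1" "set R2 \<subseteq> Y2"
    "distinct P1" "distinct P2" "distinct R1" "distinct R2" "P1 \<noteq> []" "P2 \<noteq> []" "R1 \<noteq> []" "R2 \<noteq> []"
    "pedges P1 \<subseteq> A" "pedges P2 \<subseteq> A" "pedges R1 \<subseteq> A" "pedges R2 \<subseteq> A"
    using P1(1) P2(1) R1(1) R2(1) unfolding path_in_def by auto
  obtain l1 r1 where P1s: "P1 = l1 @ a # r1" using P1(4) by (meson split_list)
  obtain l2 r2 where P2s: "P2 = l2 @ b # r2" using P2(4) by (meson split_list)
  \<comment> \<open>U1 runs from a back along P1 to the contact with \<open>Y1\<close>, crosses
    \<open>Y1\<close> on R1 and follows P2 up to b; U2 uses the other halves of P1 and P2 and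
    crosses \<open>Y2\<close>.\<close>
  define U1 where "U1 = rev (l1 @ [a]) @ R1 @ (l2 @ [b])"
  define U2 where "U2 = (a # r1) @ R2 @ rev (b # r2)"
  have hl: "last (rev (l1 @ [a])) = x11" "hd (l2 @ [b]) = x21" "last (a # r1) = x12" "hd (rev (b # r2)) = x22"
  proof -
    show "last (rev (l1 @ [a])) = x11" using P1(2) P1s by (cases l1) auto
    show "hd (l2 @ [b]) = x21" using P2(2) P2s by (cases l2) auto
    show "last (a # r1) = x12" using P1(3) P1s by simp
    have "hd (rev (b # r2)) = last (b # r2)" by (rule hd_rev)
    then show "hd (rev (b # r2)) = x22" using P2(3) P2s by simp
  qed
  have sub_edges: "pedges (l @ [z]) \<subseteq> A" "pedges (z # r) \<subseteq> A" if "pedges (l @ z # r) \<subseteq> A" for l z r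
  proof -
    show "pedges (z # r) \<subseteq> A" using that pedges_append[of l "z # r"] by (cases "l = []") auto
    show "pedges (l @ [z]) \<subseteq> A" using that pedges_append[of "l @ [z]" r] by (cases "r = []") auto
  qed
  have se1: "pedges (l1 @ [a]) \<subseteq> A" "pedges (a # r1) \<subseteq> A" using sub_edges[of l1 a r1] ps(13) P1s by simp_all
  have se2: "pedges (l2 @ [b]) \<subseteq> A" "pedges (b # r2) \<subseteq> A" using sub_edges[of l2 b r2] ps(14) P2s by simp_all
  have U1A: "pedges U1 \<subseteq> A"
  proof -
    have "pedges (R1 @ (l2 @ [b])) = pedges R1 \<union> pedges (l2 @ [b]) \<union> {(y21, x21), (x21, y21)}"
      using pedges_append[of R1 "l2 @ [b]"] ps(11) R1(3) hl(2) by simp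
    then have "pedges (R1 @ (l2 @ [b])) \<subseteq> A" using ps(15) se2(1) e21(3) sm by blast
    moreover have "pedges U1 = pedges (rev (l1 @ [a])) \<union> pedges (R1 @ (l2 @ [b])) \<union> {(x11, y11), (y11, x11)}"
      unfolding U1_def using pedges_append[of "rev (l1 @ [a])" "R1 @ (l2 @ [b])"] ps(11) R1(2) hl(1) by simp
    moreover have "pedges (rev (l1 @ [a])) \<subseteq> A" using se1(1) by (simp only: pedges_rev)
    ultimately show ?thesis using e11(3) sm by blast
  qed
  have U2A: "pedges U2 \<subseteq> A"
  proof -
    have "pedges (R2 @ rev (b # r2)) = pedges R2 \<union> pedges (rev (b # r2)) \<union> {(y22, x22), (x22, y22)}"
      using pedges_append[of R2 "rev (b # r2)"] ps(12) R2(3) hl(4) by simp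
    moreover have "pedges (rev (b # r2)) \<subseteq> A" using se2(2) by (simp only: pedges_rev)
    ultimately have "pedges (R2 @ rev (b # r2)) \<subseteq> A" using ps(16) e22(3) sm by blast
    moreover have "pedges U2 = pedges (a # r1) \<union> pedges (R2 @ rev (b # r2)) \<union> {(x12, y12), (y12, x12)}"
      unfolding U2_def using pedges_append[of "a # r1" "R2 @ rev (b # r2)"] ps(12) R2(2) hl(3) by simp
    ultimately show ?thesis using se1(2) e12(3) sm by blast
  qed
  have s1: "set l1 \<subseteq> X1" "set r1 \<subseteq> X1" "a \<in> X1" "set l2 \<subseteq> X2" "set r2 \<subseteq> X2" "b \<in> X2"
    using ps(1,2) P1s P2s by auto
  have d1: "distinct (l1 @ a # r1)" "distinct (l2 @ b # r2)" using ps(5,6) P1s P2s by simp_all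
  have setU: "set U1 = set l1 \<union> {a} \<union> set R1 \<union> set l2 \<union> {b}" "set U2 = set r1 \<union> {a} \<union> set R2 \<union> set r2 \<union> {b}"
    unfolding U1_def U2_def by auto
  have dl: "distinct (rev (l1 @ [a]))" "distinct (a # r1)" "distinct (l2 @ [b])" "distinct (rev (b # r2))" using d1 by auto
  have sl: "set (rev (l1 @ [a])) \<subseteq> X1" "set (a # r1) \<subseteq> X1" "set (l2 @ [b]) \<subseteq> X2" "set (rev (b # r2)) \<subseteq> X2"
    using s1 by simp_all
  have YX: "Y1 \<inter> X2 = {}" "Y2 \<inter> X2 = {}" using dXY(4,5) by blast+
  have U1d: "distinct U1" unfolding U1_def
    by (rule distinct_append3[OF dl(1) ps(7) dl(3) sl(1) ps(3) sl(3) dXY(1) dX(1) YX(1)])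
  have U2d: "distinct U2" unfolding U2_def
    by (rule distinct_append3[OF dl(2) ps(8) dl(4) sl(2) ps(4) sl(4) dXY(2) dX(1) YX(2)])
  have UV: "set U1 \<subseteq> V" "set U2 \<subseteq> V" unfolding setU using s1 ps(3,4) inV by blast+
  have Uint: "set U1 \<inter> set U2 = {a, b}"
  proof
    have dd: "set l1 \<inter> set r1 = {}" "a \<notin> set l1" "a \<notin> set r1" "set l2 \<inter> set r2 = {}" "b \<notin> set l2" "b \<notin> set r2"
      using d1 by auto
    have u1: "set U1 \<inter> X1 \<subseteq> insert a (set l1)" "set U1 \<inter> X2 \<subseteq> insert b (set l2)" "set U1 \<subseteq> X1 \<union> X2 \<union> Y1"
      unfolding setU using s1 ps(3) dX(1) dXY(1,4) by blast+
    have u2: "set U2 \<inter> X1 \<subseteq> insert a (set r1)" "set U2 \<inter> X2 \<subseteq> insert b (set r2)" "set U2 \<subseteq> X1 \<union> X2 \<union> Y2"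
      unfolding setU using s1 ps(4) dX(1) dXY(2,5) by blast+
    show "set U1 \<inter> set U2 \<subseteq> {a, b}"
    proof
      fix x assume x: "x \<in> set U1 \<inter> set U2"
      consider "x \<in> X1" | "x \<in> X2" | "x \<in> Y1" "x \<in> Y2" using x u1(3) u2(3) by blast
      then show "x \<in> {a, b}"
      proof cases
        case 1 then show ?thesis using x u1(1) u2(1) dd(1) by blast
      next
        case 2 then show ?thesis using x u1(2) u2(2) dd(4) by blast
      next
        case 3 then show ?thesis using dX(4) by blast
      qed
    qed
    show "{a, b} \<subseteq> set U1 \<inter> set U2" unfolding setU by blast
  qed
  have ab: "a \<noteq> b" using s1 dX by blast
  have U1f: "U1 = a # (rev l1 @ R1 @ l2) @ [b]" unfolding U1_def by simp
  have U2f: "U2 = a # (r1 @ R2 @ rev r2) @ [b]" unfolding U2_def by simp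
  \<comment> \<open>The only edge that U1 and U2 could share is ab, since a and b are their only
    common vertices; U1 does not contain it because it passes through R1.\<close>
  have nab1: "(a, b) \<notin> pedges U1"
    using pedges_ends[of a "rev l1 @ R1 @ l2" b] U1d ps(11) unfolding U1f by simp
  have "pedges U1 \<inter> pedges U2 = {}"
  proof (rule ccontr)
    assume "pedges U1 \<inter> pedges U2 \<noteq> {}"
    then obtain u v where uv: "(u, v) \<in> pedges U1" "(u, v) \<in> pedges U2" by auto
    then have "u \<in> {a, b}" "v \<in> {a, b}" using pedges_subset[of U1] pedges_subset[of U2] Uint by blast+
    moreover have "u \<noteq> v" using uv(1) U1A irreflA by blast
    ultimately have "(a, b) \<in> pedges U1" using uv(1) symD[OF sym_pedges uv(1)] by auto
    then show False using nab1 by simp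
  qed
  note Udj = this
  obtain g1 where g1: "arc g1" "pathstart g1 = p a" "pathfinish g1 = p b" "path_image g1 = drawn (set U1) (pedges U1)"
    using path_arc[OF U1d _ UV(1) U1A] unfolding U1f by auto
  obtain g2 where g2: "arc g2" "pathstart g2 = p a" "pathfinish g2 = p b" "path_image g2 = drawn (set U2) (pedges U2)"
    using path_arc[OF U2d _ UV(2) U2A] unfolding U2f by auto
  let ?I = "H1 \<union> H2"
  have I: "conn A ?I"
    by (rule conn_Un[OF symA H1(1) H2(1)]) (use H1(2) H2(2) conn_nonempty[OF cX(6)] in blast)
  obtain i1 where i1: "i1 \<in> H1" "(a, i1) \<in> A" using H1(4) unfolding touch_def by blast
  obtain i2 where i2: "i2 \<in> H2" "(b, i2) \<in> A" using H2(4) unfolding touch_def by blast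
  obtain j1 where j1: "j1 \<in> G1" "(f1, j1) \<in> A" using G1(4) unfolding touch_def by blast
  obtain j2 where j2: "j2 \<in> G2" "(f2, j2) \<in> A" using G2(4) unfolding touch_def by blast
  have UU: "set U1 \<union> set U2 = set P1 \<union> set P2 \<union> set R1 \<union> set R2" unfolding setU P1s P2s by auto
  have hs: "H1 \<subseteq> X1 \<union> Y3" "H2 \<subseteq> X2 \<union> Y3" "G1 \<subseteq> Y1 \<union> X3" "G2 \<subseteq> Y2 \<union> X3"
    "H1 \<inter> set P1 = {}" "H2 \<inter> set P2 = {}" "G1 \<inter> set R1 = {}" "G2 \<inter> set R2 = {}"
    using H1(3) H2(3) G1(3) G2(3) by auto
  have sw: "X2 \<inter> X1 = {}" "X3 \<inter> X1 = {}" "X3 \<inter> X2 = {}" "Y2 \<inter> Y1 = {}" "Y3 \<inter> Y1 = {}" "Y3 \<inter> Y2 = {}"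
    "Y1 \<inter> X1 = {}" "Y1 \<inter> X2 = {}" "Y2 \<inter> X1 = {}" "Y2 \<inter> X2 = {}" "Y3 \<inter> X1 = {}" "Y3 \<inter> X2 = {}" "Y1 \<inter> X3 = {}" "Y2 \<inter> X3 = {}" "Y3 \<inter> X3 = {}"
    using dX dXY by (simp_all only: Int_commute)
  have HP: "H1 \<inter> set P2 = {}" "H1 \<inter> set R1 = {}" "H1 \<inter> set R2 = {}" "H2 \<inter> set P1 = {}" "H2 \<inter> set R1 = {}" "H2 \<inter> set R2 = {}"
    by (rule disjoint_Un_subset[OF hs(1) ps(2) dX(1) sw(12)] disjoint_Un_subset[OF hs(1) ps(3) dXY(1) sw(5)]
        disjoint_Un_subset[OF hs(1) ps(4) dXY(2) sw(6)] disjoint_Un_subset[OF hs(2) ps(1) sw(1) sw(11)]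
        disjoint_Un_subset[OF hs(2) ps(3) dXY(4) sw(5)] disjoint_Un_subset[OF hs(2) ps(4) dXY(5) sw(6)])+
  have GP: "G1 \<inter> set P1 = {}" "G1 \<inter> set P2 = {}" "G1 \<inter> set R2 = {}" "G2 \<inter> set P1 = {}" "G2 \<inter> set P2 = {}" "G2 \<inter> set R1 = {}"
    by (rule disjoint_Un_subset[OF hs(3) ps(1) sw(7) sw(2)] disjoint_Un_subset[OF hs(3) ps(2) sw(8) sw(3)]
        disjoint_Un_subset[OF hs(3) ps(4) dX(4) dXY(8)] disjoint_Un_subset[OF hs(4) ps(1) sw(9) sw(2)]
        disjoint_Un_subset[OF hs(4) ps(2) sw(10) sw(3)] disjoint_Un_subset[OF hs(4) ps(3) sw(4) dXY(7)])+
  have IU: "?I \<inter> (set U1 \<union> set U2) = {}"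
    unfolding UU using HP hs(5,6) by (simp add: Int_Un_distrib Int_Un_distrib2)
  have GU: "G1 \<inter> (set U1 \<union> set U2) = {}" "G2 \<inter> (set U1 \<union> set U2) = {}"
    unfolding UU using GP hs(7,8) by (simp_all add: Int_Un_distrib)
  have XYX: "(X1 \<union> Y3) \<inter> Y1 = {}" "(X1 \<union> Y3) \<inter> X3 = {}" "(X2 \<union> Y3) \<inter> Y1 = {}" "(X2 \<union> Y3) \<inter> X3 = {}"
    "(X1 \<union> Y3) \<inter> Y2 = {}" "(X2 \<union> Y3) \<inter> Y2 = {}"
    using dX dXY sw by (simp_all add: Int_Un_distrib2)
  have HG: "G1 \<inter> H1 = {}" "G1 \<inter> H2 = {}" "G2 \<inter> H1 = {}" "G2 \<inter> H2 = {}"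
    by (rule disjoint_Un_subset[OF hs(3) hs(1)] disjoint_Un_subset[OF hs(3) hs(2)] disjoint_Un_subset[OF hs(4) hs(1)] disjoint_Un_subset[OF hs(4) hs(2)];
        use XYX in \<open>simp add: Int_commute\<close>)+
  have GI: "G1 \<inter> ?I = {}" "G2 \<inter> ?I = {}" using HG by (simp_all add: Int_Un_distrib)
  have f12: "f1 \<in> set U1" "f1 \<notin> set U2" "f1 \<notin> ?I" "f2 \<in> set U2" "f2 \<notin> set U1" "f2 \<notin> ?I"
  proof -
    have f: "f1 \<in> Y1" "f2 \<in> Y2" using R1(4) R2(4) ps(3,4) by blast+
    show "f1 \<in> set U1" "f2 \<in> set U2" unfolding setU using R1(4) R2(4) by blast+
    then show "f1 \<notin> ?I" "f2 \<notin> ?I" using IU by blast+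
    have "f1 \<noteq> a" "f1 \<noteq> b" "f2 \<noteq> a" "f2 \<noteq> b" using f s1(3,6) dXY(1,2,4,5) by blast+
    moreover have "{a, b} = set U1 \<inter> set U2" by (rule Uint[symmetric])
    ultimately show "f1 \<notin> set U2" "f2 \<notin> set U1" using \<open>f1 \<in> set U1\<close> \<open>f2 \<in> set U2\<close> by blast+
  qed
  have IV: "?I \<subseteq> V" "G1 \<subseteq> V" "G2 \<subseteq> V" using hs(1-4) inV by blast+
  \<comment> \<open>Besides the drawing of \<open>?I\<close>, K contains just one edge at a and one
    at b, so K without its ends is a connected drawing with two spikes.\<close>
  define RI where "RI = A \<inter> ?I \<times> ?I"
  define RK where "RK = RI \<union> {(a, i1), (i1, a), (b, i2), (i2, b)}"
  define K where "K = drawn (insert a (insert b ?I)) RK"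
  have symRI: "sym RI" unfolding RI_def using symA by (auto simp: sym_def)
  have symRK: "sym RK" using symRI unfolding RK_def sym_def by blast
  have RKA: "RK \<subseteq> A" using i1 i2 sm unfolding RK_def RI_def by blast
  have RKs: "RK \<subseteq> insert a (insert b ?I) \<times> insert a (insert b ?I)" unfolding RK_def RI_def using i1 i2 by blast
  have connRK: "conn RK (insert a (insert b ?I))"
  proof (rule conn_insert[OF symRK], rule conn_insert[OF symRK])
    show "conn RK ?I" by (rule conn_restrict[OF I]) (auto simp: RK_def RI_def)
  qed (use i1 i2 in \<open>auto simp: touch_def RK_def\<close>)
  have abV: "a \<in> V" "b \<in> V" using s1 inV by blast+
  have KV: "insert a (insert b ?I) \<subseteq> V" using abV IV by blast
  have K1: "compact K" "Topological_Spaces.connected K"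
    unfolding K_def using drawn_compact[OF KV RKA] drawn_connected[OF connRK RKA RKs] by blast+
  have KU: "K \<inter> drawn S R = p ` (insert a (insert b ?I) \<inter> S)" if "S \<subseteq> V" "R \<subseteq> A" "R \<subseteq> S \<times> S" "S \<inter> ?I = {}" for S R
    unfolding K_def
  proof (rule drawn_Int[OF KV that(1) RKA RKs that(2,3) symRK])
    have "u \<in> ?I \<or> v \<in> ?I" if "(u, v) \<in> RK" for u v using that i1 i2 unfolding RK_def RI_def by blast
    then show "RK \<inter> R = {}" using that(3,4) by blast
  qed
  have Kg1: "K \<inter> path_image g1 = {p a, p b}"
  proof -
    have i: "insert a (insert b ?I) \<inter> set U1 = {a, b}" using IU Uint by blast
    have SU: "set U1 \<inter> ?I = {}" using IU by blast
    have "K \<inter> drawn (set U1) (pedges U1) = p ` (insert a (insert b ?I) \<inter> set U1)"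
      by (rule KU[OF UV(1) U1A pedges_subset SU])
    then show ?thesis unfolding g1(4) i by simp
  qed
  have Kg2: "K \<inter> path_image g2 = {p a, p b}"
  proof -
    have i: "insert a (insert b ?I) \<inter> set U2 = {a, b}" using IU Uint by blast
    have SU: "set U2 \<inter> ?I = {}" using IU by blast
    have "K \<inter> drawn (set U2) (pedges U2) = p ` (insert a (insert b ?I) \<inter> set U2)"
      by (rule KU[OF UV(2) U2A pedges_subset SU])
    then show ?thesis unfolding g2(4) i by simp
  qed
  have g12: "path_image g1 \<inter> path_image g2 = {p a, p b}"
    unfolding g1(4) g2(4) drawn_Int[OF UV U1A pedges_subset U2A pedges_subset sym_pedges Udj] Uint by simp
  obtain x3 y3 where e3: "x3 \<in> X3" "y3 \<in> Y3" "(x3, y3) \<in> A" using tXY(9) unfolding touch_def by blast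
  have x3: "x3 \<in> G1" "x3 \<in> G2" "x3 \<in> V" using e3 G1(2) G2(2) inV by blast+
  have out: "Topological_Spaces.connected (drawn (insert f G) ((A \<inter> G \<times> G) \<union> {(f, j), (j, f)})) \<and>
      (\<forall>S R. S \<subseteq> V \<longrightarrow> R \<subseteq> A \<longrightarrow> R \<subseteq> S \<times> S \<longrightarrow> S \<inter> G = {} \<longrightarrow>
        drawn (insert f G) ((A \<inter> G \<times> G) \<union> {(f, j), (j, f)}) \<inter> drawn S R = p ` (S \<inter> {f}))"
    if G: "conn A G" "G \<subseteq> V" and f: "f \<in> V" "j \<in> G" "(f, j) \<in> A" for G f j
  proof -
    let ?R = "(A \<inter> G \<times> G) \<union> {(f, j), (j, f)}"
    have symR: "sym ?R" using symA unfolding sym_def by blast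
    have RA: "?R \<subseteq> A" using f(3) sm by blast
    have Rs: "?R \<subseteq> insert f G \<times> insert f G" using f by blast
    have "conn ?R (insert f G)"
      by (rule conn_insert[OF symR conn_restrict[OF G(1)]]) (use f in \<open>auto simp: touch_def\<close>)
    then have "Topological_Spaces.connected (drawn (insert f G) ?R)" by (rule drawn_connected[OF _ RA Rs])
    moreover have "drawn (insert f G) ?R \<inter> drawn S R = p ` (S \<inter> {f})"
      if "S \<subseteq> V" "R \<subseteq> A" "R \<subseteq> S \<times> S" "S \<inter> G = {}" for S R
    proof -
      have "drawn (insert f G) ?R \<inter> drawn S R = p ` (insert f G \<inter> S)"
        by (rule drawn_Int[OF _ that(1) RA Rs that(2,3) symR]) (use f G that in blast)+
      moreover have "insert f G \<inter> S = S \<inter> {f}" using that(4) by blast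
      ultimately show ?thesis by simp
    qed
    ultimately show ?thesis by blast
  qed
  have fV: "f1 \<in> V" "f2 \<in> V" using f12 UV by blast+
  define O1 where "O1 = drawn (insert f1 G1) ((A \<inter> G1 \<times> G1) \<union> {(f1, j1), (j1, f1)})"
  define O2 where "O2 = drawn (insert f2 G2) ((A \<inter> G2 \<times> G2) \<union> {(f2, j2), (j2, f2)})"
  have O1: "Topological_Spaces.connected O1" "\<And>S R. S \<subseteq> V \<Longrightarrow> R \<subseteq> A \<Longrightarrow> R \<subseteq> S \<times> S \<Longrightarrow> S \<inter> G1 = {} \<Longrightarrow> O1 \<inter> drawn S R = p ` (S \<inter> {f1})"
    using out[OF G1(1) IV(2) fV(1) j1] unfolding O1_def by blast+
  have O2: "Topological_Spaces.connected O2" "\<And>S R. S \<subseteq> V \<Longrightarrow> R \<subseteq> A \<Longrightarrow> R \<subseteq> S \<times> S \<Longrightarrow> S \<inter> G2 = {} \<Longrightarrow> O2 \<inter> drawn S R = p ` (S \<inter> {f2})"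
    using out[OF G2(1) IV(3) fV(2) j2] unfolding O2_def by blast+
  have abG: "a \<notin> G1" "b \<notin> G1" "a \<notin> G2" "b \<notin> G2" using GU unfolding setU by blast+
  have qO: "p x3 \<in> O1" "p x3 \<in> O2" unfolding O1_def O2_def drawn_def using x3 by blast+
  have O1K: "O1 \<inter> K = {}"
  proof -
    have i: "insert a (insert b ?I) \<inter> {f1} = {}" using f12 Uint by blast
    have SG: "insert a (insert b ?I) \<inter> G1 = {}" using GI abG by blast
    have "O1 \<inter> K = p ` (insert a (insert b ?I) \<inter> {f1})" unfolding K_def by (rule O1(2)[OF KV RKA RKs SG])
    then show ?thesis unfolding i by simp
  qed
  have O2K: "O2 \<inter> K = {}"
  proof -
    have i: "insert a (insert b ?I) \<inter> {f2} = {}" using f12 Uint by blast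
    have SG: "insert a (insert b ?I) \<inter> G2 = {}" using GI abG by blast
    have "O2 \<inter> K = p ` (insert a (insert b ?I) \<inter> {f2})" unfolding K_def by (rule O2(2)[OF KV RKA RKs SG])
    then show ?thesis unfolding i by simp
  qed
  have SGU: "set U1 \<inter> G1 = {}" "set U2 \<inter> G1 = {}" "set U1 \<inter> G2 = {}" "set U2 \<inter> G2 = {}" using GU by blast+
  have fU: "set U1 \<inter> {f1} = {f1}" "set U2 \<inter> {f1} = {}" "set U1 \<inter> {f2} = {}" "set U2 \<inter> {f2} = {f2}" using f12 by blast+
  have O1g: "O1 \<inter> path_image g2 = {}" "O1 \<inter> path_image g1 = {p f1}"
    unfolding g1(4) g2(4) O1(2)[OF UV(2) U2A pedges_subset SGU(2)] O1(2)[OF UV(1) U1A pedges_subset SGU(1)] fU by simp_all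
  have O2g: "O2 \<inter> path_image g1 = {}" "O2 \<inter> path_image g2 = {p f2}"
    unfolding g1(4) g2(4) O2(2)[OF UV(1) U1A pedges_subset SGU(3)] O2(2)[OF UV(2) U2A pedges_subset SGU(4)] fU by simp_all
  let ?J = "path_image g1 \<union> path_image g2"
  \<comment> \<open>T joins \<open>X3\<close> to \<open>?I\<close> without meeting the curve and so
    places the drawing of \<open>?I\<close> on the side of q.\<close>
  define T where "T = ?I \<union> X3"
  define RT where "RT = A \<inter> T \<times> T"
  have T: "conn A T" unfolding T_def
  proof (rule conn_Un[OF symA I cX(3)])
    have "y3 \<in> ?I" using e3(2) H1(2) by blast
    then show "?I \<inter> X3 \<noteq> {} \<or> touch A ?I X3" using touchI[OF sm[OF e3(3)], of ?I X3] e3(1) by blast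
  qed
  have TV: "T \<subseteq> V" using IV inV unfolding T_def by blast
  have RT: "RT \<subseteq> A" "RT \<subseteq> T \<times> T" "sym RT" unfolding RT_def using symA by (auto simp: sym_def)
  have connT: "Topological_Spaces.connected (drawn T RT)"
    by (rule drawn_connected[OF conn_restrict[OF T] RT(1,2)]) (simp add: RT_def)
  have TU: "T \<inter> (set U1 \<union> set U2) = {}" using IU GU(1) G1(2) unfolding T_def by blast
  have TJ: "drawn T RT \<inter> ?J = {}"
  proof -
    have "drawn T RT \<inter> path_image g1 = p ` (T \<inter> set U1)"
      unfolding g1(4) by (rule drawn_Int[OF TV UV(1) RT(1,2) U1A pedges_subset RT(3)]) (use RT(2) pedges_subset[of U1] TU in blast)
    moreover have "drawn T RT \<inter> path_image g2 = p ` (T \<inter> set U2)"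
      unfolding g2(4) by (rule drawn_Int[OF TV UV(2) RT(1,2) U2A pedges_subset RT(3)]) (use RT(2) pedges_subset[of U2] TU in blast)
    ultimately show ?thesis using TU by blast
  qed
  have qT: "p x3 \<in> drawn T RT" using e3 unfolding drawn_def T_def by blast
  have toT: "connected_component (- ?J) (p x3) z" if "z \<in> drawn T RT" for z
    unfolding connected_component_def using connT TJ qT that by blast
  \<comment> \<open>The edge without its end s is still connected, misses the curve and contains the
    point of i, which T joins to q.\<close>
  have spike: "connected_component (- ?J) (p x3) z"
    if s: "s \<in> {a, b}" "i \<in> ?I" "(s, i) \<in> A" "(s, i) \<in> RK" "z \<in> path_image (c {s, i})" "z \<noteq> p s" for s i z
  proof -
    let ?E = "path_image (c {s, i}) - {p s}"
    have EJ: "?E \<inter> ?J = {}"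
    proof -
      have "path_image (c {s, i}) \<inter> ?J \<subseteq> {p s}"
      proof
        fix t assume t: "t \<in> path_image (c {s, i}) \<inter> ?J"
        have "t \<in> K" using t s(4) unfolding K_def drawn_def by blast
        then have "t \<in> {p a, p b}" using t Kg1 Kg2 by blast
        moreover have "p ` V \<inter> path_image (c {s, i}) = {p s, p i}" using verts[OF s(3)] by blast
        ultimately have "t = p s \<or> t = p i" using t abV by blast
        moreover have "t \<noteq> p i"
        proof
          assume "t = p i"
          then have "p i = p a \<or> p i = p b" using \<open>t \<in> {p a, p b}\<close> by blast
          then have "i = a \<or> i = b" using inj_on_eq_iff[OF inj] s(2) IV abV by blast
          then show False using s(2) IU unfolding setU by blast
        qed
        ultimately show "t \<in> {p s}" by blast
      qed
      then show ?thesis by blast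
    qed
    have "p i \<noteq> p s"
    proof
      assume "p i = p s"
      then have "i = s" using inj_on_eq_iff[OF inj] s(1,2) IV abV by blast
      then show False using s(3) irreflA by blast
    qed
    then have pi: "p i \<in> ?E" using edge_mem[OF s(3)] by blast
    have "connected_component (- ?J) (p i) z"
      unfolding connected_component_def using edge_minus_end[OF s(3)] EJ pi s(5,6) by blast
    moreover have "connected_component (- ?J) (p x3) (p i)"
      by (rule toT) (use s(2) in \<open>auto simp: drawn_def T_def\<close>)
    ultimately show ?thesis using connected_component_trans by metis
  qed
  show False
  proof (rule theta_outsider[OF g1(1) g2(1) g1(2) g2(2) g1(3) g2(3) g12 K1 Kg1 Kg2, of "p x3" O1 O2])
    fix z assume z: "z \<in> K - {p a, p b}"
    have "z \<in> drawn T RT \<or> (\<exists>s i. s \<in> {a, b} \<and> i \<in> ?I \<and> (s, i) \<in> A \<and> (s, i) \<in> RK \<and> z \<in> path_image (c {s, i}) \<and> z \<noteq> p s)"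
    proof -
      from z consider (1) i where "i \<in> ?I" "z = p i" | (2) u v where "(u, v) \<in> RI" "z \<in> path_image (c {u, v})"
        | (3) "z \<in> path_image (c {a, i1})" | (4) "z \<in> path_image (c {b, i2})"
        unfolding K_def drawn_def RK_def by (auto simp: insert_commute)
      then show ?thesis
      proof cases
        case 1 then show ?thesis unfolding drawn_def T_def by blast
      next
        case 2
        then have "(u, v) \<in> RT" unfolding RI_def RT_def T_def by blast
        then show ?thesis using 2(2) unfolding drawn_def by blast
      next
        case 3
        have "(a, i1) \<in> RK" unfolding RK_def by blast
        then show ?thesis using 3 i1 z by blast
      next
        case 4
        have "(b, i2) \<in> RK" unfolding RK_def by blast
        then show ?thesis using 4 i2 z by blast
      qed
    qed
    then show "connected_component (- ?J) (p x3) z" using toT spike by blast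
  qed (use g1 g2 g12 K1 Kg1 Kg2 O1(1) O2(1) qO O1K O2K O1g O2g in auto)
qed

end

section \<open>The main theorem\<close>

lemma vertex_degree_nbrs: "pair_graph G \<Longrightarrow> vertex_degree G v = card (nbrs (parcs G) (pverts G) v)"
proof -
  assume "pair_graph G"
  then interpret pair_graph G .
  have "out_arcs (with_proj G) v = (\<lambda>x. (v, x)) ` nbrs (parcs G) (pverts G) v"
    using arc_snd_in_verts unfolding out_arcs_def nbrs_def by force
  then show ?thesis unfolding vertex_degree_def out_degree_def by (simp add: card_image inj_on_def)
qed

lemma pair_graph_arcs:
  assumes "pair_graph G"
  shows "finite (pverts G)" "parcs G \<subseteq> pverts G \<times> pverts G" "sym (parcs G)" "(x, x) \<notin> parcs G"
proof -
  interpret pair_graph G by (rule assms)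
  show "finite (pverts G)" by (rule pair_finite_verts)
  show "parcs G \<subseteq> pverts G \<times> pverts G" using arc_fst_in_verts arc_snd_in_verts by force
  show "sym (parcs G)" using pair_sym_arcs unfolding symmetric_def by simp
  show "(x, x) \<notin> parcs G" using pair_no_loops[of "(x, x)"] by auto
qed

text \<open>With fewer than three boundary vertices the graph without them would be connected,
  although a walk that starts in S and avoids the boundary never leaves S.\<close>

lemma three_connected_bound:
  assumes G: "pair_graph G" "k_connected 3 G" and S: "S \<subseteq> pverts G" "S \<noteq> {}" "pverts G - S - bound (parcs G) S \<noteq> {}"
  shows "3 \<le> card (bound (parcs G) S)"
proof (rule ccontr)
  interpret pair_graph G by (rule G(1))
  let ?N = "bound (parcs G) S" and ?V = "pverts G"
  assume "\<not> 3 \<le> card ?N"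
  moreover have "?N \<subseteq> ?V" using arc_snd_in_verts unfolding bound_def touch_def by force
  ultimately have c: "Digraph_Component.connected (with_proj G \<restriction> (?V - ?N))" using G(2) unfolding k_connected_def by simp
  obtain u where u: "u \<in> S" using S by blast
  obtain v where v: "v \<in> ?V" "v \<notin> S" "v \<notin> ?N" using S by blast
  let ?H = "mk_symmetric (with_proj G \<restriction> (?V - ?N))"
  have H: "pverts ?H = ?V - ?N"
    "parcs ?H = {(x, y). x \<in> ?V - ?N \<and> y \<in> ?V - ?N \<and> ((x, y) \<in> parcs G \<or> (y, x) \<in> parcs G)}"
    unfolding mk_symmetric_def induce_subgraph_def by auto
  have "u \<in> ?V - ?N" using u S(1) unfolding bound_def by blast
  then have "(u, v) \<in> rtrancl_on (?V - ?N) (parcs ?H)"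
    using c v H(1) unfolding Digraph_Component.connected_def strongly_connected_def reachable_def by auto
  then have "v \<in> S"
  proof (induction rule: rtrancl_on_induct)
    case base then show ?case using u by simp
  next
    case (step y z)
    then have "(y, z) \<in> parcs G \<or> (z, y) \<in> parcs G" unfolding H(2) by blast
    then have "(y, z) \<in> parcs G" using pair_sym_arcs unfolding symmetric_def by (auto elim: symE)
    then show ?case using step unfolding bound_def touch_def by blast
  qed
  then show False using v by blast
qed

lemma planar_k33_free:
  assumes G: "pair_graph G" "planar G"
  shows "k33_free (parcs G)"
proof -
  obtain p c where d: "plane_drawing G p c" using G(2) unfolding planar_def by blast
  have e: "{u, v} \<in> edges G" if "(u, v) \<in> parcs G" for u v using that unfolding edges_def by blast
  note d' = d[unfolded plane_drawing_def]
  note d1 = d'[THEN conjunct1] and d2 = d'[THEN conjunct2, THEN conjunct1, rule_format]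
    and d3 = d'[THEN conjunct2, THEN conjunct2, rule_format]
  interpret drawing "pverts G" "parcs G" p c
  proof
    show "finite (pverts G)" "parcs G \<subseteq> pverts G \<times> pverts G" "sym (parcs G)" "(x, x) \<notin> parcs G" for x
      by (rule pair_graph_arcs[OF G(1)])+
    fix u v assume uv: "(u, v) \<in> parcs G"
    show "arc (c {u, v})" "{pathstart (c {u, v}), pathfinish (c {u, v})} = {p u, p v}"
      "path_image (c {u, v}) \<inter> p ` pverts G = {p u, p v}" using d2[OF e[OF uv]] by simp_all
    fix u' v' assume "(u', v') \<in> parcs G" "{u, v} \<noteq> {u', v'}"
    then show "path_image (c {u, v}) \<inter> path_image (c {u', v'}) = p ` ({u, v} \<inter> {u', v'})"
      by (intro d3 e uv)
  qed (rule d1)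
  show ?thesis by (rule k33_free_drawing)
qed

theorem theorem4:
  fixes G :: "'a pair_pre_digraph"
  assumes "pair_graph G"
    and "k_connected 3 G"
    and "\<not> complete_graph G"
    and "planar G"
  shows "degree_truncated_DP_colourable TYPE('b) 16 G"
  unfolding degree_truncated_DP_colourable_def DP_colourable_def
proof (intro allI impI)
  note G = pair_graph_arcs[OF assms(1)]
  let ?V = "pverts G" and ?A = "parcs G"
  fix L :: "'a \<Rightarrow> 'b set" and M
  assume f: "f_cover (\<lambda>v. min 16 (vertex_degree G v)) G L M"
  have dis: "u = v" if "u \<in> ?V" "v \<in> ?V" "\<alpha> \<in> L u" "\<alpha> \<in> L v" for u v \<alpha>
    using f that unfolding f_cover_def cover_def disjoint_family_on_def by blast
  have mat: "matching_between (L u) (L v) (M {u, v})" if "(u, v) \<in> ?A" for u v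
    using f that unfolding f_cover_def cover_def by blast
  have AV: "u \<in> ?V" "v \<in> ?V" if "(u, v) \<in> ?A" for u v
    using G(2) that by auto
  note symA = G(3)
  \<comment> \<open>Lists may be infinite, whereas counting needs finite ones; a colouring from
    sublists is also one from the lists.\<close>
  have "\<exists>S. finite S \<and> S \<subseteq> L v \<and> min 16 (vertex_degree G v) \<le> card S" if "v \<in> ?V" for v
  proof (cases "finite (L v)")
    case True then show ?thesis using f that unfolding f_cover_def by blast
  next
    case False
    then show ?thesis using infinite_arbitrarily_large[OF False, of "min 16 (vertex_degree G v)"] by auto
  qed
  then obtain L1 where L1: "\<And>v. v \<in> ?V \<Longrightarrow> finite (L1 v) \<and> L1 v \<subseteq> L v \<and> min 16 (vertex_degree G v) \<le> card (L1 v)"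
    by metis
  define L' where "L' v = (if v \<in> ?V then L1 v else {})" for v
  have L': "finite (L' v)" "L' v \<subseteq> L v" for v using L1 unfolding L'_def by auto
  have cL': "min 16 (card (nbrs ?A ?V v)) \<le> card (L' v)" if "v \<in> ?V" for v
    using L1[OF that] that vertex_degree_nbrs[OF assms(1)] unfolding L'_def by simp
  \<comment> \<open>As the lists are disjoint, colours determine their vertices, so a single
    relation can hold all matchings; \<open>CM\<close> recovers the matching of an edge from
    it.\<close>
  define C where "C = {(\<alpha>, \<beta>). \<exists>(u, v) \<in> ?A. \<alpha> \<in> L u \<and> \<beta> \<in> L v \<and> {\<alpha>, \<beta>} \<in> M {u, v}}"
  have symC: "sym C"
  proof (rule symI)
    fix \<alpha> \<beta> assume "(\<alpha>, \<beta>) \<in> C"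
    then obtain u v where "(u, v) \<in> ?A" "\<alpha> \<in> L u" "\<beta> \<in> L v" "{\<alpha>, \<beta>} \<in> M {u, v}" unfolding C_def by blast
    then have "(v, u) \<in> ?A" "{\<beta>, \<alpha>} \<in> M {v, u}" using symD[OF symA] by (simp_all add: insert_commute)
    then show "(\<beta>, \<alpha>) \<in> C" using \<open>\<alpha> \<in> L u\<close> \<open>\<beta> \<in> L v\<close> unfolding C_def by blast
  qed
  have CM: "{\<alpha>, \<beta>} \<in> M {u, v}" if uv: "(u, v) \<in> ?A" "\<alpha> \<in> L u" "\<beta> \<in> L v" and C: "(\<alpha>, \<beta>) \<in> C" for u v \<alpha> \<beta>
  proof -
    obtain u' v' where u': "(u', v') \<in> ?A" "\<alpha> \<in> L u'" "\<beta> \<in> L v'" "{\<alpha>, \<beta>} \<in> M {u', v'}"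
      using C unfolding C_def by blast
    have "u' = u" by (rule dis[OF AV(1)[OF u'(1)] AV(1)[OF uv(1)] u'(2) uv(2)])
    moreover have "v' = v" by (rule dis[OF AV(2)[OF u'(1)] AV(2)[OF uv(1)] u'(3) uv(3)])
    ultimately show ?thesis using u'(4) by simp
  qed
  \<comment> \<open>Below degree 16 the truncated list size is the full degree; from degree 16 on it
    is 16.\<close>
  let ?B = "{v \<in> ?V. 16 \<le> card (nbrs ?A ?V v)}"
  interpret T: truncated_cover ?A L' C ?V ?B
  proof
    show "sym ?A" "sym C" by (rule symA, rule symC)
    show "(x, x) \<notin> ?A" for x by (rule G(4))
    show "finite (L' v)" for v by (rule L')
    show "\<beta> = \<beta>'" if "(u, v) \<in> ?A" "\<alpha> \<in> L' u" "\<beta> \<in> L' v" "\<beta>' \<in> L' v" "(\<alpha>, \<beta>) \<in> C" "(\<alpha>, \<beta>') \<in> C" for u v \<alpha> \<beta> \<beta>'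
    proof -
      have m: "{\<alpha>, \<beta>} \<in> M {u, v}" "{\<alpha>, \<beta>'} \<in> M {u, v}" using CM[OF that(1)] that(2-6) L'(2) by blast+
      have pd: "pairwise disjnt (M {u, v})" using mat[OF that(1)] unfolding matching_between_def by simp
      have "{\<alpha>, \<beta>} = {\<alpha>, \<beta>'}"
      proof (rule ccontr)
        assume "{\<alpha>, \<beta>} \<noteq> {\<alpha>, \<beta>'}"
        from pairwiseD[OF pd m this] show False by (simp add: disjnt_def)
      qed
      then show ?thesis by (auto simp: doubleton_eq_iff)
    qed
    show "finite ?V" "?A \<subseteq> ?V \<times> ?V" by (rule G)+
    show "?B \<subseteq> ?V" by blast
    show "card (nbrs ?A ?V y) \<le> card (L' y)" if "y \<in> ?V - ?B" for y using cL'[of y] that by auto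
    show "16 \<le> card (L' b)" if "b \<in> ?B" for b using cL'[of b] that by auto
    show "k33_free ?A" by (rule planar_k33_free[OF assms(1,4)])
    show "3 \<le> card (bound ?A S)" if "S \<subseteq> ?V" "S \<noteq> {}" "?V - S - bound ?A S \<noteq> {}" for S
      by (rule three_connected_bound[OF assms(1,2) that])
  qed
  have "4 \<le> card ?V" using assms(2) unfolding k_connected_def by simp
  moreover obtain u v where "u \<in> ?V" "v \<in> ?V" "u \<noteq> v" "(u, v) \<notin> ?A"
  proof -
    have "?A \<noteq> {(u, v). (u, v) \<in> ?V \<times> ?V \<and> u \<noteq> v}"
      using assms(3) G(1) unfolding complete_graph_def complete_digraph_pair_def by blast
    moreover have "?A \<subseteq> {(u, v). (u, v) \<in> ?V \<times> ?V \<and> u \<noteq> v}" using G(2,4) by auto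
    ultimately show ?thesis using that by blast
  qed
  ultimately obtain \<phi> where \<phi>: "T.proper ?V L' \<phi>" using T.colourable_all by blast
  have "cover_colouring G L M \<phi>"
    unfolding cover_colouring_def
  proof (intro conjI ballI)
    show "\<phi> v \<in> L v" if "v \<in> ?V" for v using \<phi> L'(2) that unfolding T.proper_def by blast
    then show "case e of (u, v) \<Rightarrow> {\<phi> u, \<phi> v} \<notin> M {u, v}" if e: "e \<in> ?A" for e
    proof -
      obtain u v where uv: "e = (u, v)" "(u, v) \<in> ?A" using e by (cases e) auto
      have "(\<phi> u, \<phi> v) \<notin> C" using \<phi> uv AV unfolding T.proper_def by blast
      then have "{\<phi> u, \<phi> v} \<notin> M {u, v}"
        using \<open>\<And>v. v \<in> ?V \<Longrightarrow> \<phi> v \<in> L v\<close> uv(2) AV[OF uv(2)] unfolding C_def by blast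
      then show ?thesis using uv by simp
    qed
  qed
  then show "\<exists>\<phi>. cover_colouring G L M \<phi>" by blast
qed

end
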